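(* Let $g\in C^\infty(B_1^m,\mathbb{R})$ be nonnegative and not identically zero, and let $f_0=[[g]]+[[-g]]\in\mathcal{Y}_2(B_1^m,\mathbb{Q}_2(\mathbb{R}))$. For $h>0$ let $(f_h^k)_{k\ge0}$ be the step minimizing sequence with $f_h^0=f_0$: for each $k\ge1$, $f_h^k$ minimizes $$G(f_h^{k-1},u,h)=\mathrm{Dir}(u;B_1^m)+\frac{1}{h/2^k}\int_{B_1^m}\mathcal{G}^2(f_h^{k-1},u)\,dx$$ over $u\in\mathcal{M}$. Write $f_h^k(x)=[[\tilde f_h^k(x)]]+[[-\tilde f_h^k(x)]]$ with $\tilde f_h^k\ge0$. Then $$\tilde f_h^k(x)>0,\qquad x\in(B_1^m)^\circ,\ k=1,2,\dots.$$ In particular, $f_h^k(x)\ne2[[0]]$ for any $x\in(B_1^m)^\circ$ and $k=1,2,\dots$.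
   Context: $\mathbb{Q}_2(\mathbb{R})$ is the set of unordered pairs $[[a]]+[[b]]$, $a,b\in\mathbb{R}$, with metric $\mathcal{G}([[a_1]]+[[a_2]],[[b_1]]+[[b_2]])=\min_\sigma(\sum_i|a_i-b_{\sigma(i)}|^2)^{1/2}$ over permutations $\sigma$ of $\{1,2\}$; $2[[0]]=[[0]]+[[0]]$. Let $\xi:\mathbb{Q}_2(\mathbb{R})\to\mathbb{R}^2$, $\xi([[a]]+[[b]])=(\min(a,b),\max(a,b))$; this is an isometric embedding. $B_1^m=\{x\in\mathbb{R}^m:|x|\le1\}$ with interior $(B_1^m)^\circ$. $\mathcal{Y}_2(B_1^m,\mathbb{Q}_2(\mathbb{R}))$ is the set of $f:B_1^m\to\mathbb{Q}_2(\mathbb{R})$ with $\xi\circ f$ square summable with square summable distributional first derivatives, and $\mathrm{Dir}(f;B_1^m)=\int_{B_1^m}|D(\xi\circ f)|^2$. A function $f$ with values in $\mathbb{Q}_2(\mathbb{R})$ is strictly defined if $\xi\circ f(x)=y$ whenever the averages of $|\xi\circ f-y|$ over $B^m(x,r)$ tend to $0$ as $r\downarrow0$. $\mathcal{M}$ is the set of strictly defined $u\in\mathcal{Y}_2(B_1^m,\mathbb{Q}_2(\mathbb{R}))$ with $u=f_0$ on $\partial B_1^m$, i.e. $\xi\circ u$ and $\xi\circ f_0$ have the same boundary values (traces) on $\partial B_1^m$. Minimizers $f_h^k$ exist for all $k\ge1$, $h>0$, and under the stated assumptions they are of the symmetric form $[[\tilde f_h^k]]+[[-\tilde f_h^k]]$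 with $\tilde f_h^k\ge0$ smooth on $B_1^m$. *)

theory Defs
  imports "HOL-Analysis.Analysis" "HOL-Library.Uprod"
begin

section \<open>The space of unordered pairs of reals\<close>

text \<open>
  The unordered pair \<open>[[a]] + [[b]]\<close> is \<^term>\<open>Upair a b\<close>; in particular \<open>2[[0]]\<close> is
  \<^term>\<open>Upair 0 0 :: real uprod\<close>. The two terms in the minimum below belong to the two
  permutations of \<open>{1, 2}\<close>.
\<close>

lift_definition Q2_dist :: "real uprod \<Rightarrow> real uprod \<Rightarrow> real" is
  "\<lambda>(a1, a2) (b1, b2). min (sqrt (\<bar>a1 - b1\<bar>\<^sup>2 + \<bar>a2 - b2\<bar>\<^sup>2)) (sqrt (\<bar>a1 - b2\<bar>\<^sup>2 + \<bar>a2 - b1\<bar>\<^sup>2))"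
  by (auto simp: min.commute add.commute)

lift_definition xi :: "real uprod \<Rightarrow> real \<times> real" is
  "\<lambda>(a, b). (min a b, max a b)"
  by (auto simp: min.commute max.commute)

lemma Q2_dist_Upair [simp]:
  "Q2_dist (Upair a1 a2) (Upair b1 b2) =
     min (sqrt (\<bar>a1 - b1\<bar>\<^sup>2 + \<bar>a2 - b2\<bar>\<^sup>2)) (sqrt (\<bar>a1 - b2\<bar>\<^sup>2 + \<bar>a2 - b1\<bar>\<^sup>2))"
  by transfer simp

lemma xi_Upair [simp]: "xi (Upair a b) = (min a b, max a b)"
  by transfer simp

lemma Q2_dist_eq_dist_xi: "Q2_dist p q = dist (xi p) (xi q)"
proof -
  have rearr: "Q2_dist (Upair a b) (Upair c d) = dist (xi (Upair a b)) (xi (Upair c d))"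
    if "a \<le> b" "c \<le> d" for a b c d
  proof -
    have "0 \<le> (b - a) * (d - c)"
      using that by simp
    then have "(a - c)\<^sup>2 + (b - d)\<^sup>2 \<le> (a - d)\<^sup>2 + (b - c)\<^sup>2"
      by (simp add: power2_eq_square algebra_simps)
    then show ?thesis
      using that by (simp add: dist_Pair_Pair dist_real_def min_def max_def)
  qed
  have ordered: "\<exists>a b. r = Upair a b \<and> a \<le> b" for r :: "real uprod"
  proof (cases r)
    case (Upair a b)
    then show ?thesis
      by (metis Upair_inject linear)
  qed
  from ordered[of p] ordered[of q] show ?thesis
    using rearr by blast
qed


section \<open>Smooth functions\<close>

abbreviation partial_deriv ::
    "'m::finite \<Rightarrow> (real ^ 'm \<Rightarrow> 'b::real_normed_vector) \<Rightarrow> real ^ 'm \<Rightarrow> 'b"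
  where "partial_deriv i f x \<equiv> frechet_derivative f (at x) (axis i 1)"

text \<open>\<open>Ck_on n U f\<close>, for open \<open>U\<close>: the function \<open>f\<close> is of class \<open>C\<^sup>n\<close> on \<open>U\<close>.\<close>

primrec Ck_on ::
    "nat \<Rightarrow> (real ^ 'm::finite) set \<Rightarrow> (real ^ 'm \<Rightarrow> 'b::real_normed_vector) \<Rightarrow> bool"
  where
    "Ck_on 0 U f \<longleftrightarrow> continuous_on U f"
  | "Ck_on (Suc n) U f \<longleftrightarrow>
       (\<forall>x\<in>U. f differentiable (at x)) \<and> (\<forall>i. Ck_on n U (partial_deriv i f))"

definition smooth_on_open ::
    "(real ^ 'm::finite) set \<Rightarrow> (real ^ 'm \<Rightarrow> 'b::real_normed_vector) \<Rightarrow> bool"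
  where "smooth_on_open U f \<longleftrightarrow> open U \<and> (\<forall>n. Ck_on n U f)"

text \<open>
  Smoothness on a set that need not be open, such as a closed ball, is the existence of a
  smooth extension to an open neighbourhood.
\<close>

definition smooth_on ::
    "(real ^ 'm::finite) set \<Rightarrow> (real ^ 'm \<Rightarrow> 'b::real_normed_vector) \<Rightarrow> bool"
  where "smooth_on A f \<longleftrightarrow> (\<exists>U f'. A \<subseteq> U \<and> smooth_on_open U f' \<and> (\<forall>x\<in>A. f' x = f x))"

definition test_function :: "(real ^ 'm::finite) set \<Rightarrow> (real ^ 'm \<Rightarrow> real) \<Rightarrow> bool"
  where "test_function U \<phi> \<longleftrightarrow>
    smooth_on_open UNIV \<phi> \<and> compact (closure {x. \<phi> x \<noteq> 0}) \<and> closure {x. \<phi> x \<noteq> 0} \<subseteq> U"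


section \<open>Square summable functions and distributional derivatives\<close>

definition square_summable ::
    "(real ^ 'm::finite) set \<Rightarrow> (real ^ 'm \<Rightarrow> 'b::euclidean_space) \<Rightarrow> bool"
  where "square_summable A F \<longleftrightarrow>
    F \<in> borel_measurable (lebesgue_on A) \<and> integrable (lebesgue_on A) (\<lambda>x. (norm (F x))\<^sup>2)"

text \<open>The function \<open>F'\<close> is the distributional derivative of \<open>F\<close> on \<open>U\<close> in direction \<open>i\<close>.\<close>

definition has_weak_partial ::
    "(real ^ 'm::finite) set \<Rightarrow> 'm \<Rightarrow> (real ^ 'm \<Rightarrow> 'b::euclidean_space) \<Rightarrow> (real ^ 'm \<Rightarrow> 'b) \<Rightarrow> bool"
  where "has_weak_partial U i F F' \<longleftrightarrow>
    (\<forall>\<phi>. test_function U \<phi> \<longrightarrow>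
      (LINT x|lebesgue_on U. partial_deriv i \<phi> x *\<^sub>R F x) = - (LINT x|lebesgue_on U. \<phi> x *\<^sub>R F' x))"

text \<open>The choice below is unique up to null sets whenever a square summable derivative exists.\<close>

definition weak_partial ::
    "(real ^ 'm::finite) set \<Rightarrow> 'm \<Rightarrow> (real ^ 'm \<Rightarrow> 'b::euclidean_space) \<Rightarrow> real ^ 'm \<Rightarrow> 'b"
  where "weak_partial U i F = (SOME F'. square_summable U F' \<and> has_weak_partial U i F F')"


section \<open>The class \<open>Y\<^sub>2\<close> and the Dirichlet integral on the unit ball\<close>

text \<open>
  Functions on the closed unit ball are represented by total functions whose values outside
  \<^term>\<open>cball 0 1\<close> are irrelevant. Distributional derivatives live on the open ball; the sphere
  is a null set.
\<close>

definition Y2 :: "(real ^ 'm::finite \<Rightarrow> real uprod) set"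
  where "Y2 = {f. square_summable (cball 0 1) (xi \<circ> f) \<and>
    (\<forall>i. \<exists>F'. square_summable (ball 0 1) F' \<and> has_weak_partial (ball 0 1) i (xi \<circ> f) F')}"

definition Dir :: "(real ^ 'm::finite \<Rightarrow> real uprod) \<Rightarrow> real"
  where "Dir f =
    (LINT x|lebesgue_on (ball 0 1). (\<Sum>i\<in>UNIV. (norm (weak_partial (ball 0 1) i (xi \<circ> f) x))\<^sup>2))"

text \<open>
  The condition is imposed at interior points, where small balls around \<open>x\<close> lie inside the domain.
\<close>

definition strictly_defined :: "(real ^ 'm::finite \<Rightarrow> real uprod) \<Rightarrow> bool"
  where "strictly_defined f \<longleftrightarrow>
    (\<forall>x\<in>ball 0 1. \<forall>y.
      ((\<lambda>r. (LINT z|lebesgue_on (cball x r). norm (xi (f z) - y)) / measure lebesgue (cball x r))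
        \<longlongrightarrow> 0) (at_right 0) \<longrightarrow> xi (f x) = y)"


section \<open>Traces on the unit sphere\<close>

text \<open>
  The surface measure on the Borel sets of the unit sphere: the measure of \<open>A\<close> is \<open>m\<close> times the
  volume of the cone \<open>{x. 0 < norm x < 1 \<and> x / norm x \<in> A}\<close>, where \<open>m\<close> is the dimension.
\<close>

definition sphere_measure :: "(real ^ 'm::finite) measure"
  where "sphere_measure =
    scale_measure (of_nat CARD('m))
      (distr (lebesgue_on (ball 0 1 - {0})) (restrict_space borel (sphere 0 1)) (\<lambda>x. x /\<^sub>R norm x))"

lemma measurable_radial_projection:
  "(\<lambda>x. x /\<^sub>R norm x) \<in> lebesgue_on (ball 0 1 - {0}) \<rightarrow>\<^sub>M restrict_space borel (sphere (0 :: real ^ 'm::finite) 1)"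
proof (rule measurable_restrict_space2)
  show "(\<lambda>x. x /\<^sub>R norm x) \<in> space (lebesgue_on (ball 0 1 - {0})) \<rightarrow> sphere (0 :: real ^ 'm) 1"
    by (auto simp: space_restrict_space)
  have "(\<lambda>x. x /\<^sub>R norm x) \<in> borel_measurable (borel :: (real ^ 'm) measure)"
    by measurable
  then have "(\<lambda>x. x /\<^sub>R norm x) \<in> borel_measurable (lebesgue :: (real ^ 'm) measure)"
    by (simp add: measurable_completion)
  then show "(\<lambda>x. x /\<^sub>R norm x) \<in> borel_measurable (lebesgue_on (ball (0 :: real ^ 'm) 1 - {0}))"
    by (rule measurable_restrict_space1)
qed

lemma emeasure_sphere_measure:
  fixes A :: "(real ^ 'm::finite) set"
  assumes "A \<in> sets borel" and "A \<subseteq> sphere 0 1"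
  shows "emeasure sphere_measure A =
    of_nat CARD('m) * emeasure lebesgue {x. 0 < norm x \<and> norm x < 1 \<and> x /\<^sub>R norm x \<in> A}"
proof -
  have A: "A \<in> sets (restrict_space borel (sphere 0 1))"
    using assms by (simp add: sets_restrict_space_iff)
  have eq: "(\<lambda>x. x /\<^sub>R norm x) -` A \<inter> (ball 0 1 - {0}) =
      {x. 0 < norm x \<and> norm x < 1 \<and> x /\<^sub>R norm x \<in> A}"
    by auto
  have "emeasure (lebesgue_on (ball 0 1 - {0})) {x. 0 < norm x \<and> norm x < 1 \<and> x /\<^sub>R norm x \<in> A} =
      emeasure lebesgue {x. 0 < norm x \<and> norm x < 1 \<and> x /\<^sub>R norm x \<in> A}"
    by (rule emeasure_restrict_space) auto
  then show ?thesis
    unfolding sphere_measure_def emeasure_scale_measure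
      emeasure_distr[OF measurable_radial_projection A]
    by (simp add: space_restrict_space eq del: zero_less_norm_iff)
qed

text \<open>
  The trace operator is the continuous extension, from the functions smooth up to the boundary
  with the \<open>W\<^sup>1\<^sup>,\<^sup>2\<close> norm on the ball to the square integrable functions on the sphere, of the
  restriction to the sphere; \<open>has_trace F T\<close> describes its graph.
\<close>

definition has_trace ::
    "(real ^ 'm::finite \<Rightarrow> 'b::euclidean_space) \<Rightarrow> (real ^ 'm \<Rightarrow> 'b) \<Rightarrow> bool"
  where "has_trace F T \<longleftrightarrow>
    T \<in> borel_measurable sphere_measure \<and> integrable sphere_measure (\<lambda>x. (norm (T x))\<^sup>2) \<and>
    (\<exists>V. (\<forall>n::nat. smooth_on (cball 0 1) (V n)) \<and>
      (\<lambda>n. LINT x|lebesgue_on (ball 0 1). (norm (V n x - F x))\<^sup>2) \<longlonglongrightarrow> 0 \<and>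
      (\<forall>i. (\<lambda>n. LINT x|lebesgue_on (ball 0 1).
              (norm (partial_deriv i (V n) x - weak_partial (ball 0 1) i F x))\<^sup>2) \<longlonglongrightarrow> 0) \<and>
      (\<lambda>n. LINT x|sphere_measure. (norm (V n x - T x))\<^sup>2) \<longlonglongrightarrow> 0)"

definition same_trace ::
    "(real ^ 'm::finite \<Rightarrow> 'b::euclidean_space) \<Rightarrow> (real ^ 'm \<Rightarrow> 'b) \<Rightarrow> bool"
  where "same_trace F F' \<longleftrightarrow> (\<exists>T. has_trace F T \<and> has_trace F' T)"


section \<open>Step minimizing sequences\<close>

definition admissible ::
    "(real ^ 'm::finite \<Rightarrow> real uprod) \<Rightarrow> (real ^ 'm \<Rightarrow> real uprod) set"
  where "admissible f0 = {u \<in> Y2. strictly_defined u \<and> same_trace (xi \<circ> u) (xi \<circ> f0)}"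

definition step_functional ::
    "nat \<Rightarrow> (real ^ 'm::finite \<Rightarrow> real uprod) \<Rightarrow> (real ^ 'm \<Rightarrow> real uprod) \<Rightarrow> real \<Rightarrow> real"
  where "step_functional k v u h =
    Dir u + 1 / (h / 2 ^ k) * (LINT x|lebesgue_on (cball 0 1). (Q2_dist (v x) (u x))\<^sup>2)"

definition step_minimizing_sequence ::
    "(real ^ 'm::finite \<Rightarrow> real uprod) \<Rightarrow> real \<Rightarrow> (nat \<Rightarrow> real ^ 'm \<Rightarrow> real uprod) \<Rightarrow> bool"
  where "step_minimizing_sequence f0 h f \<longleftrightarrow>
    (\<forall>x\<in>cball 0 1. f 0 x = f0 x) \<and>
    (\<forall>k\<ge>1. is_arg_min (\<lambda>u. step_functional k (f (k - 1)) u h) (\<lambda>u. u \<in> admissible f0) (f k))"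

end

theory Submission
  imports Defs "HOL-Computational_Algebra.Polynomial"
begin

text \<open>
  Replacing a competitor \<open>(a, b)\<close>, \<open>a \<le> b\<close>, by its antisymmetric part \<open>((a - b)/2, (b - a)/2)\<close> does not
  increase the energy, so a minimizer is \<open>(- z, z)\<close> with \<open>z \<ge> 0\<close>. Adding \<open>t \<phi>\<close> with \<open>\<phi> \<ge> 0\<close> shows
  that \<open>z\<close> is a weak supersolution of \<open>- \<Delta> z + c z = c w\<close>, where \<open>w\<close> is the preceding step. Averages
  \<open>A(x, r)\<close> of \<open>z\<close> against the radial kernel \<open>2 q'(1 - |y - x|\<^sup>2/r\<^sup>2) / r\<^sup>m\<close>, \<open>q(s) = exp(-1/s)\<close>, satisfy
  \<open>\<partial>A/\<partial>r = r \<integral> z \<Delta>Q\<close> for the bump \<open>Q = q(1 - |y - x|\<^sup>2/r\<^sup>2) / r\<^sup>m\<close>, and \<open>Q\<close> is at most half of the kernel.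
  Hence \<open>exp(- c r\<^sup>2/4) A(x, r)\<close> decreases in \<open>r\<close>, which is a strong minimum principle: \<open>z\<close> is locally
  bounded below by a positive constant. The order constraint is then inactive and \<open>z\<close> solves the
  equation. The same formula for \<open>\<partial>A/\<partial>r\<close> now bounds \<open>z\<close> locally from above and makes \<open>A(x, r)\<close> converge
  locally uniformly as \<open>r\<close> tends to \<open>0\<close>, so \<open>z\<close> has a continuous representative. Strictly defined functions
  agree with it everywhere, and the next step can be treated in the same way.
\<close>

section \<open>Smooth bump functions\<close>

text \<open>The obstacle is that competitors must remain ordered pairs. A variation that lowers
  \<open>z\<close> is admissible only where \<open>z\<close> is known to exceed a positive constant,
  so at the outset there is an inequality and no equation, and \<open>z\<close> is a square summable
  class without reliable point values. Positivity has to come out of the one-sided inequality,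
  through averages whose companion kernels \<open>Q\<close> are themselves legitimate test
  functions. The two kernels are made for each other. If \<open>K\<close> is the averaging kernel,
  the gradient of \<open>Q\<close> is \<open>-(y - x) K / r^2\<close>, while dilation gives
  \<open>dK/dr = - div ((y - x) K) / r\<close>; hence \<open>dK/dr\<close> is \<open>r\<close> times
  the Laplacian of \<open>Q\<close>. The profile \<open>exp (-1/s)\<close> is not only smooth across
  0: its derivative is the function itself times \<open>1/s^2\<close>, so it is dominated by its
  derivative for \<open>s \<le> 1\<close>. This bounds the radial derivative of an average by the
  same average and closes the differential inequality. Besides square summability, each step hands
  on continuity, nonnegativity and nontriviality of the representing function, exactly what the
  minimum principle asks of the preceding step.\<close>

lemma partial_deriv_eq:
  assumes "(f has_derivative D) (at x)"
  shows "partial_deriv i f x = D (axis i 1)"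
  using frechet_derivative_at[OF assms] by simp

text \<open>Openness of \<open>U\<close> makes this work: the derivative at a point of
  \<open>U\<close> sees only nearby values, all taken in \<open>U\<close>, so agreement passes to
  the partial derivatives and the induction can continue.\<close>

lemma Ck_on_cong:
  fixes f g :: "real ^ 'm::finite \<Rightarrow> 'b::real_normed_vector"
  assumes "open U" "Ck_on n U f" "\<And>x. x \<in> U \<Longrightarrow> f x = g x"
  shows "Ck_on n U g"
  using assms(2,3)
proof (induction n arbitrary: f g)
  case 0
  then show ?case by (auto cong: continuous_on_cong)
next
  case (Suc n)
  have D: "(g has_derivative frechet_derivative f (at x)) (at x)" if "x \<in> U" for x
  proof (rule has_derivative_transform_within_open[OF _ assms(1) that])
    show "(f has_derivative frechet_derivative f (at x)) (at x)"
      using Suc.prems that by (simp add: frechet_derivative_works[symmetric])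
  qed (use Suc.prems in auto)
  have "Ck_on n U (partial_deriv i g)" for i
    by (rule Suc.IH[of "partial_deriv i f"]) (use Suc.prems in \<open>auto simp: partial_deriv_eq[OF D]\<close>)
  then show ?case using D by (auto intro: differentiableI)
qed

lemma Ck_on_bounded_linear:
  fixes f :: "real ^ 'm::finite \<Rightarrow> 'b::real_normed_vector"
  assumes "bounded_linear L" "open U" "Ck_on n U f"
  shows "Ck_on n U (\<lambda>x. L (f x))"
  using assms(3)
proof (induction n arbitrary: f)
  case 0
  then show ?case
    using bounded_linear.continuous_on[OF assms(1)] by simp
next
  case (Suc n)
  have D: "((\<lambda>x. L (f x)) has_derivative (\<lambda>v. L (frechet_derivative f (at x) v))) (at x)"
    if "x \<in> U" for x
    by (rule bounded_linear.has_derivative[OF assms(1)])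
      (use Suc.prems that in \<open>simp add: frechet_derivative_works[symmetric]\<close>)
  have "Ck_on n U (partial_deriv i (\<lambda>x. L (f x)))" for i
    by (rule Ck_on_cong[OF assms(2) Suc.IH[of "partial_deriv i f"]])
      (use Suc.prems in \<open>auto simp: partial_deriv_eq[OF D]\<close>)
  then show ?case using D by (auto intro: differentiableI)
qed

lemma Ck_on_add:
  fixes f g :: "real ^ 'm::finite \<Rightarrow> 'b::real_normed_vector"
  assumes "open U" "Ck_on n U f" "Ck_on n U g"
  shows "Ck_on n U (\<lambda>x. f x + g x)"
  using assms(2,3)
proof (induction n arbitrary: f g)
  case 0
  then show ?case by (auto intro: continuous_intros)
next
  case (Suc n)
  have D: "((\<lambda>x. f x + g x) has_derivative
      (\<lambda>v. frechet_derivative f (at x) v + frechet_derivative g (at x) v)) (at x)"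
    if "x \<in> U" for x
    by (rule has_derivative_add) (use Suc.prems that in \<open>simp_all add: frechet_derivative_works[symmetric]\<close>)
  have "Ck_on n U (partial_deriv i (\<lambda>x. f x + g x))" for i
    by (rule Ck_on_cong[OF assms(1) Suc.IH[of "partial_deriv i f" "partial_deriv i g"]])
      (use Suc.prems in \<open>auto simp: partial_deriv_eq[OF D]\<close>)
  then show ?case using D by (auto intro: differentiableI)
qed

lemma Ck_on_subset: "Ck_on n U f \<Longrightarrow> V \<subseteq> U \<Longrightarrow> Ck_on n V f"
  by (induction n arbitrary: f) (auto intro: continuous_on_subset)

lemma smooth_on_open_differentiable:
  "smooth_on_open U f \<Longrightarrow> x \<in> U \<Longrightarrow> f differentiable (at x)"
  unfolding smooth_on_open_def by (metis Ck_on.simps(2))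

lemma smooth_on_open_has_derivative:
  "smooth_on_open U f \<Longrightarrow> x \<in> U \<Longrightarrow> (f has_derivative frechet_derivative f (at x)) (at x)"
  using smooth_on_open_differentiable frechet_derivative_works by blast

lemma smooth_on_open_partial_deriv:
  "smooth_on_open U f \<Longrightarrow> smooth_on_open U (partial_deriv i f)"
  unfolding smooth_on_open_def by (metis Ck_on.simps(2))

lemma smooth_on_open_continuous_on: "smooth_on_open U f \<Longrightarrow> continuous_on U f"
  unfolding smooth_on_open_def by (metis Ck_on.simps(1))

text \<open>All derivatives of \<open>exp (-1/s)\<close> are of the form \<open>P (1/s) exp (-1/s)\<close> with a polynomial \<open>P\<close>.\<close>

definition bump :: "real poly \<Rightarrow> real \<Rightarrow> real"
  where "bump P s = (if s \<le> 0 then 0 else poly P (1 / s) * exp (- (1 / s)))"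

text \<open>With \<open>t = 1/s\<close> both factors are differentiated through
  \<open>dt/ds = - t^2\<close>, which turns \<open>P(t) exp(-t)\<close> into
  \<open>t^2 (P - P')(t) exp(-t)\<close>.\<close>

definition bump_step :: "real poly \<Rightarrow> real poly"
  where "bump_step P = [:0, 0, 1:] * (P - pderiv P)"

lemma poly_times_exp_tendsto_0: "((\<lambda>t. poly P t * exp (- t :: real)) \<longlongrightarrow> 0) at_top"
proof -
  have "((\<lambda>t. (\<Sum>i\<le>degree P. coeff P i * (t ^ i / exp t))) \<longlongrightarrow> (\<Sum>i\<le>degree P. coeff P i * 0)) at_top"
    by (intro tendsto_sum tendsto_mult tendsto_const tendsto_power_div_exp_0)
  also have "(\<lambda>t. (\<Sum>i\<le>degree P. coeff P i * (t ^ i / exp t))) = (\<lambda>t. poly P t * exp (- t))"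
    by (simp add: poly_altdef sum_distrib_right exp_minus divide_inverse mult.assoc)
  finally show ?thesis by simp
qed

lemma bump_tendsto_0: "(bump P \<longlongrightarrow> 0) (at 0)"
proof (rule filterlim_split_at)
  show "(bump P \<longlongrightarrow> 0) (at_left 0)"
    by (rule tendsto_eventually) (auto simp: bump_def eventually_at_filter)
  have "((\<lambda>s. poly P (inverse s) * exp (- inverse s :: real)) \<longlongrightarrow> 0) (at_right 0)"
    by (rule filterlim_compose[OF poly_times_exp_tendsto_0 filterlim_inverse_at_top_right])
  moreover have "eventually (\<lambda>s. poly P (inverse s) * exp (- inverse s :: real) = bump P s) (at_right 0)"
    by (auto simp: bump_def eventually_at_filter divide_inverse)
  ultimately show "(bump P \<longlongrightarrow> 0) (at_right 0)"
    by (rule Lim_transform_eventually)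
qed

lemma bump_has_derivative: "(bump P has_real_derivative bump (bump_step P) s) (at s)"
proof -
  consider "s < 0" | "s > 0" | "s = 0" by linarith
  then show ?thesis
  proof cases
    case 1
    show ?thesis
      by (rule DERIV_cong[OF has_field_derivative_transform_within_open[of "\<lambda>_. 0" 0 s "{..<0}"]])
        (use 1 in \<open>auto simp: bump_def\<close>)
  next
    case 2
    have "((\<lambda>s. poly P (1 / s) * exp (- (1 / s))) has_real_derivative bump (bump_step P) s) (at s)"
      using 2 by (auto intro!: derivative_eq_intros poly_DERIV[THEN DERIV_chain2]
        simp: bump_def bump_step_def field_simps power2_eq_square)
    then show ?thesis
      by (rule has_field_derivative_transform_within_open[of _ _ s "{0<..}"])
        (use 2 in \<open>auto simp: bump_def\<close>)
  next
    case 3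
    \<comment> \<open>At 0 the difference quotient is again a bump, with the polynomial multiplied
      by \<open>t = 1/h\<close>, so the limit already known for all bumps gives the
      derivative.\<close>
    have eq: "bump P h / h = bump ([:0, 1:] * P) h" if "h \<noteq> 0" for h
      using that by (auto simp: bump_def field_simps)
    have "((\<lambda>h. bump P h / h) \<longlongrightarrow> 0) (at 0)"
      by (rule Lim_transform_eventually[OF bump_tendsto_0[of "[:0,1:] * P"]])
        (auto simp: eventually_at_filter eq)
    then show ?thesis
      using 3 by (simp add: DERIV_def bump_def)
  qed
qed

text \<open>A class of functions closed under partial derivatives, so that smoothness of every order
  follows by one induction. Fixing \<open>x\<close> and \<open>b\<close> keeps the radial argument
  the same throughout; differentiation only changes \<open>P\<close> and produces polynomial factors
  in the coordinates.\<close>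

inductive_set bump_alg :: "real ^ 'm::finite \<Rightarrow> real \<Rightarrow> (real ^ 'm \<Rightarrow> real) set" for x b where
  const: "(\<lambda>_. c) \<in> bump_alg x b"
| coord: "(\<lambda>y. y $ i) \<in> bump_alg x b"
| bump: "(\<lambda>y. bump P (1 - b * (norm (y - x))\<^sup>2)) \<in> bump_alg x b"
| add: "f \<in> bump_alg x b \<Longrightarrow> g \<in> bump_alg x b \<Longrightarrow> (\<lambda>y. f y + g y) \<in> bump_alg x b"
| mult: "f \<in> bump_alg x b \<Longrightarrow> g \<in> bump_alg x b \<Longrightarrow> (\<lambda>y. f y * g y) \<in> bump_alg x b"

lemma norm_power2_has_derivative:
  "((\<lambda>y. (norm (y - x))\<^sup>2) has_derivative (\<lambda>v. 2 * ((y - x) \<bullet> v))) (at y)"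
  for x :: "'a::real_inner"
  unfolding power2_norm_eq_inner by (auto intro!: derivative_eq_intros simp: inner_commute)

lemma radial_bump_has_derivative:
  "((\<lambda>y. bump P (1 - b * (norm (y - x))\<^sup>2)) has_derivative
     (\<lambda>v. bump (bump_step P) (1 - b * (norm (y - x))\<^sup>2) * (- 2 * b * ((y - x) \<bullet> v)))) (at y)"
  for x :: "'a::real_inner"
proof -
  have "((\<lambda>y. 1 - b * (norm (y - x))\<^sup>2) has_derivative (\<lambda>v. - 2 * b * ((y - x) \<bullet> v))) (at y)"
    using has_derivative_diff[OF has_derivative_const
        has_derivative_mult_right[OF norm_power2_has_derivative, of b x y]]
    by (simp add: mult.assoc mult.left_commute)
  from DERIV_compose_FDERIV[OF bump_has_derivative this, of P] show ?thesis
    by (simp add: mult.commute mult.left_commute)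
qed

lemma radial_bump_partial:
  "partial_deriv i (\<lambda>y. bump P (1 - b * (norm (y - x))\<^sup>2)) y =
     bump (bump_step P) (1 - b * (norm (y - x))\<^sup>2) * (- 2 * b * (y $ i - x $ i))"
  by (subst partial_deriv_eq[OF radial_bump_has_derivative]) (simp add: inner_axis)

lemma bump_alg_deriv:
  assumes "f \<in> bump_alg x b"
  shows "(\<forall>y. f differentiable (at y)) \<and> (\<forall>i. partial_deriv i f \<in> bump_alg x b)"
  using assms
proof induction
  case (const c)
  have "partial_deriv i (\<lambda>_. c) = (\<lambda>_. 0)" for i :: 'a
    by (rule ext, subst partial_deriv_eq[OF has_derivative_const]) simp
  then show ?case by (auto intro: bump_alg.const)
next
  case (coord j)
  have D: "((\<lambda>y. y $ j) has_derivative (\<lambda>v. v $ j)) (at y)" for y :: "real ^ 'a"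
    by (rule bounded_linear_imp_has_derivative) (rule bounded_linear_vec_nth)
  then have "partial_deriv i (\<lambda>y :: real ^ 'a. y $ j) = (\<lambda>_. axis i 1 $ j)" for i
    by (intro ext) (rule partial_deriv_eq)
  then show ?case using D by (auto intro: bump_alg.const differentiableI)
next
  case (bump P)
  have "partial_deriv i (\<lambda>y. bump P (1 - b * (norm (y - x))\<^sup>2)) =
     (\<lambda>y. bump (bump_step P) (1 - b * (norm (y - x))\<^sup>2) * ((- 2 * b) * (y $ i + (- x $ i))))" for i
    by (rule ext, subst radial_bump_partial) simp
  then have "partial_deriv i (\<lambda>y. bump P (1 - b * (norm (y - x))\<^sup>2)) \<in> bump_alg x b" for i
    by (simp only:) (intro bump_alg.intros)
  then show ?case
    using radial_bump_has_derivative differentiableI by blast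
next
  case (add f g)
  have D: "((\<lambda>y. f y + g y) has_derivative
      (\<lambda>v. frechet_derivative f (at y) v + frechet_derivative g (at y) v)) (at y)" for y
    by (rule has_derivative_add) (use add in \<open>simp_all add: frechet_derivative_works[symmetric]\<close>)
  have "partial_deriv i (\<lambda>y. f y + g y) = (\<lambda>y. partial_deriv i f y + partial_deriv i g y)" for i
    by (rule ext, subst partial_deriv_eq[OF D]) simp
  then show ?case using add D by (auto intro!: bump_alg.add differentiableI)
next
  case (mult f g)
  have D: "((\<lambda>y. f y * g y) has_derivative
      (\<lambda>v. f y * frechet_derivative g (at y) v + frechet_derivative f (at y) v * g y)) (at y)" for y
    by (rule has_derivative_mult) (use mult in \<open>simp_all add: frechet_derivative_works[symmetric]\<close>)
  have "partial_deriv i (\<lambda>y. f y * g y) =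
      (\<lambda>y. f y * partial_deriv i g y + partial_deriv i f y * g y)" for i
    by (rule ext, subst partial_deriv_eq[OF D]) simp
  then show ?case using mult D by (auto intro!: bump_alg.add bump_alg.mult differentiableI)
qed

lemma bump_alg_smooth: "f \<in> bump_alg x b \<Longrightarrow> smooth_on_open UNIV f"
proof -
  have "f \<in> bump_alg x b \<Longrightarrow> Ck_on n UNIV f" for n
  proof (induction n arbitrary: f)
    case 0
    then show ?case
      using bump_alg_deriv[of f x b]
      by (auto intro!: continuous_at_imp_continuous_on differentiable_imp_continuous_within)
  next
    case (Suc n)
    then show ?case using bump_alg_deriv[of f x b] by auto
  qed
  then show "f \<in> bump_alg x b \<Longrightarrow> ?thesis" by (simp add: smooth_on_open_def)
qed


section \<open>Test functions and integration by parts\<close>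

lemma partial_deriv_zero_outside_support:
  assumes "x \<notin> closure {x. \<phi> x \<noteq> 0}"
  shows "partial_deriv i \<phi> x = 0"
proof -
  have "(\<phi> has_derivative (\<lambda>_. 0)) (at x)"
  proof (rule has_derivative_transform_within_open[OF has_derivative_const])
    show "open (- closure {x. \<phi> x \<noteq> 0})" by (rule open_Compl) simp
    show "x \<in> - closure {x. \<phi> x \<noteq> 0}" using assms by simp
    show "0 = \<phi> y" if "y \<in> - closure {x. \<phi> x \<noteq> 0}" for y
      using that closure_subset[of "{x. \<phi> x \<noteq> 0}"] by auto
  qed
  then show ?thesis by (rule partial_deriv_eq)
qed

lemma closure_support_partial_deriv:
  "closure {x. partial_deriv i \<phi> x \<noteq> 0} \<subseteq> closure {x. \<phi> x \<noteq> 0}"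
  by (rule closure_minimal) (use partial_deriv_zero_outside_support[of _ \<phi>] in blast, simp)

lemma test_function_partial_deriv:
  assumes "test_function U \<phi>"
  shows "test_function U (partial_deriv i \<phi>)"
proof -
  have "compact (closure {x. partial_deriv i \<phi> x \<noteq> 0})"
    using assms closure_support_partial_deriv[where i = i and \<phi> = \<phi>] unfolding test_function_def
    by (metis bounded_subset closed_closure compact_eq_bounded_closed)
  then show ?thesis
    using assms closure_support_partial_deriv[where i = i and \<phi> = \<phi>] smooth_on_open_partial_deriv
    unfolding test_function_def by blast
qed

lemma integrable_lborel_compact_support:
  fixes f :: "'a::euclidean_space \<Rightarrow> 'b::euclidean_space"
  assumes "continuous_on UNIV f" "compact K" "\<And>x. x \<notin> K \<Longrightarrow> f x = 0"
  shows "integrable lborel f"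
proof -
  have "integrable lborel (\<lambda>x. indicator K x *\<^sub>R f x)"
    using assms by (intro borel_integrable_compact) (auto intro: continuous_on_subset)
  also have "(\<lambda>x. indicator K x *\<^sub>R f x) = f"
    using assms(3) by (auto simp: indicator_def)
  finally show ?thesis .
qed

text \<open>By translation invariance all difference quotients have integral zero.\<close>

lemma integral_partial_deriv_zero:
  fixes f :: "real ^ 'm::finite \<Rightarrow> real"
  assumes diff: "\<And>x. f differentiable (at x)" and cont: "continuous_on UNIV (partial_deriv i f)"
    and K: "compact K" "\<And>x. x \<notin> K \<Longrightarrow> f x = 0"
  shows "(LINT x|lborel. partial_deriv i f x) = 0"
proof -
  define e :: "real ^ 'm" where "e = axis i 1"
  have [simp]: "norm e = 1" by (simp add: e_def norm_axis_1)
  have contf: "continuous_on UNIV f"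
    using diff by (auto intro!: continuous_at_imp_continuous_on differentiable_imp_continuous_within)
  have line: "((\<lambda>t. f (x + t *\<^sub>R e)) has_real_derivative partial_deriv i f (x + t *\<^sub>R e)) (at t)" for x t
  proof -
    have "(f has_derivative frechet_derivative f (at (x + t *\<^sub>R e))) (at (x + t *\<^sub>R e))"
      using diff frechet_derivative_works by blast
    moreover have "((\<lambda>t. x + t *\<^sub>R e) has_derivative (\<lambda>s. s *\<^sub>R e)) (at t)"
      by (auto intro!: derivative_eq_intros)
    ultimately have *: "((\<lambda>t. f (x + t *\<^sub>R e)) has_derivative
        (\<lambda>s. frechet_derivative f (at (x + t *\<^sub>R e)) (s *\<^sub>R e))) (at t)"
      by (rule has_derivative_compose[rotated])
    have "linear (frechet_derivative f (at (x + t *\<^sub>R e)))"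
      using diff linear_frechet_derivative by blast
    then have "(\<lambda>s. frechet_derivative f (at (x + t *\<^sub>R e)) (s *\<^sub>R e)) = (*) (partial_deriv i f (x + t *\<^sub>R e))"
      by (auto simp: linear_cmul e_def)
    then show ?thesis using * by (simp add: has_field_derivative_def)
  qed
  obtain R where R: "R > 0" "K \<subseteq> cball 0 R"
    using bounded_subset_ballD[OF compact_imp_bounded[OF K(1)], of 0] ball_subset_cball by blast
  \<comment> \<open>The quotients below vanish outside radius \<open>R + 1\<close>, because their
    step is at most 1, and the intermediate point of the mean value theorem lies at most 1 further
    out; hence the radius \<open>R + 2\<close>.\<close>
  have "compact (partial_deriv i f ` cball 0 (R + 2))"
    using cont by (intro compact_continuous_image) (auto intro: continuous_on_subset)
  then have "bounded (partial_deriv i f ` cball 0 (R + 2))" by (rule compact_imp_bounded)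
  then obtain M where M: "\<And>x. norm x \<le> R + 2 \<Longrightarrow> \<bar>partial_deriv i f x\<bar> \<le> M"
    unfolding bounded_iff by (metis image_eqI mem_cball_0 real_norm_def)
  have "0 \<le> M" using M[of 0] R by (simp add: abs_ge_zero order_trans)
  define D where "D n x = (f (x + (1 / Suc n) *\<^sub>R e) - f x) / (1 / Suc n)" for n x
  have intf: "integrable lborel f"
    by (rule integrable_lborel_compact_support[OF contf K])
  have fm [measurable]: "f \<in> borel_measurable borel" using contf by (rule borel_measurable_continuous_onI)
  have shift: "integrable lborel (\<lambda>x. f (x + c))" "(LINT x|lborel. f (x + c)) = (LINT x|lborel. f x)" for c
  proof -
    have "integrable (distr lborel borel ((+) c)) f" using intf by (simp add: lborel_distr_plus)
    then show "integrable lborel (\<lambda>x. f (x + c))"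
      by (subst (asm) integrable_distr_eq) (auto simp: add.commute)
    have "(LINT x|lborel. f x) = (LINT x|distr lborel borel ((+) c). f x)" by (simp add: lborel_distr_plus)
    also have "\<dots> = (LINT x|lborel. f (x + c))"
      by (subst integral_distr) (auto simp: add.commute)
    finally show "(LINT x|lborel. f (x + c)) = (LINT x|lborel. f x)" ..
  qed
  have D0: "(LINT x|lborel. D n x) = 0" for n
    unfolding D_def using shift intf by simp
  have "(\<lambda>n. LINT x|lborel. D n x) \<longlonglongrightarrow> (LINT x|lborel. partial_deriv i f x)"
  proof (rule integral_dominated_convergence[where w = "\<lambda>x. indicator (cball 0 (R + 1)) x * M"])
    show "partial_deriv i f \<in> borel_measurable lborel"
      using borel_measurable_continuous_onI[OF cont] by simp
    show "D n \<in> borel_measurable lborel" for n unfolding D_def by measurable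
    have "emeasure lborel (cball (0::real^'m) (R + 1)) < \<infinity>"
      by (intro emeasure_bounded_finite) auto
    then show "integrable lborel (\<lambda>x. indicator (cball (0::real^'m) (R + 1)) x * M)"
      by (intro integrable_mult_left integrable_real_indicator) auto
    show "AE x in lborel. (\<lambda>n. D n x) \<longlonglongrightarrow> partial_deriv i f x"
    proof (rule AE_I2)
      fix x
      have "((\<lambda>h. (f (x + h *\<^sub>R e) - f x) / h) \<longlongrightarrow> partial_deriv i f x) (at 0)"
        using line[of x 0] by (simp add: DERIV_def)
      moreover have "filterlim (\<lambda>n. 1 / real (Suc n)) (at 0) sequentially"
        using LIMSEQ_inverse_real_of_nat by (simp add: filterlim_at inverse_eq_divide del: of_nat_Suc)
      ultimately show "(\<lambda>n. D n x) \<longlonglongrightarrow> partial_deriv i f x"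
        unfolding D_def by (rule filterlim_compose)
    qed
    show "AE x in lborel. norm (D n x) \<le> indicator (cball 0 (R + 1)) x * M" for n
    proof (rule AE_I2)
      fix x
      let ?h = "1 / real (Suc n)"
      have h: "0 < ?h" "?h \<le> 1" by auto
      show "norm (D n x) \<le> indicator (cball 0 (R + 1)) x * M"
      proof (cases "norm x \<le> R + 1")
        case True
        obtain t where t: "0 < t" "t < ?h"
          "f (x + ?h *\<^sub>R e) - f (x + 0 *\<^sub>R e) = (?h - 0) * partial_deriv i f (x + t *\<^sub>R e)"
          using MVT2[OF h(1) line] by blast
        have "norm (x + t *\<^sub>R e) \<le> norm x + norm (t *\<^sub>R e)" by (rule norm_triangle_ineq)
        then have "norm (x + t *\<^sub>R e) \<le> norm x + t" using t by simp
        then have "norm (x + t *\<^sub>R e) \<le> R + 2" using True t(2) h(2) by linarith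
        then show ?thesis using True t(3) M h by (simp add: D_def)
      next
        case False
        have "norm x \<le> norm (x + ?h *\<^sub>R e) + norm (?h *\<^sub>R e)"
          by (metis add_diff_cancel_right' norm_triangle_ineq4)
        then have "norm x \<le> norm (x + ?h *\<^sub>R e) + ?h" by simp
        then have "norm (x + ?h *\<^sub>R e) > R" using False h(2) by linarith
        then have "x + ?h *\<^sub>R e \<notin> K" "x \<notin> K" using R(2) False by auto
        then have "f (x + ?h *\<^sub>R e) = 0" "f x = 0" by (auto intro: K(2))
        then show ?thesis using False by (simp add: D_def)
      qed
    qed
  qed
  then show ?thesis using D0 by (simp add: LIMSEQ_const_iff)
qed

lemma integral_lebesgue_on_borel:
  fixes f :: "'a::euclidean_space \<Rightarrow> 'b::euclidean_space"
  assumes "f \<in> borel_measurable borel" "U \<in> sets borel" "\<And>x. x \<notin> U \<Longrightarrow> f x = 0"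
  shows "(LINT x|lebesgue_on U. f x) = (LINT x|lborel. f x)"
proof -
  have "(LINT x|lebesgue_on U. f x) = (LINT x|lebesgue. indicator U x *\<^sub>R f x)"
    using assms by (subst integral_restrict_space) auto
  also have "(\<lambda>x. indicator U x *\<^sub>R f x) = f"
    using assms(3) by (auto simp: indicator_def)
  finally show ?thesis using assms by (simp add: integral_completion)
qed

text \<open>The product of \<open>\<phi>\<close> with a test function has compact support, so the
  integral of its partial derivative vanishes, and the product rule splits this into the two sides
  of the claim.\<close>

lemma has_weak_partial_smooth:
  fixes \<phi> :: "real ^ 'm::finite \<Rightarrow> real" and e :: "'b::euclidean_space"
  assumes "open U" and \<phi>: "smooth_on_open UNIV \<phi>"
  shows "has_weak_partial U i (\<lambda>x. \<phi> x *\<^sub>R e) (\<lambda>x. partial_deriv i \<phi> x *\<^sub>R e)"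
  unfolding has_weak_partial_def
proof (intro allI impI)
  fix \<eta> assume \<eta>: "test_function U \<eta>"
  define K where "K = closure {x. \<eta> x \<noteq> 0}"
  have s\<eta>: "smooth_on_open UNIV \<eta>" and K: "compact K" "K \<subseteq> U"
    using \<eta> by (auto simp: test_function_def K_def)
  have out: "\<eta> x = 0" "partial_deriv i \<eta> x = 0" if "x \<notin> K" for x
    using that closure_subset[of "{x. \<eta> x \<noteq> 0}"] partial_deriv_zero_outside_support[of x \<eta> i]
    by (auto simp: K_def)
  have D: "((\<lambda>x. \<eta> x * \<phi> x) has_derivative
      (\<lambda>v. \<eta> x * frechet_derivative \<phi> (at x) v + frechet_derivative \<eta> (at x) v * \<phi> x)) (at x)" for x
    by (intro has_derivative_mult smooth_on_open_has_derivative[OF s\<eta>] smooth_on_open_has_derivative[OF \<phi>]) auto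
  have pd: "partial_deriv i (\<lambda>x. \<eta> x * \<phi> x) = (\<lambda>x. \<eta> x * partial_deriv i \<phi> x + partial_deriv i \<eta> x * \<phi> x)"
    by (rule ext, subst partial_deriv_eq[OF D]) simp
  note c = smooth_on_open_continuous_on[OF s\<eta>] smooth_on_open_continuous_on[OF \<phi>]
    smooth_on_open_continuous_on[OF smooth_on_open_partial_deriv[OF s\<eta>], of i]
    smooth_on_open_continuous_on[OF smooth_on_open_partial_deriv[OF \<phi>], of i]
  have cont: "continuous_on UNIV (\<lambda>x. \<eta> x * partial_deriv i \<phi> x)"
    "continuous_on UNIV (\<lambda>x. partial_deriv i \<eta> x * \<phi> x)"
    by (rule continuous_on_mult; rule c)+
  have "(LINT x|lborel. partial_deriv i (\<lambda>x. \<eta> x * \<phi> x) x) = 0"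
  proof (rule integral_partial_deriv_zero[OF _ _ K(1)])
    show "(\<lambda>x. \<eta> x * \<phi> x) differentiable (at x)" for x using D by (rule differentiableI)
    show "continuous_on UNIV (partial_deriv i (\<lambda>x. \<eta> x * \<phi> x))"
      unfolding pd by (rule continuous_on_add[OF cont])
  qed (simp add: out)
  moreover have i1: "integrable lborel (\<lambda>x. \<eta> x * partial_deriv i \<phi> x)"
    by (rule integrable_lborel_compact_support[OF cont(1) K(1)]) (simp add: out)
  moreover have i2: "integrable lborel (\<lambda>x. partial_deriv i \<eta> x * \<phi> x)"
    by (rule integrable_lborel_compact_support[OF cont(2) K(1)])
      (simp add: out)
  ultimately have eq: "(LINT x|lborel. partial_deriv i \<eta> x * \<phi> x) = - (LINT x|lborel. \<eta> x * partial_deriv i \<phi> x)"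
    by (simp add: pd)
  have "(LINT x|lebesgue_on U. partial_deriv i \<eta> x *\<^sub>R \<phi> x *\<^sub>R e) =
      (LINT x|lborel. (partial_deriv i \<eta> x * \<phi> x) *\<^sub>R e)"
    unfolding scaleR_scaleR
  proof (rule integral_lebesgue_on_borel)
    show "(\<lambda>x. (partial_deriv i \<eta> x * \<phi> x) *\<^sub>R e) \<in> borel_measurable borel"
      by (intro borel_measurable_continuous_onI continuous_on_scaleR cont continuous_on_const)
    show "(partial_deriv i \<eta> x * \<phi> x) *\<^sub>R e = 0" if "x \<notin> U" for x
      using that K(2) out[of x] by auto
  qed (use \<open>open U\<close> in simp)
  moreover have "(LINT x|lebesgue_on U. \<eta> x *\<^sub>R partial_deriv i \<phi> x *\<^sub>R e) =
      (LINT x|lborel. (\<eta> x * partial_deriv i \<phi> x) *\<^sub>R e)"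
    unfolding scaleR_scaleR
  proof (rule integral_lebesgue_on_borel)
    show "(\<lambda>x. (\<eta> x * partial_deriv i \<phi> x) *\<^sub>R e) \<in> borel_measurable borel"
      by (intro borel_measurable_continuous_onI continuous_on_scaleR cont continuous_on_const)
    show "(\<eta> x * partial_deriv i \<phi> x) *\<^sub>R e = 0" if "x \<notin> U" for x
      using that K(2) out[of x] by auto
  qed (use \<open>open U\<close> in simp)
  ultimately show "(LINT x|lebesgue_on U. partial_deriv i \<eta> x *\<^sub>R \<phi> x *\<^sub>R e) =
      - (LINT x|lebesgue_on U. \<eta> x *\<^sub>R partial_deriv i \<phi> x *\<^sub>R e)"
    using eq i1 i2 by simp
qed


section \<open>Lebesgue points\<close>

lemma integrable_lebesgue_on_subset:
  fixes F :: "'a::euclidean_space \<Rightarrow> 'b::euclidean_space"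
  assumes "integrable (lebesgue_on U) F" "U \<in> sets lebesgue" "V \<in> sets lebesgue" "V \<subseteq> U"
  shows "integrable (lebesgue_on V) F"
  using set_integrable_subset[of lebesgue U F V] assms
  by (simp add: integrable_restrict_space set_integrable_def)

text \<open>A Vitali covering argument. The measure \<open>\<nu>\<close> with density the positive
  part of \<open>f - b\<close> does not charge \<open>S\<close>, so outer regularity provides an
  open set around \<open>S\<close> of small \<open>\<nu>\<close>-measure. Vitali yields disjoint
  balls in it with average above \<open>b\<close> that cover the exceptional set up to a null set.
  On each such ball \<open>f\<close> must make up on the rest what it loses on \<open>S\<close>, so
  \<open>\<nu>\<close> of the ball is at least \<open>b - a\<close> times the volume of its part in
  \<open>S\<close>; summation bounds the total volume.\<close>

lemma negligible_upper_derivate: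
  fixes f :: "'a::euclidean_space \<Rightarrow> real"
  assumes f [measurable]: "f \<in> borel_measurable borel" and int: "integrable lborel f"
    and "0 \<le> b" "a < b"
  shows "negligible {x. f x < a \<and> (\<forall>d>0. \<exists>r. 0 < r \<and> r < d \<and>
    b * measure lebesgue (cball x r) < (LINT z:cball x r|lborel. f z))}" (is "negligible ?E")
  unfolding negligible_outer_le
proof (intro allI impI)
  fix e :: real assume "e > 0"
  define S where "S = {x. f x < a}"
  have S [measurable]: "S \<in> sets borel" unfolding S_def by measurable
  define \<nu> where "\<nu> = density lborel (\<lambda>x. ennreal (f x - b))"
  have sets_\<nu>: "sets \<nu> = sets borel" by (simp add: \<nu>_def)
  have pos: "integrable lborel (\<lambda>x. max 0 (f x - b))"
    by (rule Bochner_Integration.integrable_bound[OF int]) (use \<open>0 \<le> b\<close> in auto)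
  have ennreal_max: "ennreal (f x - b) = ennreal (max 0 (f x - b))" for x
    by (simp add: max_def ennreal_neg)
  have "emeasure \<nu> UNIV = (\<integral>\<^sup>+x. ennreal (max 0 (f x - b)) \<partial>lborel)"
    by (simp add: \<nu>_def emeasure_density flip: ennreal_max)
  also have "\<dots> \<noteq> \<infinity>"
    using pos by (subst nn_integral_eq_integral) auto
  finally have fin: "emeasure \<nu> (space \<nu>) \<noteq> \<infinity>" by (simp add: \<nu>_def)
  have "emeasure \<nu> S = (\<integral>\<^sup>+x. 0 \<partial>(lborel :: 'a measure))"
    unfolding \<nu>_def
    by (subst emeasure_density, simp, simp, rule nn_integral_cong)
      (use \<open>a < b\<close> in \<open>auto simp: S_def indicator_def ennreal_neg\<close>)
  then have "emeasure \<nu> S = 0" by simp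
  then have "(INF U \<in> {U. S \<subseteq> U \<and> open U}. emeasure \<nu> U) < ennreal (e * (b - a))"
    using outer_regular[OF sets_\<nu> fin S] \<open>e > 0\<close> \<open>a < b\<close> by simp
  then obtain U where U: "S \<subseteq> U" "open U" "emeasure \<nu> U < ennreal (e * (b - a))"
    by (auto simp: INF_less_iff)
  have [measurable]: "U \<in> sets borel" using U by auto
  define K where "K = {(x, r). 0 < r \<and> cball x r \<subseteq> U \<and>
    b * measure lebesgue (cball x r) < (LINT z:cball x r|lborel. f z)}"
  obtain C where C: "countable C" "C \<subseteq> K"
     "pairwise (\<lambda>i j. disjnt (cball (fst i) (snd i)) (cball (fst j) (snd j))) C"
     "negligible (?E - (\<Union>i \<in> C. cball (fst i) (snd i)))"
  proof (rule Vitali_covering_theorem_cballs[of K snd ?E fst])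
    show "0 < snd i" if "i \<in> K" for i using that by (auto simp: K_def)
    fix x d assume x: "x \<in> ?E" and "(0::real) < d"
    then have "x \<in> U" using U by (auto simp: S_def)
    then obtain d' where d': "d' > 0" "cball x d' \<subseteq> U"
      using \<open>open U\<close> open_contains_cball by blast
    have "0 < min d d'" using d' \<open>0 < d\<close> by simp
    then obtain r where "0 < r" and r: "r < min d d'"
      and "b * measure lebesgue (cball x r) < (LINT z:cball x r|lborel. f z)"
      using x by blast
    moreover have "cball x r \<subseteq> U" using d' r subset_cball[of r d' x] by auto
    ultimately show "\<exists>i. i \<in> K \<and> x \<in> cball (fst i) (snd i) \<and> snd i < d"
      by (intro exI[of _ "(x, r)"]) (use r in \<open>auto simp: K_def\<close>)
  qed (use that in blast)
  let ?B = "\<lambda>i. cball (fst i) (snd i) :: 'a set"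
  have disj: "disjoint_family_on ?B C"
    using C(3) by (auto simp: pairwise_def disjnt_def disjoint_family_on_def)
  then have disjS: "disjoint_family_on (\<lambda>i. ?B i \<inter> S) C"
    unfolding disjoint_family_on_def by blast
  have le: "ennreal (b - a) * emeasure lborel (?B i \<inter> S) \<le> emeasure \<nu> (?B i)" if "i \<in> C" for i
  proof -
    have fin_B: "emeasure lborel (?B i) < \<infinity>"
      by (intro emeasure_bounded_finite) auto
    have fin_S: "emeasure lborel (?B i \<inter> S) < \<infinity>"
      by (rule le_less_trans[OF emeasure_mono fin_B]) auto
    have i1: "integrable lborel (\<lambda>z. indicator (?B i) z * f z)"
      using integrable_mult_indicator[OF _ int, of "?B i"] by simp
    have i2: "integrable lborel (\<lambda>z. indicator (?B i) z * max 0 (f z - b))"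
      using integrable_mult_indicator[OF _ pos, of "?B i"] by simp
    have i3: "integrable lborel (\<lambda>z. indicator (?B i \<inter> S) z * (b - a))"
      using fin_S by (intro integrable_mult_left integrable_real_indicator) auto
    have i4: "integrable lborel (\<lambda>z. indicator (?B i) z * b)"
      using fin_B by (intro integrable_mult_left integrable_real_indicator) auto
    have "b * measure lborel (?B i) < (\<integral>z. indicator (?B i) z * f z \<partial>lborel)"
      using C(2) that by (auto simp: K_def set_lebesgue_integral_def)
    \<comment> \<open>Pointwise \<open>f\<close> is at most \<open>b\<close> plus the positive part
      of \<open>f - b\<close>, and on \<open>S\<close>, where \<open>f < a\<close> and that positive
      part is 0, there is \<open>b - a\<close> to spare.\<close>
    also have "\<dots> \<le> (\<integral>z. indicator (?B i) z * b + (indicator (?B i) z * max 0 (f z - b)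
        - indicator (?B i \<inter> S) z * (b - a)) \<partial>lborel)"
      by (intro integral_mono Bochner_Integration.integrable_add Bochner_Integration.integrable_diff i1 i2 i3 i4)
        (use \<open>a < b\<close> in \<open>auto simp: S_def indicator_def max_def\<close>)
    also have "\<dots> = measure lborel (?B i) * b + ((\<integral>z. indicator (?B i) z * max 0 (f z - b) \<partial>lborel)
        - measure lborel (?B i \<inter> S) * (b - a))"
      using i2 i3 i4 by simp
    finally have "(b - a) * measure lborel (?B i \<inter> S) \<le> (\<integral>z. indicator (?B i) z * max 0 (f z - b) \<partial>lborel)"
      by (simp add: algebra_simps)
    then have "ennreal ((b - a) * measure lborel (?B i \<inter> S)) \<le>
        ennreal (\<integral>z. indicator (?B i) z * max 0 (f z - b) \<partial>lborel)"
      by (rule ennreal_leI)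
    also have "\<dots> = (\<integral>\<^sup>+z. ennreal (indicator (?B i) z * max 0 (f z - b)) \<partial>lborel)"
      by (rule nn_integral_eq_integral[symmetric, OF i2]) auto
    also have "\<dots> = emeasure \<nu> (?B i)"
      unfolding \<nu>_def by (subst emeasure_density, simp, simp, rule nn_integral_cong)
        (auto simp: indicator_def simp flip: ennreal_max)
    also have "ennreal ((b - a) * measure lborel (?B i \<inter> S)) = ennreal (b - a) * emeasure lborel (?B i \<inter> S)"
      using \<open>a < b\<close> fin_S by (simp add: ennreal_mult emeasure_eq_ennreal_measure)
    finally show ?thesis .
  qed
  define T where "T = (\<Union>i\<in>C. ?B i \<inter> S)"
  have T [measurable]: "T \<in> sets borel"
    unfolding T_def using C(1) by (intro sets.countable_UN') auto
  have "ennreal (b - a) * emeasure lborel T = ennreal (b - a) * (\<integral>\<^sup>+i. emeasure lborel (?B i \<inter> S) \<partial>count_space C)"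
    unfolding T_def using disjS by (subst emeasure_UN_countable) (auto simp: C(1))
  also have "\<dots> = (\<integral>\<^sup>+i. ennreal (b - a) * emeasure lborel (?B i \<inter> S) \<partial>count_space C)"
    by (rule nn_integral_cmult[symmetric]) simp
  also have "\<dots> \<le> (\<integral>\<^sup>+i. emeasure \<nu> (?B i) \<partial>count_space C)"
    by (rule nn_integral_mono) (use le in auto)
  also have "\<dots> = emeasure \<nu> (\<Union>i\<in>C. ?B i)"
    by (rule emeasure_UN_countable[symmetric]) (use disj C(1) in \<open>auto simp: sets_\<nu>\<close>)
  also have "\<dots> \<le> emeasure \<nu> U"
  proof (rule emeasure_mono)
    have "?B i \<subseteq> U" if "i \<in> K" for i using that by (auto simp: K_def split: prod.splits)
    then show "(\<Union>i\<in>C. ?B i) \<subseteq> U" using C(2) by blast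
  qed (simp add: sets_\<nu>)
  also have "\<dots> \<le> ennreal (b - a) * ennreal e"
    using U(3) \<open>a < b\<close> \<open>e > 0\<close> by (simp add: ennreal_mult mult.commute less_imp_le)
  finally have Te: "emeasure lborel T \<le> ennreal e"
    using \<open>a < b\<close> by (simp add: ennreal_mult_le_mult_iff)
  let ?N = "?E - (\<Union>i\<in>C. ?B i)"
  have N: "?N \<in> null_sets lebesgue" using C(4) negligible_iff_null_sets by blast
  have Tl: "T \<in> lmeasurable"
    using Te by (intro fmeasurableI) (auto simp: le_less_trans)
  show "\<exists>T. ?E \<subseteq> T \<and> T \<in> lmeasurable \<and> measure lebesgue T \<le> e"
  proof (intro exI[of _ "T \<union> ?N"] conjI)
    show "?E \<subseteq> T \<union> ?N" by (auto simp: T_def S_def)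
    show "T \<union> ?N \<in> lmeasurable"
      using Tl C(4) negligible_imp_measurable by blast
    have "measure lebesgue (T \<union> ?N) = measure lebesgue T"
      using N Tl by (intro measure_Un_null_set) auto
    also have "\<dots> = measure lborel T" by simp
    also have "\<dots> \<le> e"
      using Te \<open>e > 0\<close> by (simp add: measure_def enn2real_leI)
    finally show "measure lebesgue (T \<union> ?N) \<le> e" .
  qed
qed

text \<open>A Borel representative has the same integrals over all balls, so passing to it alters
  the exceptional set only inside a null set.\<close>

lemma negligible_upper_derivate_lebesgue:
  fixes f :: "'a::euclidean_space \<Rightarrow> real"
  assumes int: "integrable lebesgue f" and "0 \<le> b" "a < b"
  shows "negligible {x. f x < a \<and> (\<forall>d>0. \<exists>r. 0 < r \<and> r < d \<and>
    b * measure lebesgue (cball x r) < (LINT z|lebesgue_on (cball x r). f z))}" (is "negligible ?E")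
proof -
  have fm [measurable]: "f \<in> borel_measurable lebesgue" using int by simp
  obtain g where g [measurable]: "g \<in> borel_measurable borel" and ae: "AE x in lborel. f x = g x"
    using completion_ex_borel_measurable_real[OF fm] by auto
  have gl [measurable]: "g \<in> borel_measurable lebesgue" using g by (simp add: measurable_completion)
  have ae': "AE x in lebesgue. f x = g x" using ae by (rule AE_completion)
  then obtain N where N: "N \<in> null_sets lebesgue" "{x. f x \<noteq> g x} \<subseteq> N"
    by (auto simp: eventually_ae_filter)
  have "integrable lebesgue g"
    using int ae' by (subst (asm) integrable_cong_AE[OF fm gl])
  then have intg: "integrable lborel g" using g by (subst (asm) integrable_completion) auto
  have eq: "(LINT z|lebesgue_on (cball x r). f z) = (LINT z:cball x r|lborel. g z)" for x r
  proof -
    have "(LINT z|lebesgue_on (cball x r). f z) = (LINT z|lebesgue. indicator (cball x r) z * f z)"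
      by (subst integral_restrict_space) auto
    also have "\<dots> = (LINT z|lebesgue. indicator (cball x r) z * g z)"
    proof (rule integral_cong_AE)
      show "AE z in lebesgue. indicator (cball x r) z * f z = indicator (cball x r) z * g z"
        using ae' by eventually_elim simp
    qed (auto intro!: borel_measurable_times borel_measurable_indicator)
    also have "\<dots> = (LINT z:cball x r|lborel. g z)"
      unfolding set_lebesgue_integral_def real_scaleR_def
      by (rule integral_completion) (auto intro!: borel_measurable_times borel_measurable_indicator)
    finally show ?thesis .
  qed
  have "?E \<subseteq> {x. g x < a \<and> (\<forall>d>0. \<exists>r. 0 < r \<and> r < d \<and>
    b * measure lebesgue (cball x r) < (LINT z:cball x r|lborel. g z))} \<union> N"
  proof
    fix x assume x: "x \<in> ?E"
    show "x \<in> {x. g x < a \<and> (\<forall>d>0. \<exists>r. 0 < r \<and> r < d \<and>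
      b * measure lebesgue (cball x r) < (LINT z:cball x r|lborel. g z))} \<union> N"
    proof (cases "x \<in> N")
      case False
      then have "f x = g x" using N(2) by blast
      then show ?thesis using x unfolding eq by simp
    qed simp
  qed
  then show ?thesis
    using negligible_upper_derivate[OF g intg assms(2,3)] N(1)
    by (meson negligible_Un negligible_iff_null_sets negligible_subset)
qed

theorem AE_lebesgue_point:
  fixes F :: "'a::euclidean_space \<Rightarrow> 'b::euclidean_space"
  assumes "open U" "U \<in> lmeasurable" and F: "integrable (lebesgue_on U) F"
  shows "AE x in lebesgue_on U.
    ((\<lambda>r. (LINT z|lebesgue_on (cball x r). norm (F z - F x)) / measure lebesgue (cball x r)) \<longlongrightarrow> 0) (at_right 0)"
proof -
  have [measurable]: "U \<in> sets lebesgue" using assms by auto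
  obtain D :: "'b set" where D: "countable D" "\<And>X. open X \<Longrightarrow> X \<noteq> {} \<Longrightarrow> \<exists>d \<in> D. d \<in> X"
    using countable_dense_setE by blast
  \<comment> \<open>The cutoff by \<open>U\<close> makes the function integrable on the whole space;
    it is invisible on balls inside \<open>U\<close>.\<close>
  define G where "G q x = indicator U x * norm (F x - q)" for q x
  have "integrable (lebesgue_on U) (\<lambda>x. norm (F x - q))" for q
    by (intro integrable_norm Bochner_Integration.integrable_diff F)
      (rule finite_measure.integrable_const[OF finite_measure_lebesgue_on[OF assms(2)]])
  then have G: "integrable lebesgue (G q)" for q
    unfolding G_def by (subst (asm) integrable_restrict_space) auto
  define E where "E q a b = {x. G q x < a \<and> (\<forall>d>0. \<exists>r. 0 < r \<and> r < d \<and>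
    b * measure lebesgue (cball x r) < (LINT z|lebesgue_on (cball x r). G q z))}" for q a b
  define I where "I = D \<times> {(a, b). a \<in> \<rat> \<and> b \<in> \<rat> \<and> 0 \<le> b \<and> a < (b::real)}"
  have "countable I" unfolding I_def
    by (rule countable_SIGMA[OF D(1)], rule countable_subset[of _ "\<rat> \<times> \<rat>"])
      (auto intro: countable_rat)
  define N where "N = (\<Union>(q, a, b)\<in>I. E q a b)"
  have "negligible N" unfolding N_def
  proof (rule negligible_countable_Union)
    show "countable ((\<lambda>(q, a, b). E q a b) ` I)" using \<open>countable I\<close> by (rule countable_image)
    show "negligible X" if "X \<in> (\<lambda>(q, a, b). E q a b) ` I" for X
      using that negligible_upper_derivate_lebesgue[OF G] by (auto simp: I_def E_def)
  qed
  then have "AE x in lebesgue. x \<notin> N"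
    using AE_not_in negligible_iff_null_sets by blast
  moreover have "((\<lambda>r. (LINT z|lebesgue_on (cball x r). norm (F z - F x)) / measure lebesgue (cball x r)) \<longlongrightarrow> 0) (at_right 0)"
    if "x \<in> U" "x \<notin> N" for x
  proof (rule tendstoI)
    fix e :: real assume "e > 0"
    \<comment> \<open>The error budget: the average of \<open>norm (F z - q)\<close> is at most
      \<open>b < e / 2\<close> for small radii, and replacing \<open>q\<close> by \<open>F x\<close>
      costs at most \<open>e / 4\<close>. Taking \<open>q\<close> from a dense countable set and
      \<open>a\<close>, \<open>b\<close> rational leaves only countably many null sets to
      avoid.\<close>
    obtain q where q: "q \<in> D" "norm (F x - q) < e / 4"
      using D(2)[of "ball (F x) (e/4)"] \<open>e > 0\<close> by (auto simp: dist_norm)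
    obtain a where a: "a \<in> \<rat>" "norm (F x - q) < a" "a < e / 4"
      using Rats_dense_in_real[OF q(2)] by blast
    obtain b where b: "b \<in> \<rat>" "a < b" "b < e / 2"
    proof -
      have "a < e / 2" using a \<open>e > 0\<close> by linarith
      then show ?thesis using Rats_dense_in_real that by blast
    qed
    have "0 \<le> b" using a b norm_ge_zero[of "F x - q"] by linarith
    have "x \<notin> E q a b"
      using that(2) q a b \<open>0 \<le> b\<close> by (auto simp: N_def I_def)
    moreover have "G q x < a" using that a by (simp add: G_def)
    ultimately have "\<not> (\<forall>d>0. \<exists>r. 0 < r \<and> r < d \<and>
        b * measure lebesgue (cball x r) < (LINT z|lebesgue_on (cball x r). G q z))"
      unfolding E_def by simp
    then obtain d where d: "d > 0" "\<And>r. 0 < r \<Longrightarrow> r < d \<Longrightarrow>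
      (LINT z|lebesgue_on (cball x r). G q z) \<le> b * measure lebesgue (cball x r)"
      by (meson not_le)
    obtain d' where d': "d' > 0" "cball x d' \<subseteq> U"
      using \<open>open U\<close> \<open>x \<in> U\<close> open_contains_cball by blast
    have "dist ((LINT z|lebesgue_on (cball x r). norm (F z - F x)) / measure lebesgue (cball x r)) 0 < e"
      if r: "0 < r" "r < min d d'" for r
    proof -
      have sub: "cball x r \<subseteq> U" using r d' by (meson less_imp_le min.strict_boundedE subset_cball subset_trans)
      have pos: "measure lebesgue (cball x r) > 0"
        using r by (simp add: content_cball_pos)
      have fin: "emeasure lebesgue (cball x r) < \<infinity>"
        using emeasure_bounded_finite[of "cball x r"] by simp
      have iG: "integrable (lebesgue_on (cball x r)) (G q)"
        using integrable_mult_indicator[OF _ G, of "cball x r"] by (subst integrable_restrict_space) auto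
      have iF: "integrable (lebesgue_on (cball x r)) F"
        by (rule integrable_lebesgue_on_subset[OF F]) (use sub in auto)
      have ic: "integrable (lebesgue_on (cball x r)) (\<lambda>_. c)" for c :: "'c::euclidean_space"
        by (rule finite_measure.integrable_const[OF finite_measure_lebesgue_on]) simp
      have "(LINT z|lebesgue_on (cball x r). norm (F z - F x)) \<le> (LINT z|lebesgue_on (cball x r). G q z + e / 4)"
      proof (rule integral_mono)
        show "integrable (lebesgue_on (cball x r)) (\<lambda>z. norm (F z - F x))"
          by (intro integrable_norm Bochner_Integration.integrable_diff iF ic)
        show "integrable (lebesgue_on (cball x r)) (\<lambda>z. G q z + e / 4)"
          by (intro Bochner_Integration.integrable_add iG ic)
        fix z assume "z \<in> space (lebesgue_on (cball x r))"
        then have "z \<in> U" using sub by (auto simp: space_restrict_space)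
        moreover have "norm (F z - F x) \<le> norm (F z - q) + norm (F x - q)"
          by (metis dist_norm dist_triangle2)
        ultimately show "norm (F z - F x) \<le> G q z + e / 4" using q by (simp add: G_def)
      qed
      also have "\<dots> = (LINT z|lebesgue_on (cball x r). G q z) + e / 4 * measure lebesgue (cball x r)"
        using iG ic[of "e/4"] by (simp add: measure_restrict_space)
      also have "\<dots> \<le> b * measure lebesgue (cball x r) + e / 4 * measure lebesgue (cball x r)"
        using d r by auto
      also have "\<dots> < e * measure lebesgue (cball x r)"
        unfolding distrib_right[symmetric] using b \<open>e > 0\<close> pos by (intro mult_strict_right_mono) auto
      finally show ?thesis
        using pos by (simp add: pos_divide_less_eq)
    qed
    then show "\<forall>\<^sub>F r in at_right 0. dist ((LINT z|lebesgue_on (cball x r). norm (F z - F x)) / measure lebesgue (cball x r)) 0 < e"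
      unfolding eventually_at_right_field using d(1) d'(1)
      by (intro exI[of _ "min d d'"]) auto
  qed
  ultimately show ?thesis
    by (subst AE_restrict_space_iff) auto
qed


section \<open>Radial kernels\<close>

definition laplacian :: "(real ^ 'm::finite \<Rightarrow> real) \<Rightarrow> real ^ 'm \<Rightarrow> real"
  where "laplacian \<phi> x = (\<Sum>i\<in>UNIV. partial_deriv i (partial_deriv i \<phi>) x)"

definition bump_kernel :: "real ^ 'm::finite \<Rightarrow> real \<Rightarrow> real ^ 'm \<Rightarrow> real"
  where "bump_kernel x r y = inverse r ^ CARD('m) * bump 1 (1 - 1 / r\<^sup>2 * (norm (y - x))\<^sup>2)"

text \<open>The gradient of \<open>bump_kernel x r\<close> at \<open>y\<close> is \<open>- (y - x) / r\<^sup>2\<close> times the following kernel.\<close>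

definition flux_kernel :: "real ^ 'm::finite \<Rightarrow> real \<Rightarrow> real ^ 'm \<Rightarrow> real"
  where "flux_kernel x r y =
    2 * inverse r ^ CARD('m) * bump (bump_step 1) (1 - 1 / r\<^sup>2 * (norm (y - x))\<^sup>2)"

lemma bump_continuous: "continuous_on UNIV (bump P)"
  using bump_has_derivative by (auto intro!: continuous_at_imp_continuous_on DERIV_isCont)

lemma bump_bounded: "\<exists>C>0. \<forall>s\<le>1. \<bar>bump P s\<bar> \<le> C"
proof -
  have "bounded (bump P ` {0..1})"
    by (intro compact_imp_bounded compact_continuous_image) (auto intro: continuous_on_subset[OF bump_continuous])
  then obtain C where C: "\<And>s. 0 \<le> s \<Longrightarrow> s \<le> 1 \<Longrightarrow> \<bar>bump P s\<bar> \<le> C"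
    unfolding bounded_iff by (metis atLeastAtMost_iff image_eqI real_norm_def)
  have "\<bar>bump P s\<bar> \<le> max C 1" if "s \<le> 1" for s
    using C[of s] that by (cases "s \<le> 0") (auto simp: bump_def)
  then show ?thesis by (intro exI[of _ "max C 1"]) auto
qed

lemma bump_step_1: "bump_step 1 = [:0, 0, 1:]"
  by (simp add: bump_step_def pderiv_1)

lemma bump_nonneg: "bump 1 s \<ge> 0" "bump (bump_step 1) s \<ge> 0"
  by (auto simp: bump_def bump_step_1)

lemma bump_1_pos: "s > 0 \<Longrightarrow> bump 1 s > 0"
  by (auto simp: bump_def)

text \<open>On \<open>(0, 1]\<close> the derivative of \<open>exp (-1/s)\<close> is
  \<open>exp (-1/s)\<close> times \<open>1/s^2 \<ge> 1\<close>. All later comparisons between the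
  two kernels rest on this.\<close>

lemma bump_le: "s \<le> 1 \<Longrightarrow> bump 1 s \<le> bump (bump_step 1) s"
  by (auto simp: bump_def bump_step_1 field_simps power_le_one mult_le_one)

lemma bump_kernel_nonneg: "r > 0 \<Longrightarrow> bump_kernel x r y \<ge> 0"
  by (simp add: bump_kernel_def bump_nonneg)

lemma bump_kernel_pos: "r > 0 \<Longrightarrow> y \<in> ball x r \<Longrightarrow> bump_kernel x r y > 0"
  by (auto simp: bump_kernel_def dist_norm norm_minus_commute power_strict_mono
      intro!: mult_pos_pos bump_1_pos)

lemma flux_kernel_nonneg: "r > 0 \<Longrightarrow> flux_kernel x r y \<ge> 0"
  by (simp add: flux_kernel_def bump_nonneg)

lemma bump_kernel_le_flux_kernel: "r > 0 \<Longrightarrow> bump_kernel x r y \<le> flux_kernel x r y / 2"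
  by (auto simp: bump_kernel_def flux_kernel_def intro!: mult_left_mono bump_le)

lemma bump_outside: 
  assumes "r > 0" "y \<notin> cball x r"
  shows "bump P (1 - 1 / r\<^sup>2 * (norm (y - x))\<^sup>2) = 0"
proof -
  have "r \<le> norm (y - x)" using assms by (auto simp: dist_norm norm_minus_commute)
  then have "r\<^sup>2 \<le> (norm (y - x))\<^sup>2" using assms by (intro power_mono) auto
  then show ?thesis using assms by (auto simp: bump_def field_simps)
qed

lemma kernel_outside:
  assumes "r > 0" "y \<notin> cball x r"
  shows "bump_kernel x r y = 0" "flux_kernel x r y = 0"
  using bump_outside[OF assms] by (auto simp: bump_kernel_def flux_kernel_def)

lemma bump_kernel_smooth: "smooth_on_open UNIV (bump_kernel x r)"
  and flux_kernel_smooth: "smooth_on_open UNIV (flux_kernel x r)"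
  unfolding bump_kernel_def[abs_def] flux_kernel_def[abs_def]
  by (intro bump_alg_smooth[of _ x "1 / r\<^sup>2"] bump_alg.intros)+

lemma test_functionI:
  assumes "smooth_on_open UNIV \<phi>" "\<And>y. y \<notin> cball x r \<Longrightarrow> \<phi> y = 0" "cball x r \<subseteq> U"
  shows "test_function U \<phi>"
proof -
  have "closure {y. \<phi> y \<noteq> 0} \<subseteq> cball x r"
    by (rule closure_minimal) (use assms(2) in blast, simp)
  moreover from this have "compact (closure {y. \<phi> y \<noteq> 0})"
    by (metis bounded_cball bounded_subset closed_closure compact_eq_bounded_closed)
  ultimately show ?thesis using assms unfolding test_function_def by blast
qed

lemma test_function_bump_kernel: "r > 0 \<Longrightarrow> cball x r \<subseteq> U \<Longrightarrow> test_function U (bump_kernel x r)"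
  by (rule test_functionI[OF bump_kernel_smooth]) (use kernel_outside in auto)

lemma test_function_flux_kernel: "r > 0 \<Longrightarrow> cball x r \<subseteq> U \<Longrightarrow> test_function U (flux_kernel x r)"
  by (rule test_functionI[OF flux_kernel_smooth]) (use kernel_outside in auto)

lemma kernel_borel [measurable]:
  "bump_kernel x r \<in> borel_measurable borel" "flux_kernel x r \<in> borel_measurable borel"
  by (rule borel_measurable_continuous_onI smooth_on_open_continuous_on bump_kernel_smooth flux_kernel_smooth)+

text \<open>The chain rule for the Laplacian of \<open>q(s)\<close>: it is \<open>q''(s)\<close>
  times the squared gradient of \<open>s\<close> plus \<open>q'(s)\<close> times the Laplacian of
  \<open>s\<close>, and for this \<open>s\<close> these factors are \<open>4 |y - x|^2 / r^4\<close>
  and \<open>- 2 m / r^2\<close>, with \<open>m\<close> the dimension.\<close>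

lemma laplacian_bump_kernel:
  fixes x y :: "real ^ 'm::finite"
  shows "laplacian (bump_kernel x r) y = inverse r ^ CARD('m) *
    (4 / r ^ 4 * (norm (y - x))\<^sup>2 * bump (bump_step (bump_step 1)) (1 - 1 / r\<^sup>2 * (norm (y - x))\<^sup>2)
      - 2 * CARD('m) / r\<^sup>2 * bump (bump_step 1) (1 - 1 / r\<^sup>2 * (norm (y - x))\<^sup>2))"
proof -
  let ?s = "\<lambda>y. 1 - 1 / r\<^sup>2 * (norm (y - x))\<^sup>2"
  let ?c = "inverse r ^ CARD('m)"
  have D1: "(bump_kernel x r has_derivative
      (\<lambda>v. ?c * (bump (bump_step 1) (?s y) * (- 2 * (1 / r\<^sup>2) * ((y - x) \<bullet> v))))) (at y)" for y
    unfolding bump_kernel_def[abs_def]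
    by (rule has_derivative_mult_right[OF radial_bump_has_derivative])
  have p1: "partial_deriv i (bump_kernel x r) =
      (\<lambda>y. ?c * (- 2 / r\<^sup>2) * (bump (bump_step 1) (?s y) * (y $ i - x $ i)))" for i
    by (rule ext, subst partial_deriv_eq[OF D1]) (simp add: inner_axis)
  have D2: "((\<lambda>y. ?c * (- 2 / r\<^sup>2) * (bump (bump_step 1) (?s y) * (y $ i - x $ i))) has_derivative
      (\<lambda>v. ?c * (- 2 / r\<^sup>2) * (bump (bump_step 1) (?s y) * (v $ i) +
        bump (bump_step (bump_step 1)) (?s y) * (- 2 * (1 / r\<^sup>2) * ((y - x) \<bullet> v)) * (y $ i - x $ i)))) (at y)" for y i
  proof -
    have "((\<lambda>y :: real ^ 'm. y $ i - x $ i) has_derivative (\<lambda>v. v $ i)) (at y)"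
      using has_derivative_diff[OF bounded_linear_imp_has_derivative[OF bounded_linear_vec_nth] has_derivative_const, of i "x $ i" "at y"]
      by simp
    from has_derivative_mult_right[OF has_derivative_mult[OF radial_bump_has_derivative this]]
    show ?thesis .
  qed
  have p2: "partial_deriv i (partial_deriv i (bump_kernel x r)) y =
      ?c * (4 / r ^ 4 * bump (bump_step (bump_step 1)) (?s y) * (y $ i - x $ i)\<^sup>2
        - 2 / r\<^sup>2 * bump (bump_step 1) (?s y))" for i
  proof -
    have "c * (- 2 * k) * (b1 + b2 * (- 2 * k * d) * d) = c * (4 * k\<^sup>2 * b2 * d\<^sup>2 - 2 * k * b1)"
      for c k b1 b2 d :: real
      by (simp add: algebra_simps power2_eq_square)
    from this[of ?c "1 / r\<^sup>2" "bump (bump_step 1) (?s y)" "bump (bump_step (bump_step 1)) (?s y)"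
      "y $ i - x $ i"] show ?thesis
      unfolding p1 by (subst partial_deriv_eq[OF D2]) (simp add: inner_axis power_divide)
  qed
  have N: "(norm (y - x))\<^sup>2 = (\<Sum>i\<in>UNIV. (y $ i - x $ i)\<^sup>2)"
    by (simp add: norm_vec_def L2_set_def sum_nonneg)
  have *: "(\<Sum>i\<in>UNIV. c * (a * b * (d i)\<^sup>2 - k)) = c * (a * (\<Sum>i\<in>UNIV. (d i)\<^sup>2) * b - CARD('m) * k)"
    for c a b k :: real and d :: "'m \<Rightarrow> real"
    by (simp add: sum_distrib_left sum_distrib_right sum_subtractf right_diff_distrib mult_ac)
  show ?thesis
    unfolding laplacian_def p2 * N[symmetric] by simp
qed

text \<open>The reason is scaling: the \<open>r\<close>-derivative of a mass preserving dilation is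
  a divergence, and the field in question is \<open>r\<close> times the gradient of
  \<open>bump_kernel x r\<close>. The proof compares the two explicit formulas.\<close>

lemma flux_kernel_deriv:
  fixes x y :: "real ^ 'm::finite"
  assumes "r > 0"
  shows "((\<lambda>r. flux_kernel x r y) has_real_derivative r * laplacian (bump_kernel x r) y) (at r)"
proof -
  have n: "CARD('m) > 0" by simp
  let ?s = "\<lambda>r. 1 - 1 / r\<^sup>2 * (norm (y - x))\<^sup>2"
  have s: "(?s has_real_derivative 2 / r ^ 3 * (norm (y - x))\<^sup>2) (at r)"
    using assms by (auto intro!: derivative_eq_intros simp: field_simps power2_eq_square power3_eq_cube)
  have b: "((\<lambda>r. bump (bump_step 1) (?s r)) has_real_derivative
      bump (bump_step (bump_step 1)) (?s r) * (2 / r ^ 3 * (norm (y - x))\<^sup>2)) (at r)"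
    by (rule DERIV_chain2[OF bump_has_derivative s])
  have p: "((\<lambda>r. 2 * inverse r ^ CARD('m)) has_real_derivative - 2 * CARD('m) * inverse r ^ CARD('m) / r) (at r)"
  proof -
    have "((\<lambda>r. 2 * inverse r ^ CARD('m)) has_real_derivative
        2 * (of_nat CARD('m) * inverse r ^ (CARD('m) - 1) * - (inverse r ^ 2))) (at r)"
      using assms by (auto intro!: derivative_eq_intros simp: power2_eq_square)
    moreover have "inverse r ^ (CARD('m) - 1) * inverse r ^ 2 = inverse r ^ CARD('m) / r"
    proof -
      have "inverse r ^ CARD('m) = inverse r ^ (CARD('m) - 1) * inverse r"
        using n by (metis Suc_diff_1 power_Suc2)
      then show ?thesis by (simp add: divide_inverse power2_eq_square)
    qed
    ultimately show ?thesis by (simp add: mult.assoc)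
  qed
  show ?thesis
    unfolding flux_kernel_def[abs_def] laplacian_bump_kernel
    by (rule DERIV_cong[OF DERIV_mult[OF p b]])
      (use assms in \<open>simp add: field_simps power2_eq_square power3_eq_cube power4_eq_xxxx\<close>)
qed

lemma flux_kernel_bound:
  "\<exists>C>0. \<forall>x r. \<forall>y :: real ^ 'm::finite. r > 0 \<longrightarrow> flux_kernel x r y \<le> C * inverse r ^ CARD('m)"
proof -
  obtain C where C: "C > 0" "\<And>s. s \<le> 1 \<Longrightarrow> \<bar>bump (bump_step 1) s\<bar> \<le> C" using bump_bounded by blast
  have "flux_kernel x r y \<le> (2 * C) * inverse r ^ CARD('m)" if "r > 0" for x y :: "real ^ 'm" and r
    using C(2)[of "1 - 1 / r\<^sup>2 * (norm (y - x))\<^sup>2"] that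
    by (simp add: flux_kernel_def mult.commute mult_right_mono abs_le_iff)
  then show ?thesis using C(1) by (intro exI[of _ "2 * C"]) auto
qed

text \<open>Both terms have the order \<open>r^-(m+2)\<close>: in the first one,
  \<open>|y - x| \<le> r\<close> on the support cancels two of the four inverse powers of
  \<open>r\<close>.\<close>

lemma laplacian_bump_kernel_bound:
  "\<exists>C>0. \<forall>x r. \<forall>y :: real ^ 'm::finite. r > 0 \<longrightarrow>
    \<bar>laplacian (bump_kernel x r) y\<bar> \<le> C * inverse r ^ (CARD('m) + 2)"
proof -
  let ?n = "real CARD('m)"
  obtain C where C: "C > 0" "\<And>s. s \<le> 1 \<Longrightarrow> \<bar>bump (bump_step 1) s\<bar> \<le> C" using bump_bounded by blast
  obtain D where D: "D > 0" "\<And>s. s \<le> 1 \<Longrightarrow> \<bar>bump (bump_step (bump_step 1)) s\<bar> \<le> D" using bump_bounded by blast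
  have "\<bar>laplacian (bump_kernel x r) y\<bar> \<le> (4 * D + 2 * ?n * C) * inverse r ^ (CARD('m) + 2)"
    if r: "r > 0" for x y :: "real ^ 'm" and r
  proof -
    let ?s = "1 - 1 / r\<^sup>2 * (norm (y - x))\<^sup>2"
    have s: "?s \<le> 1" by simp
    have 1: "\<bar>4 / r ^ 4 * (norm (y - x))\<^sup>2 * bump (bump_step (bump_step 1)) ?s\<bar> \<le> 4 * D / r\<^sup>2"
    proof (cases "y \<in> cball x r")
      case True
      then have "(norm (y - x))\<^sup>2 \<le> r\<^sup>2"
        by (intro power_mono) (auto simp: dist_norm norm_minus_commute)
      then have "(norm (y - x))\<^sup>2 * \<bar>bump (bump_step (bump_step 1)) ?s\<bar> \<le> r\<^sup>2 * D"
        using D(2)[OF s] by (intro mult_mono) auto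
      then have "4 / r ^ 4 * ((norm (y - x))\<^sup>2 * \<bar>bump (bump_step (bump_step 1)) ?s\<bar>) \<le> 4 / r ^ 4 * (r\<^sup>2 * D)"
        using r by (intro mult_left_mono) auto
      also have "\<dots> = 4 * D / r\<^sup>2" using r by (simp add: field_simps power2_eq_square power4_eq_xxxx)
      finally show ?thesis using r by (simp add: abs_mult mult.assoc)
    next
      case False
      then show ?thesis using D(1) r by (subst bump_outside[OF r False]) simp
    qed
    have 2: "\<bar>2 * ?n / r\<^sup>2 * bump (bump_step 1) ?s\<bar> \<le> 2 * ?n * C / r\<^sup>2"
      using C(2)[OF s] r by (simp add: abs_mult divide_right_mono mult_left_mono)
    have "\<bar>laplacian (bump_kernel x r) y\<bar> \<le> inverse r ^ CARD('m) * (4 * D / r\<^sup>2 + 2 * ?n * C / r\<^sup>2)"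
      unfolding laplacian_bump_kernel abs_mult[of "inverse r ^ CARD('m)"]
      using r order_trans[OF abs_triangle_ineq4 add_mono[OF 1 2]] by (intro mult_mono) auto
    also have "\<dots> = (4 * D + 2 * ?n * C) * inverse r ^ (CARD('m) + 2)"
      using r by (simp add: power_add power2_eq_square field_simps)
    finally show ?thesis .
  qed
  then show ?thesis using C D by (intro exI[of _ "4 * D + 2 * ?n * C"]) (auto intro: add_pos_nonneg)
qed

text \<open>At distance at most \<open>3 r / 4\<close> the argument of the profile is at least
  \<open>1 - 9/16 = 7/16\<close>, so the exponential is at least \<open>exp (- 16/7)\<close>, and
  the remaining factor \<open>1/s^2\<close> is at least 1.\<close>

lemma flux_kernel_lower:
  fixes x y :: "real ^ 'm::finite"
  assumes "r > 0" "norm (y - x) \<le> 3 / 4 * r"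
  shows "flux_kernel x r y \<ge> 2 * inverse r ^ CARD('m) * exp (- (16 / 7))"
proof -
  let ?s = "1 - 1 / r\<^sup>2 * (norm (y - x))\<^sup>2"
  have "(norm (y - x))\<^sup>2 \<le> (3 / 4 * r)\<^sup>2" using assms by (intro power_mono) auto
  then have s: "?s \<ge> 7 / 16" "?s \<le> 1" using assms by (auto simp: field_simps power2_eq_square)
  have "1 / ?s \<le> 1 / (7 / 16)" using s by (intro divide_left_mono) auto
  then have e: "exp (- (16 / 7)) \<le> exp (- (1 / ?s))" by simp
  have "0 < ?s" using s(1) by linarith
  then have "1 \<le> 1 / ?s" using s(2) by (simp only: pos_le_divide_eq mult_1)
  then have "1 \<le> (1 / ?s) * (1 / ?s)" by (metis mult_mono' mult_1 zero_le_one)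
  then have "1 * exp (- (16 / 7)) \<le> (1 / ?s) * (1 / ?s) * exp (- (1 / ?s))"
    using e s by (intro mult_mono) auto
  also have "\<dots> = bump (bump_step 1) ?s"
  proof -
    have "(1 / s) * (1 / s) * exp (- (1 / s)) = bump (bump_step 1) s" if "0 < s" for s :: real
      using that by (simp add: bump_def bump_step_1)
    from this[OF \<open>0 < ?s\<close>] show ?thesis .
  qed
  finally show ?thesis
    using assms by (simp add: flux_kernel_def mult_left_mono)
qed

text \<open>By scaling this is the total mass of every flux kernel, whatever its centre and radius;
  only the dimension enters, hence the type argument. The kernels are left unnormalised, so averages
  of a function tend to \<open>flux_mass\<close> times its value.\<close>

definition flux_mass :: "'m::finite itself \<Rightarrow> real"
  where "flux_mass _ = (LINT y|lborel. flux_kernel (0 :: real ^ 'm) 1 y)"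

definition bump_mass :: "'m::finite itself \<Rightarrow> real"
  where "bump_mass _ = (LINT y|lborel. bump_kernel (0 :: real ^ 'm) 1 y)"

lemma integral_scaled:
  fixes f :: "real ^ 'm::finite \<Rightarrow> real"
  assumes [measurable]: "f \<in> borel_measurable borel" and "r > 0"
  shows "(LINT y|lborel. inverse r ^ CARD('m) * f (inverse r *\<^sub>R (y - x))) = (LINT y|lborel. f y)"
proof -
  let ?g = "\<lambda>y. inverse r ^ CARD('m) * f (inverse r *\<^sub>R (y - x))"
  have "(LINT y|lborel. ?g y) = (LINT y|density (distr lborel borel (\<lambda>y. x + r *\<^sub>R y)) (\<lambda>_. ennreal (\<bar>r\<bar> ^ DIM(real ^ 'm))). ?g y)"
    using lborel_affine[of r x] \<open>r > 0\<close> by simp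
  also have "\<dots> = (LINT y|lborel. r ^ CARD('m) * ?g (x + r *\<^sub>R y))"
    using \<open>r > 0\<close> by (subst integral_density) (auto simp: integral_distr)
  also have "\<dots> = (LINT y|lborel. f y)"
    using \<open>r > 0\<close> by (intro Bochner_Integration.integral_cong) (auto simp: power_inverse)
  finally show ?thesis .
qed

lemma kernel_scale:
  fixes x y :: "real ^ 'm::finite"
  assumes "r > 0"
  shows "bump_kernel x r y = inverse r ^ CARD('m) * bump_kernel 0 1 (inverse r *\<^sub>R (y - x))"
    and "flux_kernel x r y = inverse r ^ CARD('m) * flux_kernel 0 1 (inverse r *\<^sub>R (y - x))"
  using assms by (simp_all add: bump_kernel_def flux_kernel_def power_mult_distrib divide_inverse power_inverse)

lemma integral_kernel_lborel:
  fixes x :: "real ^ 'm::finite"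
  assumes "r > 0"
  shows "(LINT y|lborel. bump_kernel x r y) = bump_mass TYPE('m)"
    and "(LINT y|lborel. flux_kernel x r y) = flux_mass TYPE('m)"
  using integral_scaled[OF kernel_borel(1) assms, of 0 1 x] integral_scaled[OF kernel_borel(2) assms, of 0 1 x]
  unfolding bump_mass_def flux_mass_def kernel_scale[OF assms, of x] by auto

lemma integral_kernel:
  fixes x :: "real ^ 'm::finite"
  assumes "r > 0" "cball x r \<subseteq> U" "open U"
  shows "(LINT y|lebesgue_on U. bump_kernel x r y) = bump_mass TYPE('m)"
    and "(LINT y|lebesgue_on U. flux_kernel x r y) = flux_mass TYPE('m)"
  using integral_kernel_lborel[OF assms(1), of x] assms kernel_outside
  by (subst integral_lebesgue_on_borel; blast intro: kernel_borel borel_open)+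

lemma integrable_kernel:
  fixes x :: "real ^ 'm::finite"
  assumes "r > 0"
  shows "integrable lborel (bump_kernel x r)" "integrable lborel (flux_kernel x r)"
  by (rule integrable_lborel_compact_support[OF _ compact_cball[of x r]];
      use kernel_outside[OF assms] smooth_on_open_continuous_on[OF bump_kernel_smooth]
        smooth_on_open_continuous_on[OF flux_kernel_smooth] in blast)+

lemma flux_mass_pos: "flux_mass TYPE('m::finite) > 0"
proof -
  let ?c = "2 * exp (- (16 / 7)) :: real"
  have fin: "emeasure lborel (cball (0 :: real ^ 'm) (3/4)) < \<infinity>"
    by (intro emeasure_bounded_finite) auto
  have "0 < ?c * measure lborel (cball (0 :: real ^ 'm) (3/4))"
    by (simp add: content_cball_pos)
  also have "\<dots> = (LINT y|lborel. ?c * indicator (cball (0 :: real ^ 'm) (3/4)) y)"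
    using fin by simp
  also have "\<dots> \<le> (LINT y|lborel. flux_kernel (0 :: real ^ 'm) 1 y)"
  proof (rule integral_mono)
    show "integrable lborel (\<lambda>y. ?c * indicator (cball (0 :: real ^ 'm) (3/4)) y)"
      using fin by (intro integrable_mult_right integrable_real_indicator) auto
    show "?c * indicator (cball 0 (3/4)) y \<le> flux_kernel (0 :: real ^ 'm) 1 y" for y
      using flux_kernel_lower[of 1 y 0] flux_kernel_nonneg[of 1 0 y] by (auto simp: indicator_def)
  qed (rule integrable_kernel, simp)
  finally show ?thesis by (simp add: flux_mass_def)
qed


section \<open>Integrals against test functions and radial derivatives of averages\<close>

lemma borel_measurable_lebesgue_on:
  "f \<in> borel_measurable borel \<Longrightarrow> f \<in> borel_measurable (lebesgue_on U)"
  by (rule measurable_restrict_space1) (simp add: measurable_completion)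

lemma smooth_borel_measurable: "smooth_on_open UNIV f \<Longrightarrow> f \<in> borel_measurable borel"
  by (rule borel_measurable_continuous_onI[OF smooth_on_open_continuous_on])

lemma integrable_bounded_scaleR:
  fixes F :: "'a \<Rightarrow> 'b::euclidean_space"
  assumes F: "integrable M F" and k: "k \<in> borel_measurable M" "\<And>x. \<bar>k x\<bar> \<le> C"
  shows "integrable M (\<lambda>x. k x *\<^sub>R F x)"
proof (rule Bochner_Integration.integrable_bound)
  show "integrable M (\<lambda>x. C * norm (F x))" using F by simp
  show "(\<lambda>x. k x *\<^sub>R F x) \<in> borel_measurable M" using F k by measurable
  have "0 \<le> C" using k(2)[of undefined] abs_ge_zero order_trans by blast
  then show "AE x in M. norm (k x *\<^sub>R F x) \<le> norm (C * norm (F x))"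
    using k(2) by (intro AE_I2) (simp add: abs_mult mult_right_mono)
qed

lemma test_function_bounded:
  assumes "test_function U \<phi>"
  shows "\<exists>C. \<forall>x. \<bar>\<phi> x\<bar> \<le> C"
proof -
  let ?K = "closure {x. \<phi> x \<noteq> 0}"
  have "bounded (\<phi> ` ?K)"
    using assms unfolding test_function_def
    by (intro compact_imp_bounded compact_continuous_image)
      (auto intro: continuous_on_subset smooth_on_open_continuous_on)
  then obtain C where C: "\<And>x. x \<in> ?K \<Longrightarrow> \<bar>\<phi> x\<bar> \<le> C"
    unfolding bounded_iff by (metis image_eqI real_norm_def)
  have "\<bar>\<phi> x\<bar> \<le> max C 0" for x
  proof (cases "x \<in> ?K")
    case False
    then have "\<phi> x = 0" using closure_subset[of "{x. \<phi> x \<noteq> 0}"] by auto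
    then show ?thesis by simp
  qed (use C in \<open>simp add: le_max_iff_disj\<close>)
  then show ?thesis by blast
qed

lemma test_function_measurable:
  "test_function U \<phi> \<Longrightarrow> \<phi> \<in> borel_measurable (lebesgue_on V)"
  by (simp add: test_function_def borel_measurable_lebesgue_on smooth_borel_measurable)

lemma integrable_test_function_scaleR:
  fixes F :: "real ^ 'm::finite \<Rightarrow> 'b::euclidean_space"
  assumes "integrable (lebesgue_on V) F" "test_function U \<phi>"
  shows "integrable (lebesgue_on V) (\<lambda>x. \<phi> x *\<^sub>R F x)"
proof -
  obtain C where "\<And>x. \<bar>\<phi> x\<bar> \<le> C" using test_function_bounded[OF assms(2)] by blast
  then show ?thesis by (rule integrable_bounded_scaleR[OF assms(1) test_function_measurable[OF assms(2)]])
qed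

lemma flux_kernel_abs_bound:
  assumes "r > 0"
  shows "\<exists>C. \<forall>x. \<forall>y :: real ^ 'm::finite. \<bar>flux_kernel x r y\<bar> \<le> C"
proof -
  obtain C where "\<And>x r. \<And>y :: real ^ 'm. r > 0 \<Longrightarrow> flux_kernel x r y \<le> C * inverse r ^ CARD('m)"
    using flux_kernel_bound by blast
  then have "\<bar>flux_kernel x r y\<bar> \<le> C * inverse r ^ CARD('m)" for x y :: "real ^ 'm"
    using assms flux_kernel_nonneg[OF assms, of x y] by simp
  then show ?thesis by blast
qed

lemma integrable_flux_kernel_scaleR:
  fixes F :: "real ^ 'm::finite \<Rightarrow> 'b::euclidean_space"
  assumes "integrable (lebesgue_on V) F" "r > 0"
  shows "integrable (lebesgue_on V) (\<lambda>y. flux_kernel x r y *\<^sub>R F y)"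
proof -
  obtain C where "\<And>y. \<bar>flux_kernel x r y\<bar> \<le> C" using flux_kernel_abs_bound[OF assms(2)] by blast
  then show ?thesis
    by (rule integrable_bounded_scaleR[OF assms(1) borel_measurable_lebesgue_on[OF kernel_borel(2)]])
qed

text \<open>The kernel is at most \<open>C r^-m\<close> and lives on a ball whose volume is a
  constant times \<open>r^m\<close>. Hence the deviation from the limit is at most a constant times
  the average of \<open>norm (F z - a)\<close> over that ball.\<close>

lemma flux_kernel_tendsto:
  fixes F :: "real ^ 'm::finite \<Rightarrow> 'b::euclidean_space"
  assumes "open U" and F: "integrable (lebesgue_on U) F" and "x \<in> U"
    and lim: "((\<lambda>r. (LINT z|lebesgue_on (cball x r). norm (F z - a)) / measure lebesgue (cball x r)) \<longlongrightarrow> 0) (at_right 0)"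
  shows "((\<lambda>r. LINT y|lebesgue_on U. flux_kernel x r y *\<^sub>R F y) \<longlongrightarrow> flux_mass TYPE('m) *\<^sub>R a) (at_right 0)"
proof -
  obtain C where C: "C > 0" "\<And>r y. r > 0 \<Longrightarrow> flux_kernel x r y \<le> C * inverse r ^ CARD('m)"
    using flux_kernel_bound by blast
  define avg where "avg r = (LINT z|lebesgue_on (cball x r). norm (F z - a)) / measure lebesgue (cball x r)" for r
  obtain d where d: "d > 0" "cball x d \<subseteq> U"
    using \<open>open U\<close> \<open>x \<in> U\<close> open_contains_cball by blast
  have U: "U \<in> sets lebesgue" using \<open>open U\<close> by simp
  have est: "norm ((LINT y|lebesgue_on U. flux_kernel x r y *\<^sub>R F y) - flux_mass TYPE('m) *\<^sub>R a)
      \<le> C * unit_ball_vol (real CARD('m)) * avg r" if r: "0 < r" "r < d" for r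
  proof -
    let ?B = "cball x r"
    have sub: "?B \<subseteq> U" using r d subset_cball[of r d x] by auto
    have iF: "integrable (lebesgue_on ?B) F"
      by (rule integrable_lebesgue_on_subset[OF F U _ sub]) simp
    have ia: "integrable (lebesgue_on ?B) (\<lambda>_. a)"
      by (rule finite_measure.integrable_const[OF finite_measure_lebesgue_on]) simp
    have out: "indicator ?B y *\<^sub>R (flux_kernel x r y *\<^sub>R w) = indicator U y *\<^sub>R (flux_kernel x r y *\<^sub>R w)"
      for y and w :: 'b
      using kernel_outside[OF r(1), of y x] sub by (auto simp: indicator_def)
    have e1: "(LINT y|lebesgue_on U. flux_kernel x r y *\<^sub>R F y) = (LINT y|lebesgue_on ?B. flux_kernel x r y *\<^sub>R F y)"
      using U by (subst (1 2) integral_restrict_space) (auto simp: out simp del: scaleR_scaleR)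
    have "flux_mass TYPE('m) = (LINT y|lebesgue_on ?B. flux_kernel x r y)"
      unfolding integral_kernel_lborel(2)[OF r(1), of x, symmetric]
      by (rule integral_lebesgue_on_borel[symmetric]) (use kernel_outside[OF r(1)] in auto)
    moreover have "integrable (lebesgue_on ?B) (\<lambda>y. flux_kernel x r y *\<^sub>R (1 :: real))"
      by (rule integrable_flux_kernel_scaleR[OF finite_measure.integrable_const[OF finite_measure_lebesgue_on] r(1)]) simp
    ultimately have e2: "flux_mass TYPE('m) *\<^sub>R a = (LINT y|lebesgue_on ?B. flux_kernel x r y *\<^sub>R a)"
      by simp
    have "(LINT y|lebesgue_on U. flux_kernel x r y *\<^sub>R F y) - flux_mass TYPE('m) *\<^sub>R a =
        (LINT y|lebesgue_on ?B. flux_kernel x r y *\<^sub>R (F y - a))"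
      unfolding e1 e2 scaleR_diff_right
      by (rule Bochner_Integration.integral_diff[symmetric]; rule integrable_flux_kernel_scaleR[OF _ r(1)]; fact)
    also have "norm \<dots> \<le> (LINT y|lebesgue_on ?B. norm (flux_kernel x r y *\<^sub>R (F y - a)))"
      by (rule integral_norm_bound)
    also have "\<dots> \<le> (LINT y|lebesgue_on ?B. (C * inverse r ^ CARD('m)) * norm (F y - a))"
    proof (rule integral_mono)
      show "integrable (lebesgue_on ?B) (\<lambda>y. norm (flux_kernel x r y *\<^sub>R (F y - a)))"
        by (intro integrable_norm integrable_flux_kernel_scaleR Bochner_Integration.integrable_diff iF ia r)
      show "integrable (lebesgue_on ?B) (\<lambda>y. (C * inverse r ^ CARD('m)) * norm (F y - a))"
        by (intro integrable_mult_right integrable_norm Bochner_Integration.integrable_diff iF ia)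
      show "norm (flux_kernel x r y *\<^sub>R (F y - a)) \<le> (C * inverse r ^ CARD('m)) * norm (F y - a)" for y
        using C(2)[OF r(1), of y] flux_kernel_nonneg[OF r(1), of x y] by (simp add: mult_right_mono)
    qed
    also have "\<dots> = C * unit_ball_vol (real CARD('m)) * avg r"
      using r less_imp_neq[OF unit_ball_vol_pos[OF of_nat_0_le_iff, of "CARD('m)"]] by (simp add: avg_def content_cball power_inverse field_simps)
    finally show ?thesis .
  qed
  have "((\<lambda>r. C * unit_ball_vol (real CARD('m)) * avg r) \<longlongrightarrow> C * unit_ball_vol (real CARD('m)) * 0) (at_right 0)"
    using lim unfolding avg_def by (intro tendsto_mult tendsto_const)
  then have "((\<lambda>r. C * unit_ball_vol (real CARD('m)) * avg r) \<longlongrightarrow> 0) (at_right 0)" by simp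
  moreover have "\<forall>\<^sub>F r in at_right 0. norm ((LINT y|lebesgue_on U. flux_kernel x r y *\<^sub>R F y)
      - flux_mass TYPE('m) *\<^sub>R a) \<le> C * unit_ball_vol (real CARD('m)) * avg r"
    unfolding eventually_at_right_field using d(1) by (intro exI[of _ d] conjI allI impI est)
  ultimately have "((\<lambda>r. (LINT y|lebesgue_on U. flux_kernel x r y *\<^sub>R F y) - flux_mass TYPE('m) *\<^sub>R a)
      \<longlongrightarrow> 0) (at_right 0)"
    by (rule Lim_null_comparison[rotated])
  then show ?thesis by (simp add: LIM_zero_iff)
qed

text \<open>Flux kernels of small radius are test functions for \<open>U\<close>. Their integrals
  against \<open>F\<close> are 0, yet at a Lebesgue point they converge to \<open>flux_mass\<close>
  times \<open>F x\<close>.\<close>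

lemma AE_eq_0_if_test_integrals_0:
  fixes F :: "real ^ 'm::finite \<Rightarrow> 'b::euclidean_space"
  assumes "open U" "U \<in> lmeasurable" and F: "integrable (lebesgue_on U) F"
    and 0: "\<And>\<phi>. test_function U \<phi> \<Longrightarrow> (LINT x|lebesgue_on U. \<phi> x *\<^sub>R F x) = 0"
  shows "AE x in lebesgue_on U. F x = 0"
  using AE_lebesgue_point[OF assms(1-3)] AE_space
proof eventually_elim
  case (elim x)
  then have x: "x \<in> U" by (simp add: space_restrict_space)
  obtain d where d: "d > 0" "cball x d \<subseteq> U"
    using \<open>open U\<close> x open_contains_cball by blast
  have "((\<lambda>r. LINT y|lebesgue_on U. flux_kernel x r y *\<^sub>R F y) \<longlongrightarrow> 0) (at_right 0)"
  proof (rule tendsto_eventually)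
    have "(LINT y|lebesgue_on U. flux_kernel x r y *\<^sub>R F y) = 0" if "0 < r" "r < d" for r
      using that d subset_cball[of r d x] by (intro 0 test_function_flux_kernel) auto
    then show "\<forall>\<^sub>F r in at_right 0. (LINT y|lebesgue_on U. flux_kernel x r y *\<^sub>R F y) = 0"
      using d(1) by (auto simp: eventually_at_right_field)
  qed
  then have "flux_mass TYPE('m) *\<^sub>R F x = 0"
    using flux_kernel_tendsto[OF assms(1) F x elim(1)] tendsto_unique[OF trivial_limit_at_right_real]
    by blast
  then show ?case using flux_mass_pos[where 'm='m] by simp
qed

lemma square_summable_integrable:
  fixes F :: "real ^ 'm::finite \<Rightarrow> 'b::euclidean_space"
  assumes "square_summable A F" "A \<in> lmeasurable"
  shows "integrable (lebesgue_on A) F"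
proof (rule Bochner_Integration.integrable_bound)
  show "integrable (lebesgue_on A) (\<lambda>x. 1 + (norm (F x))\<^sup>2)"
    using assms finite_measure.integrable_const[OF finite_measure_lebesgue_on[OF assms(2)]]
    by (intro Bochner_Integration.integrable_add) (auto simp: square_summable_def)
  show "F \<in> borel_measurable (lebesgue_on A)" using assms by (simp add: square_summable_def)
  have "t \<le> 1 + t\<^sup>2" for t :: real
    using zero_le_power2[of "t - 1 / 2"] by (simp add: power2_eq_square algebra_simps)
  then show "AE x in lebesgue_on A. norm (F x) \<le> norm (1 + (norm (F x))\<^sup>2)"
    by (intro AE_I2) (simp add: abs_of_nonneg add_nonneg_nonneg)
qed

lemma weak_partial_unique:
  fixes F :: "real ^ 'm::finite \<Rightarrow> 'b::euclidean_space"
  assumes "open U" "U \<in> lmeasurable"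
    and "square_summable U F1" "has_weak_partial U i F F1"
    and "square_summable U F2" "has_weak_partial U i F F2"
  shows "AE x in lebesgue_on U. F1 x = F2 x"
proof -
  have i: "integrable (lebesgue_on U) F1" "integrable (lebesgue_on U) F2"
    using assms square_summable_integrable by blast+
  have "AE x in lebesgue_on U. F1 x - F2 x = 0"
  proof (rule AE_eq_0_if_test_integrals_0[OF assms(1,2)])
    show "integrable (lebesgue_on U) (\<lambda>x. F1 x - F2 x)" using i by simp
    fix \<phi> assume \<phi>: "test_function U \<phi>"
    have "- (LINT x|lebesgue_on U. \<phi> x *\<^sub>R F1 x) = - (LINT x|lebesgue_on U. \<phi> x *\<^sub>R F2 x)"
      using assms(4,6) \<phi> unfolding has_weak_partial_def by simp
    then have "(LINT x|lebesgue_on U. \<phi> x *\<^sub>R F1 x) = (LINT x|lebesgue_on U. \<phi> x *\<^sub>R F2 x)"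
      by simp
    then show "(LINT x|lebesgue_on U. \<phi> x *\<^sub>R (F1 x - F2 x)) = 0"
      using integrable_test_function_scaleR[OF i(1) \<phi>] integrable_test_function_scaleR[OF i(2) \<phi>]
      by (simp add: scaleR_diff_right)
  qed
  then show ?thesis by simp
qed

lemma has_derivative_parametric_integral:
  fixes k k' :: "real \<Rightarrow> 'a \<Rightarrow> real"
  assumes z: "integrable M z" and r: "a < r" "r < b"
    and k: "\<And>s y. a < s \<Longrightarrow> s < b \<Longrightarrow> ((\<lambda>s. k s y) has_real_derivative k' s y) (at s)"
    and C: "\<And>s y. a < s \<Longrightarrow> s < b \<Longrightarrow> \<bar>k' s y\<bar> \<le> C"
    and i: "\<And>s. a < s \<Longrightarrow> s < b \<Longrightarrow> integrable M (\<lambda>y. k s y * z y)"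
    and m: "k' r \<in> borel_measurable M"
  shows "((\<lambda>s. LINT y|M. k s y * z y) has_real_derivative (LINT y|M. k' r y * z y)) (at r)"
  unfolding DERIV_def LIMSEQ_SEQ_conv[symmetric]
proof (intro allI impI)
  fix S :: "nat \<Rightarrow> real" assume S: "(\<forall>n. S n \<noteq> 0) \<and> S \<longlonglongrightarrow> 0"
  have "\<forall>\<^sub>F n in sequentially. a - r < S n \<and> S n < b - r"
    using S r order_tendstoD[of S 0 sequentially] by (intro eventually_conj) auto
  then obtain N where N: "\<And>n. n \<ge> N \<Longrightarrow> a - r < S n \<and> S n < b - r"
    unfolding eventually_sequentially by blast
  \<comment> \<open>The first terms of \<open>S\<close> may carry \<open>r + S n\<close> out of the
    interval \<open>(a, b)\<close> on which the assumptions speak; dropping them does not change the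
    limit.\<close>
  define s where "s n = S (n + N)" for n
  have s: "s n \<noteq> 0" "a < r + s n" "r + s n < b" for n
    using S N[of "n + N"] by (auto simp: s_def)
  have "s \<longlonglongrightarrow> 0" unfolding s_def using S LIMSEQ_ignore_initial_segment by blast
  define D where "D n y = (k (r + s n) y * z y - k r y * z y) / s n" for n y
  have iD: "integrable M (D n)" for n
    unfolding D_def using i s r by simp
  have "(\<lambda>n. LINT y|M. D n y) \<longlonglongrightarrow> (LINT y|M. k' r y * z y)"
  proof (rule integral_dominated_convergence[where w = "\<lambda>y. C * norm (z y)"])
    show "(\<lambda>y. k' r y * z y) \<in> borel_measurable M" using m z by measurable
    show "D n \<in> borel_measurable M" for n using iD by blast
    show "integrable M (\<lambda>y. C * norm (z y))" using z by simp
    show "AE y in M. (\<lambda>n. D n y) \<longlonglongrightarrow> k' r y * z y"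
    proof (rule AE_I2)
      fix y
      have "((\<lambda>h. (k (r + h) y - k r y) / h) \<longlongrightarrow> k' r y) (at 0)"
        using k[OF r] by (simp add: DERIV_def)
      moreover have "filterlim s (at 0) sequentially"
        using \<open>s \<longlonglongrightarrow> 0\<close> s(1) by (simp add: filterlim_at)
      ultimately have "(\<lambda>n. (k (r + s n) y - k r y) / s n) \<longlonglongrightarrow> k' r y"
        by (rule filterlim_compose)
      from tendsto_mult_right[OF this, of "z y"] show "(\<lambda>n. D n y) \<longlonglongrightarrow> k' r y * z y"
        by (simp add: D_def left_diff_distrib[symmetric])
    qed
    show "AE y in M. norm (D n y) \<le> C * norm (z y)" for n
    proof (rule AE_I2)
      fix y
      have "\<bar>k (r + s n) y - k r y\<bar> \<le> C * \<bar>r + s n - r\<bar>"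
      proof -
        have "norm (k (r + s n) y - k r y) \<le> C * norm (r + s n - r)"
          by (rule field_differentiable_bound[of "{a<..<b}" "\<lambda>s. k s y" "\<lambda>s. k' s y"])
            (use k C s r in \<open>auto intro: has_field_derivative_at_within\<close>)
        then show ?thesis by simp
      qed
      then have "\<bar>(k (r + s n) y - k r y) / s n\<bar> \<le> C"
        using s(1)[of n] by (simp add: pos_divide_le_eq abs_divide)
      then have "\<bar>(k (r + s n) y - k r y) / s n\<bar> * \<bar>z y\<bar> \<le> C * \<bar>z y\<bar>"
        by (rule mult_right_mono) simp
      then show "norm (D n y) \<le> C * norm (z y)"
        by (simp add: D_def left_diff_distrib[symmetric] abs_mult)
    qed
  qed
  moreover have "(LINT y|M. D n y) = ((LINT y|M. k (r + s n) y * z y) - (LINT y|M. k r y * z y)) / s n" for n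
    unfolding D_def using i s r by simp
  ultimately have "(\<lambda>n. ((LINT y|M. k (r + s n) y * z y) - (LINT y|M. k r y * z y)) / s n)
      \<longlonglongrightarrow> (LINT y|M. k' r y * z y)" by simp
  then show "(\<lambda>n. ((LINT y|M. k (r + S n) y * z y) - (LINT y|M. k r y * z y)) / S n)
      \<longlonglongrightarrow> (LINT y|M. k' r y * z y)"
    unfolding s_def by (rule LIMSEQ_offset)
qed

lemma laplacian_bump_kernel_borel: "laplacian (bump_kernel x r) \<in> borel_measurable borel"
proof -
  have "(\<lambda>y. laplacian (bump_kernel x r) y) \<in> borel_measurable borel"
    unfolding laplacian_def
    by (intro borel_measurable_sum smooth_borel_measurable smooth_on_open_partial_deriv bump_kernel_smooth)
  then show ?thesis .
qed

lemma flux_integral_has_derivative: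
  fixes z :: "real ^ 'm::finite \<Rightarrow> real"
  assumes z: "integrable (lebesgue_on V) z" and "r > 0"
  shows "((\<lambda>r. LINT y|lebesgue_on V. flux_kernel x r y * z y) has_real_derivative
    r * (LINT y|lebesgue_on V. laplacian (bump_kernel x r) y * z y)) (at r)"
proof -
  obtain C where C: "C > 0" "\<And>x r. \<And>y :: real ^ 'm. r > 0 \<Longrightarrow>
    \<bar>laplacian (bump_kernel x r) y\<bar> \<le> C * inverse r ^ (CARD('m) + 2)"
    using laplacian_bump_kernel_bound by blast
  have "((\<lambda>r. LINT y|lebesgue_on V. flux_kernel x r y * z y) has_real_derivative
    (LINT y|lebesgue_on V. r * laplacian (bump_kernel x r) y * z y)) (at r)"
  \<comment> \<open>The interval from \<open>r / 2\<close> to \<open>2 * r\<close> keeps the radius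
    away from 0, where the bound on the Laplacian of the kernel blows up.\<close>
  proof (rule has_derivative_parametric_integral[OF z, where a = "r / 2" and b = "2 * r" and
      C = "2 * r * (C * inverse (r / 2) ^ (CARD('m) + 2))"])
    show "r / 2 < r" "r < 2 * r" using \<open>r > 0\<close> by auto
    show "((\<lambda>s. flux_kernel x s y) has_real_derivative s * laplacian (bump_kernel x s) y) (at s)"
      if "r / 2 < s" for s y
      using that \<open>r > 0\<close> by (intro flux_kernel_deriv) auto
    show "\<bar>s * laplacian (bump_kernel x s) y\<bar> \<le> 2 * r * (C * inverse (r / 2) ^ (CARD('m) + 2))"
      if "r / 2 < s" "s < 2 * r" for s y
    proof -
      have "C * inverse s ^ (CARD('m) + 2) \<le> C * inverse (r / 2) ^ (CARD('m) + 2)"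
        using that \<open>r > 0\<close> C(1) by (intro mult_left_mono power_mono le_imp_inverse_le) auto
      then have "\<bar>laplacian (bump_kernel x s) y\<bar> \<le> C * inverse (r / 2) ^ (CARD('m) + 2)"
        using C(2)[of s x y] that \<open>r > 0\<close> by linarith
      then show ?thesis
        unfolding abs_mult using that \<open>r > 0\<close> C(1) by (intro mult_mono) auto
    qed
    show "integrable (lebesgue_on V) (\<lambda>y. flux_kernel x s y * z y)" if "r / 2 < s" for s
      using integrable_flux_kernel_scaleR[OF z, of s x] that \<open>r > 0\<close> by simp
    show "(\<lambda>y. r * laplacian (bump_kernel x r) y) \<in> borel_measurable (lebesgue_on V)"
      by (intro borel_measurable_times borel_measurable_const borel_measurable_lebesgue_on laplacian_bump_kernel_borel)
  qed
  then show ?thesis by (simp add: mult.assoc)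
qed

text \<open>Continuity in the centre, at a fixed radius, is what later allows averages to be bounded
  uniformly over a compact ball of centres. The bound on the kernel is uniform in the centre, so
  dominated convergence applies.\<close>

lemma flux_integral_continuous:
  fixes z :: "real ^ 'm::finite \<Rightarrow> real"
  assumes z: "integrable (lebesgue_on V) z" and "r > 0"
  shows "continuous_on UNIV (\<lambda>x. LINT y|lebesgue_on V. flux_kernel x r y * z y)"
  unfolding continuous_on_sequentially
proof (intro allI ballI impI, unfold comp_def)
  fix X :: "nat \<Rightarrow> real ^ 'm" and x assume X: "(\<forall>n. X n \<in> UNIV) \<and> X \<longlonglongrightarrow> x"
  obtain C where C: "\<And>x. \<And>y :: real ^ 'm. \<bar>flux_kernel x r y\<bar> \<le> C"
    using flux_kernel_abs_bound[OF assms(2)] by blast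
  show "(\<lambda>n. LINT y|lebesgue_on V. flux_kernel (X n) r y * z y) \<longlonglongrightarrow> (LINT y|lebesgue_on V. flux_kernel x r y * z y)"
  proof (rule integral_dominated_convergence[where w = "\<lambda>y. C * norm (z y)"])
    show "(\<lambda>y. flux_kernel x r y * z y) \<in> borel_measurable (lebesgue_on V)" for x
      using integrable_flux_kernel_scaleR[OF z, of r x] \<open>r > 0\<close> by auto
    then show "(\<lambda>y. flux_kernel (X n) r y * z y) \<in> borel_measurable (lebesgue_on V)" for n .
    show "integrable (lebesgue_on V) (\<lambda>y. C * norm (z y))" using z by simp
    show "AE y in lebesgue_on V. (\<lambda>n. flux_kernel (X n) r y * z y) \<longlonglongrightarrow> flux_kernel x r y * z y"
    proof (rule AE_I2)
      fix y
      have "(\<lambda>n. 1 - 1 / r\<^sup>2 * (norm (y - X n))\<^sup>2) \<longlonglongrightarrow> 1 - 1 / r\<^sup>2 * (norm (y - x))\<^sup>2"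
        using X by (intro tendsto_intros) auto
      then have "(\<lambda>n. bump (bump_step 1) (1 - 1 / r\<^sup>2 * (norm (y - X n))\<^sup>2)) \<longlonglongrightarrow>
          bump (bump_step 1) (1 - 1 / r\<^sup>2 * (norm (y - x))\<^sup>2)"
        by (rule continuous_on_tendsto_compose[OF bump_continuous]) auto
      then show "(\<lambda>n. flux_kernel (X n) r y * z y) \<longlonglongrightarrow> flux_kernel x r y * z y"
        unfolding flux_kernel_def by (intro tendsto_intros)
    qed
    show "AE y in lebesgue_on V. norm (flux_kernel (X n) r y * z y) \<le> C * norm (z y)" for n
      using C by (intro AE_I2) (simp add: abs_mult mult_right_mono)
  qed
qed


section \<open>Supersolutions of the Helmholtz equation\<close>

text \<open>The content of one minimizing step, free of pairs and traces. Raising \<open>z\<close>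
  is always admissible and gives \<open>supersolution\<close>; varying it in both directions is
  admissible where \<open>z\<close> stays above some \<open>\<delta>\<close> on the set where
  \<open>\<phi>\<close> is nonzero, and gives \<open>solution\<close>. Both derivatives are on
  \<open>\<phi>\<close>, so that nothing but integrability of \<open>z\<close> enters.\<close>

locale variational_inequality =
  fixes U :: "(real ^ 'm::finite) set" and z w :: "real ^ 'm \<Rightarrow> real" and c :: real
  assumes U: "open U" "connected U" "U \<in> lmeasurable"
    and c_pos: "c > 0"
    and z_int: "integrable (lebesgue_on U) z" and z_nonneg: "\<And>x. z x \<ge> 0"
    and w_int: "integrable (lebesgue_on U) w" and w_cont: "continuous_on U w"
    and w_nonneg: "\<And>x. x \<in> U \<Longrightarrow> w x \<ge> 0" and w_nontrivial: "\<exists>x\<in>U. w x \<noteq> 0"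
    and supersolution: "\<And>\<phi>. test_function U \<phi> \<Longrightarrow> (\<And>x. \<phi> x \<ge> 0) \<Longrightarrow>
      c * (LINT x|lebesgue_on U. \<phi> x * (w x - z x)) \<le> - (LINT x|lebesgue_on U. laplacian \<phi> x * z x)"
    and solution: "\<And>\<phi> \<delta>. test_function U \<phi> \<Longrightarrow> \<delta> > 0 \<Longrightarrow>
      AE x in lebesgue_on U. \<phi> x \<noteq> 0 \<longrightarrow> z x \<ge> \<delta> \<Longrightarrow>
      c * (LINT x|lebesgue_on U. \<phi> x * (w x - z x)) = - (LINT x|lebesgue_on U. laplacian \<phi> x * z x)"
begin

abbreviation "\<mu> \<equiv> lebesgue_on U"

definition flux :: "real ^ 'm \<Rightarrow> real \<Rightarrow> real"
  where "flux x r = (LINT y|\<mu>. flux_kernel x r y * z y)"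

lemma int_kernel:
  assumes "r > 0" "integrable \<mu> (f :: real ^ 'm \<Rightarrow> real)"
  shows "integrable \<mu> (\<lambda>y. flux_kernel x r y * f y)" "integrable \<mu> (\<lambda>y. bump_kernel x r y * f y)"
proof -
  show "integrable \<mu> (\<lambda>y. flux_kernel x r y * f y)"
    using integrable_flux_kernel_scaleR[OF assms(2,1)] by simp
  have "test_function UNIV (bump_kernel x r)"
    by (rule test_function_bump_kernel[OF assms(1)]) simp
  from integrable_test_function_scaleR[OF assms(2) this]
  show "integrable \<mu> (\<lambda>y. bump_kernel x r y * f y)" by simp
qed

lemma flux_nonneg: "r > 0 \<Longrightarrow> flux x r \<ge> 0"
  unfolding flux_def by (intro integral_nonneg_AE AE_I2) (simp add: flux_kernel_nonneg z_nonneg)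

lemma flux_deriv:
  "r > 0 \<Longrightarrow> (flux x has_real_derivative r * (LINT y|\<mu>. laplacian (bump_kernel x r) y * z y)) (at r)"
  unfolding flux_def[abs_def] by (rule flux_integral_has_derivative[OF z_int])

text \<open>Testing with the bump kernel and discarding the nonnegative contribution of
  \<open>w\<close> bounds the Laplacian term by \<open>c\<close> times the bump average of
  \<open>z\<close>. Because the bump kernel is at most half the flux kernel, this returns to the
  average being differentiated.\<close>

lemma flux_deriv_le:
  assumes "r > 0" "cball x r \<subseteq> U"
  shows "r * (LINT y|\<mu>. laplacian (bump_kernel x r) y * z y) \<le> c * r / 2 * flux x r"
proof -
  have "- (LINT y|\<mu>. bump_kernel x r y * z y) \<le> (LINT y|\<mu>. bump_kernel x r y * (w y - z y))"
  proof -
    have "0 \<le> (LINT y|\<mu>. bump_kernel x r y * w y)"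
      by (intro integral_nonneg_AE AE_I2)
        (simp add: space_restrict_space bump_kernel_nonneg[OF assms(1)] w_nonneg)
    then show ?thesis
      using int_kernel(2)[OF assms(1) z_int] int_kernel(2)[OF assms(1) w_int]
      by (simp add: right_diff_distrib)
  qed
  from mult_left_mono[OF this less_imp_le[OF c_pos]]
  have "- (c * (LINT y|\<mu>. bump_kernel x r y * z y)) \<le> c * (LINT y|\<mu>. bump_kernel x r y * (w y - z y))"
    by simp
  also have "\<dots> \<le> - (LINT y|\<mu>. laplacian (bump_kernel x r) y * z y)"
    by (rule supersolution[OF test_function_bump_kernel[OF assms] bump_kernel_nonneg[OF assms(1)]])
  finally have 1: "(LINT y|\<mu>. laplacian (bump_kernel x r) y * z y) \<le> c * (LINT y|\<mu>. bump_kernel x r y * z y)"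
    by simp
  have "(LINT y|\<mu>. bump_kernel x r y * z y) \<le> (LINT y|\<mu>. flux_kernel x r y * z y / 2)"
    using int_kernel[OF assms(1) z_int] mult_right_mono[OF bump_kernel_le_flux_kernel[OF assms(1)] z_nonneg]
    by (intro integral_mono) auto
  also have "\<dots> = flux x r / 2" by (simp add: flux_def)
  finally have "c * (LINT y|\<mu>. bump_kernel x r y * z y) \<le> c * (flux x r / 2)"
    using c_pos by (intro mult_left_mono) auto
  then have "r * (LINT y|\<mu>. laplacian (bump_kernel x r) y * z y) \<le> r * (c * (flux x r / 2))"
    using 1 assms by (intro mult_left_mono) auto
  then show ?thesis by (simp add: field_simps)
qed

text \<open>The exponential is an integrating factor: \<open>c * r^2 / 4\<close> is a primitive of
  the growth rate \<open>c * r / 2\<close> in \<open>flux_deriv_le\<close>. Positivity thus passes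
  from large radii to small ones, and vanishing from small radii to large ones.\<close>

lemma flux_exp_decreasing:
  assumes "0 < r" "r \<le> R" "cball x R \<subseteq> U"
  shows "exp (- (c * R\<^sup>2 / 4)) * flux x R \<le> exp (- (c * r\<^sup>2 / 4)) * flux x r"
proof (rule DERIV_nonpos_imp_nonincreasing[OF assms(2)])
  fix s assume s: "r \<le> s" "s \<le> R"
  let ?L = "LINT y|\<mu>. laplacian (bump_kernel x s) y * z y"
  have s0: "s > 0" using s assms by simp
  have "((\<lambda>s. exp (- (c * s\<^sup>2 / 4))) has_real_derivative exp (- (c * s\<^sup>2 / 4)) * - (c * s / 2)) (at s)"
    by (auto intro!: derivative_eq_intros)
  from DERIV_mult[OF this flux_deriv[OF s0, of x]]
  have "((\<lambda>s. exp (- (c * s\<^sup>2 / 4)) * flux x s) has_real_derivative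
      exp (- (c * s\<^sup>2 / 4)) * (s * ?L - c * s / 2 * flux x s)) (at s)"
    by (rule DERIV_cong) (simp add: algebra_simps)
  moreover have "exp (- (c * s\<^sup>2 / 4)) * (s * ?L - c * s / 2 * flux x s) \<le> 0"
    using flux_deriv_le[OF s0, of x] assms s subset_cball[of s R x]
    by (intro mult_nonneg_nonpos) auto
  ultimately show "\<exists>y. ((\<lambda>s. exp (- (c * s\<^sup>2 / 4)) * flux x s) has_real_derivative y) (at s) \<and> y \<le> 0"
    by blast
qed

lemma flux_lower:
  assumes "0 < r" "r \<le> R" "cball x R \<subseteq> U"
  shows "exp (- (c * R\<^sup>2 / 4)) * flux x R \<le> flux x r"
proof -
  have "exp (- (c * r\<^sup>2 / 4)) * flux x r \<le> 1 * flux x r"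
    using c_pos flux_nonneg[OF assms(1)] by (intro mult_right_mono) auto
  then show ?thesis using flux_exp_decreasing[OF assms] by simp
qed

lemma flux_zero_iff:
  assumes "r > 0"
  shows "flux x r = 0 \<longleftrightarrow> (AE y in \<mu>. y \<in> ball x r \<longrightarrow> z y = 0)"
proof -
  have pos: "flux_kernel x r y > 0" if "y \<in> ball x r" for y
    using bump_kernel_pos[OF assms that] bump_kernel_le_flux_kernel[OF assms, of x y] by simp
  \<comment> \<open>\<open>kernel_outside\<close> speaks of points off the closed ball only, and
    positivity is known on the open ball; the sphere in between is a null set.\<close>
  have sphere: "AE y in \<mu>. y \<notin> sphere x r"
    using AE_not_in[of "sphere x r" lebesgue] negligible_sphere[of x r] U
    by (subst AE_restrict_space_iff) (auto simp: negligible_iff_null_sets)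
  have "flux x r = 0 \<longleftrightarrow> (AE y in \<mu>. flux_kernel x r y * z y = 0)"
    unfolding flux_def using int_kernel(1)[OF assms z_int]
    by (intro integral_nonneg_eq_0_iff_AE) (auto simp: flux_kernel_nonneg[OF assms] z_nonneg)
  also have "\<dots> \<longleftrightarrow> (AE y in \<mu>. y \<in> ball x r \<longrightarrow> z y = 0)"
  proof
    assume "AE y in \<mu>. flux_kernel x r y * z y = 0"
    then show "AE y in \<mu>. y \<in> ball x r \<longrightarrow> z y = 0"
      by eventually_elim (use pos in force)
  next
    assume "AE y in \<mu>. y \<in> ball x r \<longrightarrow> z y = 0"
    then show "AE y in \<mu>. flux_kernel x r y * z y = 0"
      using sphere
    proof eventually_elim
      case (elim y)
      then show ?case
        using kernel_outside(2)[OF assms, of y x] by (cases "y \<in> ball x r") auto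
    qed
  qed
  finally show ?thesis .
qed

text \<open>The strong minimum principle. Let \<open>Z\<close> consist of the points near which
  \<open>z\<close> vanishes almost everywhere. By monotonicity of the weighted averages, vanishing
  near a point spreads to every closed ball about it inside \<open>U\<close>, so \<open>Z\<close> is
  open and relatively closed. Connectedness leaves \<open>{}\<close> or \<open>U\<close>, and the
  latter is excluded near a point where \<open>w\<close> is positive.\<close>

lemma flux_pos:
  assumes "x \<in> U" "r > 0"
  shows "flux x r > 0"
proof -
  define Z where "Z = {x \<in> U. \<exists>r>0. AE y in \<mu>. y \<in> ball x r \<longrightarrow> z y = 0}"
  have spread: "AE y in \<mu>. y \<in> ball x R \<longrightarrow> z y = 0" if x: "x \<in> Z" and R: "R > 0" "cball x R \<subseteq> U" for x R
  proof -
    obtain r where r: "r > 0" "AE y in \<mu>. y \<in> ball x r \<longrightarrow> z y = 0"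
      using x by (auto simp: Z_def)
    define s where "s = min r R"
    have "AE y in \<mu>. y \<in> ball x s \<longrightarrow> z y = 0"
      using r(2) by eventually_elim (auto simp: s_def)
    then have "flux x s = 0" using r(1) R(1) by (subst flux_zero_iff) (auto simp: s_def)
    then have "exp (- (c * R\<^sup>2 / 4)) * flux x R \<le> 0"
      using flux_lower[of s R x] r R by (auto simp: s_def)
    then have "flux x R = 0" using flux_nonneg[OF R(1), of x] by (simp add: mult_le_0_iff)
    then show ?thesis using flux_zero_iff[OF R(1)] by blast
  qed
  have "open Z"
    unfolding open_contains_ball
  proof
    fix x assume x: "x \<in> Z"
    then obtain r where r: "r > 0" "AE y in \<mu>. y \<in> ball x r \<longrightarrow> z y = 0" by (auto simp: Z_def)
    obtain d where d: "d > 0" "ball x d \<subseteq> U"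
      using x U(1) unfolding Z_def open_contains_ball by blast
    have "y \<in> Z" if y: "y \<in> ball x (min r d)" for y
    proof -
      have "y \<in> U" using y d by auto
      moreover have "AE t in \<mu>. t \<in> ball y (r - dist x y) \<longrightarrow> z t = 0"
        using r(2)
      proof eventually_elim
        case (elim t)
        then show ?case using dist_triangle[of x t y] by auto
      qed
      moreover have "r - dist x y > 0" using y by auto
      ultimately show ?thesis unfolding Z_def by blast
    qed
    then show "\<exists>e>0. ball x e \<subseteq> Z" using r d by (intro exI[of _ "min r d"]) auto
  qed
  moreover have "open (U - Z)"
    unfolding open_contains_ball
  proof
    fix x assume x: "x \<in> U - Z"
    then obtain d where d: "d > 0" "cball x d \<subseteq> U" using U(1) open_contains_cball by blast
    have "y \<notin> Z" if y: "y \<in> ball x (d / 3)" for y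
    proof
      assume "y \<in> Z"
      \<comment> \<open>The radius \<open>2 d / 3\<close> about a point \<open>y\<close> within
        \<open>d / 3\<close> of \<open>x\<close> is small enough to stay in \<open>cball x d\<close>
        and large enough to cover \<open>ball x (d / 3)\<close>; so \<open>x\<close> would belong to
        \<open>Z\<close> as well.\<close>
      have "cball y (2 * d / 3) \<subseteq> cball x d"
      proof
        fix t assume "t \<in> cball y (2 * d / 3)"
        then show "t \<in> cball x d" using y dist_triangle[of x t y] by simp
      qed
      then have "AE t in \<mu>. t \<in> ball y (2 * d / 3) \<longrightarrow> z t = 0"
        using spread[OF \<open>y \<in> Z\<close>, of "2 * d / 3"] d by auto
      then have "AE t in \<mu>. t \<in> ball x (d / 3) \<longrightarrow> z t = 0"
      proof eventually_elim
        case (elim t)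
        then show ?case using y dist_triangle[of y t x] by (auto simp: dist_commute)
      qed
      then have "x \<in> Z" using x d(1) unfolding Z_def by (auto intro!: exI[of _ "d / 3"])
      then show False using x by simp
    qed
    moreover have "ball x (d / 3) \<subseteq> U" using d by (auto simp: subset_iff)
    ultimately show "\<exists>e>0. ball x e \<subseteq> U - Z" using d(1) by (intro exI[of _ "d / 3"]) auto
  qed
  moreover have "Z \<subseteq> U" by (auto simp: Z_def)
  ultimately have "Z = {} \<or> U - Z = {}"
    using connectedD[OF U(2), of Z "U - Z"] by blast
  moreover obtain x0 where x0: "x0 \<in> U" "w x0 > 0"
    using w_nontrivial w_nonneg by force
  moreover have "x0 \<notin> Z"
  proof
    assume "x0 \<in> Z"
    obtain d where d: "d > 0" "cball x0 d \<subseteq> U" using U(1) x0(1) open_contains_cball by blast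
    then have z0: "AE t in \<mu>. t \<in> ball x0 d \<longrightarrow> z t = 0" using spread[OF \<open>x0 \<in> Z\<close>] by blast
    have "isCont w x0" using w_cont U(1) x0(1) by (simp add: continuous_on_eq_continuous_at)
    then obtain e where e: "e > 0" "\<And>y. dist y x0 < e \<Longrightarrow> dist (w y) (w x0) < w x0"
      using x0(2) unfolding continuous_at_eps_delta by blast
    have w_pos: "w y > 0" if "y \<in> ball x0 e" for y
      using e(2)[of y] that by (simp add: dist_commute dist_real_def)
    define s where "s = min d e / 2"
    have s: "s > 0" "s < d" "s < e" using d e by (auto simp: s_def)
    have sub: "cball x0 s \<subseteq> U" using s d by (auto simp: subset_iff)
    have zs: "AE t in \<mu>. bump_kernel x0 s t * z t = 0"
      using z0
    proof eventually_elim
      case (elim t)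
      then show ?case using kernel_outside(1)[OF s(1), of t x0] s by (cases "t \<in> cball x0 s") auto
    qed
    have lz: "(LINT y|\<mu>. laplacian (bump_kernel x0 s) y * z y) = 0"
    proof (rule integral_eq_zero_AE)
      show "AE y in \<mu>. laplacian (bump_kernel x0 s) y * z y = 0"
        using z0
      proof eventually_elim
        case (elim t)
        have "laplacian (bump_kernel x0 s) t = 0" if "t \<notin> ball x0 d"
        proof -
          have "t \<notin> cball x0 s" using that s by auto
          then show ?thesis unfolding laplacian_bump_kernel bump_outside[OF s(1) \<open>t \<notin> cball x0 s\<close>] by simp
        qed
        then show ?case using elim by (cases "t \<in> ball x0 d") auto
      qed
    qed
    \<comment> \<open>Since \<open>z\<close> vanishes almost everywhere on the support of this
      kernel, the supersolution inequality would force the integral of the kernel against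
      \<open>w\<close> to be nonpositive, although \<open>w\<close> is positive there.\<close>
    have "c * (LINT y|\<mu>. bump_kernel x0 s y * (w y - z y)) \<le> 0"
      using supersolution[OF test_function_bump_kernel[OF s(1) sub] bump_kernel_nonneg[OF s(1)]] lz by simp
    moreover have "(LINT y|\<mu>. bump_kernel x0 s y * z y) = 0" using zs by (rule integral_eq_zero_AE)
    ultimately have "(LINT y|\<mu>. bump_kernel x0 s y * w y) \<le> 0"
      using int_kernel(2)[OF s(1) z_int] int_kernel(2)[OF s(1) w_int] c_pos
      by (simp add: right_diff_distrib mult_le_0_iff)
    moreover have nn: "AE y in \<mu>. 0 \<le> bump_kernel x0 s y * w y"
      by (intro AE_I2) (simp add: space_restrict_space bump_kernel_nonneg[OF s(1)] w_nonneg)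
    ultimately have "(LINT y|\<mu>. bump_kernel x0 s y * w y) = 0"
      using integral_nonneg_AE[OF nn] by simp
    then have "AE y in \<mu>. bump_kernel x0 s y * w y = 0"
      using integral_nonneg_eq_0_iff_AE[OF int_kernel(2)[OF s(1) w_int] nn] by simp
    then have "AE y in \<mu>. y \<notin> ball x0 s"
    proof eventually_elim
      case (elim t)
      have "w t > 0" if "t \<in> ball x0 s" using that s by (intro w_pos) auto
      then show ?case using elim bump_kernel_pos[OF s(1), of t x0] by auto
    qed
    then have "AE y in lebesgue. y \<notin> ball x0 s"
      using U sub by (subst (asm) AE_restrict_space_iff) (auto elim!: eventually_mono simp: subset_iff)
    then have "ball x0 s \<in> null_sets lebesgue" by (subst AE_iff_null_sets) auto
    then show False
      using open_not_negligible[of "ball x0 s"] s(1) by (auto simp: negligible_iff_null_sets)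
  qed
  ultimately have Z: "Z = {}" by blast
  show ?thesis
  proof (rule ccontr)
    assume "\<not> flux x r > 0"
    then have "flux x r = 0" using flux_nonneg[OF assms(2), of x] by simp
    then have "x \<in> Z" using flux_zero_iff[OF assms(2)] assms by (auto simp: Z_def)
    then show False using Z by simp
  qed
qed

text \<open>At the fixed radius \<open>R\<close> the average is positive and continuous in its
  centre, hence has a positive minimum over a compact ball of centres. \<open>flux_lower\<close>
  hands this bound down to all smaller radii at the same centre, at the cost of one exponential
  factor.\<close>

lemma local_lower_bound:
  assumes "x0 \<in> U"
  shows "\<exists>R \<delta>. R > 0 \<and> \<delta> > 0 \<and> cball x0 (2 * R) \<subseteq> U \<and>
    (\<forall>x\<in>cball x0 R. \<forall>r. 0 < r \<and> r \<le> R \<longrightarrow> flux x r \<ge> flux_mass TYPE('m) * \<delta>)"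
proof -
  obtain d where d: "d > 0" "cball x0 d \<subseteq> U" using U(1) assms open_contains_cball by blast
  define R where "R = d / 2"
  have R: "R > 0" "cball x0 (2 * R) \<subseteq> U" using d by (auto simp: R_def)
  have sub: "cball x R \<subseteq> U" if "x \<in> cball x0 R" for x
  proof -
    have "cball x R \<subseteq> cball x0 (2 * R)"
    proof
      fix t assume "t \<in> cball x R"
      then show "t \<in> cball x0 (2 * R)" using that dist_triangle[of x0 t x] by simp
    qed
    then show ?thesis using R(2) by simp
  qed
  have "continuous_on (cball x0 R) (\<lambda>x. flux x R)"
    unfolding flux_def using flux_integral_continuous[OF z_int R(1)] by (rule continuous_on_subset) simp
  then obtain y where y: "y \<in> cball x0 R" "\<And>x. x \<in> cball x0 R \<Longrightarrow> flux y R \<le> flux x R"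
    using continuous_attains_inf[of "cball x0 R" "\<lambda>x. flux x R"] R(1) by auto
  have yU: "y \<in> U" using sub[OF y(1)] R(1) by auto
  define \<delta> where "\<delta> = exp (- (c * R\<^sup>2 / 4)) * flux y R / flux_mass TYPE('m)"
  have "\<delta> > 0" using flux_pos[OF yU R(1)] flux_mass_pos[where 'm='m] by (simp add: \<delta>_def)
  moreover have "flux x r \<ge> flux_mass TYPE('m) * \<delta>" if x: "x \<in> cball x0 R" and r: "0 < r" "r \<le> R" for x r
  proof -
    have "flux_mass TYPE('m) * \<delta> = exp (- (c * R\<^sup>2 / 4)) * flux y R"
      using flux_mass_pos[where 'm='m] by (simp add: \<delta>_def)
    also have "\<dots> \<le> exp (- (c * R\<^sup>2 / 4)) * flux x R" using y(2)[OF x] by simp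
    also have "\<dots> \<le> flux x r" by (rule flux_lower[OF r sub[OF x]])
    finally show ?thesis .
  qed
  ultimately show ?thesis using R by blast
qed

lemma AE_flux_tendsto: "AE x in \<mu>. (flux x \<longlongrightarrow> flux_mass TYPE('m) * z x) (at_right 0)"
  using AE_lebesgue_point[OF U(1,3) z_int] AE_space
proof eventually_elim
  case (elim x)
  then have "x \<in> U" by (simp add: space_restrict_space)
  from flux_kernel_tendsto[OF U(1) z_int this elim(1)] show ?case by (simp add: flux_def[abs_def])
qed

text \<open>Bounds that hold for all small radii survive the limit at Lebesgue points, so uniform
  bounds on averages become bounds on \<open>z\<close> itself.\<close>

lemma AE_flux_bound:
  assumes "R > 0"
  shows "(\<And>x r. x \<in> S \<Longrightarrow> 0 < r \<Longrightarrow> r \<le> R \<Longrightarrow> flux_mass TYPE('m) * \<delta> \<le> flux x r) \<Longrightarrow>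
      AE x in \<mu>. x \<in> S \<longrightarrow> \<delta> \<le> z x"
    and "(\<And>x r. x \<in> S \<Longrightarrow> 0 < r \<Longrightarrow> r \<le> R \<Longrightarrow> flux x r \<le> flux_mass TYPE('m) * \<delta>) \<Longrightarrow>
      AE x in \<mu>. x \<in> S \<longrightarrow> z x \<le> \<delta>"
proof -
  have ev: "\<forall>\<^sub>F r in at_right 0. P r" if "\<And>r. 0 < r \<Longrightarrow> r \<le> R \<Longrightarrow> P r" for P
    unfolding eventually_at_right_field using that assms by (intro exI[of _ R]) auto
  show "AE x in \<mu>. x \<in> S \<longrightarrow> \<delta> \<le> z x"
    if low: "\<And>x r. x \<in> S \<Longrightarrow> 0 < r \<Longrightarrow> r \<le> R \<Longrightarrow> flux_mass TYPE('m) * \<delta> \<le> flux x r"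
    using AE_flux_tendsto
  proof eventually_elim
    case (elim x)
    have "flux_mass TYPE('m) * \<delta> \<le> flux_mass TYPE('m) * z x" if "x \<in> S"
      by (rule tendsto_lowerbound[OF elim ev[OF low[OF that]] trivial_limit_at_right_real])
    then show ?case using flux_mass_pos[where 'm='m] by simp
  qed
  show "AE x in \<mu>. x \<in> S \<longrightarrow> z x \<le> \<delta>"
    if up: "\<And>x r. x \<in> S \<Longrightarrow> 0 < r \<Longrightarrow> r \<le> R \<Longrightarrow> flux x r \<le> flux_mass TYPE('m) * \<delta>"
    using AE_flux_tendsto
  proof eventually_elim
    case (elim x)
    have "flux_mass TYPE('m) * z x \<le> flux_mass TYPE('m) * \<delta>" if "x \<in> S"
      by (rule tendsto_upperbound[OF elim ev[OF up[OF that]] trivial_limit_at_right_real])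
    then show ?case using flux_mass_pos[where 'm='m] by simp
  qed
qed

text \<open>Near \<open>x0\<close> the lower bound lets bump kernels be used in
  \<open>solution\<close>, which controls the derivative of the averages from below. Averages can
  then grow only by a fixed amount as the radius shrinks, and those of radius \<open>R / 2\<close>
  are bounded by compactness. Halving the ball of centres keeps all balls involved inside
  \<open>cball x0 R\<close>, where the lower bound holds.\<close>

lemma local_bounds:
  assumes "x0 \<in> U"
  shows "\<exists>R \<delta> M. R > 0 \<and> \<delta> > 0 \<and> cball x0 (2 * R) \<subseteq> U \<and>
    (\<forall>x\<in>cball x0 R. \<forall>r. 0 < r \<and> r \<le> R \<longrightarrow> flux x r \<ge> flux_mass TYPE('m) * \<delta>) \<and>
    (AE x in \<mu>. x \<in> cball x0 R \<longrightarrow> z x \<ge> \<delta>) \<and> (AE x in \<mu>. x \<in> cball x0 (R / 2) \<longrightarrow> z x \<le> M)"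
proof -
  obtain R \<delta> where R: "R > 0" "\<delta> > 0" "cball x0 (2 * R) \<subseteq> U"
    and low: "\<And>x r. x \<in> cball x0 R \<Longrightarrow> 0 < r \<Longrightarrow> r \<le> R \<Longrightarrow> flux x r \<ge> flux_mass TYPE('m) * \<delta>"
    using local_lower_bound[OF assms] by blast
  have z_low: "AE x in \<mu>. x \<in> cball x0 R \<longrightarrow> z x \<ge> \<delta>"
    by (rule AE_flux_bound(1)[OF R(1) low])
  have R_sub: "cball x0 R \<subseteq> U" using R subset_cball[of R "2 * R" x0] by simp
  obtain W where W: "\<And>x. x \<in> cball x0 R \<Longrightarrow> w x \<le> W" "W \<ge> 0"
  proof -
    have "continuous_on (cball x0 R) w" using w_cont R_sub by (rule continuous_on_subset)
    then obtain y where "y \<in> cball x0 R" "\<And>x. x \<in> cball x0 R \<Longrightarrow> w x \<le> w y"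
      using continuous_attains_sup[of "cball x0 R" w] R(1) by auto
    then show ?thesis using that[of "w y"] w_nonneg R_sub by blast
  qed
  let ?b = "bump_mass TYPE('m)"
  \<comment> \<open>The radial derivative of \<open>flux\<close> is at least
    \<open>- c * W * ?b * s\<close>; the added quadratic term is a primitive of the opposite
    quantity, so the sum is nondecreasing.\<close>
  have grow: "flux x r + c * W * ?b * r\<^sup>2 / 2 \<le> flux x (R / 2) + c * W * ?b * (R / 2)\<^sup>2 / 2"
    if x: "x \<in> cball x0 (R / 2)" and r: "0 < r" "r \<le> R / 2" for x r
  proof (rule DERIV_nonneg_imp_nondecreasing[OF r(2)])
    fix s assume s: "r \<le> s" "s \<le> R / 2"
    let ?L = "LINT y|\<mu>. laplacian (bump_kernel x s) y * z y"
    have s0: "s > 0" using s r by simp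
    have sub: "cball x s \<subseteq> cball x0 R"
    proof
      fix t assume "t \<in> cball x s"
      then show "t \<in> cball x0 R" using x s dist_triangle[of x0 t x] by simp
    qed
    then have subU: "cball x s \<subseteq> U" using R_sub by simp
    have "((\<lambda>s. c * W * ?b * s\<^sup>2 / 2) has_real_derivative c * W * ?b * s) (at s)"
      by (auto intro!: derivative_eq_intros)
    from DERIV_add[OF flux_deriv[OF s0, of x] this]
    have D: "((\<lambda>s. flux x s + c * W * ?b * s\<^sup>2 / 2) has_real_derivative s * (?L + c * W * ?b)) (at s)"
      by (rule DERIV_cong) (simp add: algebra_simps)
    have "- ?L \<le> c * (W * ?b)"
    proof -
      have "AE y in \<mu>. bump_kernel x s y \<noteq> 0 \<longrightarrow> \<delta> \<le> z y"
        using z_low by eventually_elim (use kernel_outside(1)[OF s0] sub in blast)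
      from solution[OF test_function_bump_kernel[OF s0 subU] R(2) this]
      have "- ?L = c * (LINT y|\<mu>. bump_kernel x s y * (w y - z y))" by simp
      also have "\<dots> \<le> c * (LINT y|\<mu>. bump_kernel x s y * W)"
      proof (rule mult_left_mono[OF integral_mono])
        show "integrable \<mu> (\<lambda>y. bump_kernel x s y * (w y - z y))"
          by (rule int_kernel(2)[OF s0 Bochner_Integration.integrable_diff[OF w_int z_int]])
        show "integrable \<mu> (\<lambda>y. bump_kernel x s y * W)"
          by (rule int_kernel(2)[OF s0 finite_measure.integrable_const[OF finite_measure_lebesgue_on[OF U(3)]]])
        show "bump_kernel x s y * (w y - z y) \<le> bump_kernel x s y * W" for y
        proof (cases "y \<in> cball x s")
          case True
          then have "w y - z y \<le> W" using W(1)[of y] sub z_nonneg[of y] by fastforce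
          then show ?thesis using bump_kernel_nonneg[OF s0] by (rule mult_left_mono)
        next
          case False
          then show ?thesis by (simp add: kernel_outside(1)[OF s0 False])
        qed
      qed (use c_pos in simp)
      also have "(LINT y|\<mu>. bump_kernel x s y * W) = W * ?b"
        using integral_kernel(1)[OF s0 subU U(1)] by simp
      finally show ?thesis .
    qed
    then have "0 \<le> s * (?L + c * W * ?b)" using s0 by (intro mult_nonneg_nonneg) (auto simp: mult.assoc)
    with D show "\<exists>y. ((\<lambda>s. flux x s + c * W * ?b * s\<^sup>2 / 2) has_real_derivative y) (at s) \<and> 0 \<le> y"
      by blast
  qed
  have "continuous_on (cball x0 (R / 2)) (\<lambda>x. flux x (R / 2))"
    unfolding flux_def using R(1) by (intro continuous_on_subset[OF flux_integral_continuous[OF z_int]]) auto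
  moreover have "cball x0 (R / 2) \<noteq> {}" using R(1) by simp
  ultimately obtain y where y: "\<And>x. x \<in> cball x0 (R / 2) \<Longrightarrow> flux x (R / 2) \<le> flux y (R / 2)"
    using continuous_attains_sup[OF compact_cball] by blast
  define M where "M = (flux y (R / 2) + c * W * ?b * (R / 2)\<^sup>2 / 2) / flux_mass TYPE('m)"
  have "?b \<ge> 0"
    unfolding bump_mass_def by (intro integral_nonneg_AE AE_I2) (simp add: bump_kernel_nonneg)
  have up: "flux x r \<le> flux_mass TYPE('m) * M" if x: "x \<in> cball x0 (R / 2)" and r: "0 < r" "r \<le> R / 2" for x r
  proof -
    have "0 \<le> c * W * ?b * r\<^sup>2 / 2" using c_pos W(2) \<open>?b \<ge> 0\<close> by simp
    then have "flux x r \<le> flux y (R / 2) + c * W * ?b * (R / 2)\<^sup>2 / 2"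
      using grow[OF x r] y[OF x] by linarith
    then show ?thesis using flux_mass_pos[where 'm='m] by (simp add: M_def)
  qed
  have "AE x in \<mu>. x \<in> cball x0 (R / 2) \<longrightarrow> z x \<le> M"
    by (rule AE_flux_bound(2)[OF half_gt_zero[OF R(1)] up])
  then show ?thesis using R low z_low by blast
qed

text \<open>With \<open>z\<close> bounded on both sides and the equation available, the radial
  derivative of \<open>flux\<close> is bounded uniformly in the centre. The averages therefore form
  a uniform Cauchy sequence as the radius shrinks; their limit is continuous as a uniform limit of
  continuous functions, and equals \<open>flux_mass\<close> times \<open>z\<close> at Lebesgue
  points. The lower bound on averages makes the limit positive everywhere.\<close>

lemma continuous_representative:
  assumes "x0 \<in> U"
  shows "\<exists>\<eta> a. \<eta> > 0 \<and> ball x0 \<eta> \<subseteq> U \<and> continuous_on (ball x0 \<eta>) a \<and> (\<forall>x\<in>ball x0 \<eta>. a x > 0) \<and>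
    (AE x in \<mu>. x \<in> ball x0 \<eta> \<longrightarrow> z x = a x)"
proof -
  let ?\<kappa> = "flux_mass TYPE('m)" and ?b = "bump_mass TYPE('m)"
  have \<kappa>: "?\<kappa> > 0" by (rule flux_mass_pos)
  obtain R \<delta> M where R: "R > 0" "\<delta> > 0" "cball x0 (2 * R) \<subseteq> U"
    and low: "\<And>x r. x \<in> cball x0 R \<Longrightarrow> 0 < r \<Longrightarrow> r \<le> R \<Longrightarrow> flux x r \<ge> ?\<kappa> * \<delta>"
    and z_low: "AE x in \<mu>. x \<in> cball x0 R \<longrightarrow> z x \<ge> \<delta>"
    and z_up: "AE x in \<mu>. x \<in> cball x0 (R / 2) \<longrightarrow> z x \<le> M"
    using local_bounds[OF assms] by blast
  have R_sub: "cball x0 R \<subseteq> U" using R subset_cball[of R "2 * R" x0] by simp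
  obtain W where W: "\<And>x. x \<in> cball x0 R \<Longrightarrow> w x \<le> W"
  proof -
    have "continuous_on (cball x0 R) w" using w_cont R_sub by (rule continuous_on_subset)
    moreover have "cball x0 R \<noteq> {}" using R(1) by simp
    ultimately obtain y where "\<And>x. x \<in> cball x0 R \<Longrightarrow> w x \<le> w y"
      using continuous_attains_sup[OF compact_cball] by blast
    then show ?thesis by (rule that)
  qed
  define K where "K = c * (\<bar>W\<bar> + \<bar>M\<bar>) * ?b"
  \<comment> \<open>Centres within \<open>R / 4\<close> of \<open>x0\<close> and radii up to
    \<open>R / 4\<close> keep every ball inside \<open>cball x0 (R / 2)\<close>, where both bounds
    on \<open>z\<close> hold.\<close>
  define \<eta> where "\<eta> = R / 4"
  have \<eta>: "\<eta> > 0" "\<eta> + \<eta> \<le> R / 2" "\<eta> \<le> R" using R(1) by (auto simp: \<eta>_def)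
  have deriv_bound: "\<bar>s * (LINT y|\<mu>. laplacian (bump_kernel x s) y * z y)\<bar> \<le> K * \<eta>"
    if x: "x \<in> ball x0 \<eta>" and s: "0 < s" "s \<le> \<eta>" for x s
  proof -
    let ?L = "LINT y|\<mu>. laplacian (bump_kernel x s) y * z y"
    have sub: "cball x s \<subseteq> cball x0 (R / 2)"
    proof
      fix t assume "t \<in> cball x s"
      then show "t \<in> cball x0 (R / 2)" using x s \<eta>(2) dist_triangle[of x0 t x] by simp
    qed
    have subR: "cball x0 (R / 2) \<subseteq> cball x0 R" using R(1) by (intro subset_cball) simp
    have subU: "cball x s \<subseteq> U" using sub subR R_sub by simp
    have "AE y in \<mu>. bump_kernel x s y \<noteq> 0 \<longrightarrow> \<delta> \<le> z y"
      using z_low by eventually_elim (use kernel_outside(1)[OF s(1)] sub subR in blast)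
    from solution[OF test_function_bump_kernel[OF s(1) subU] R(2) this]
    have "\<bar>?L\<bar> = \<bar>c * (LINT y|\<mu>. bump_kernel x s y * (w y - z y))\<bar>" by simp
    also have "\<dots> = c * \<bar>LINT y|\<mu>. bump_kernel x s y * (w y - z y)\<bar>"
      using c_pos by (simp only: abs_mult abs_of_pos)
    also have "\<bar>LINT y|\<mu>. bump_kernel x s y * (w y - z y)\<bar> \<le> (LINT y|\<mu>. \<bar>bump_kernel x s y * (w y - z y)\<bar>)"
      by (rule integral_abs_bound)
    also have "\<dots> \<le> (LINT y|\<mu>. bump_kernel x s y * (\<bar>W\<bar> + \<bar>M\<bar>))"
    proof (rule integral_mono_AE)
      show "integrable \<mu> (\<lambda>y. \<bar>bump_kernel x s y * (w y - z y)\<bar>)"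
        by (intro integrable_abs int_kernel(2)[OF s(1) Bochner_Integration.integrable_diff[OF w_int z_int]])
      show "integrable \<mu> (\<lambda>y. bump_kernel x s y * (\<bar>W\<bar> + \<bar>M\<bar>))"
        by (rule int_kernel(2)[OF s(1) finite_measure.integrable_const[OF finite_measure_lebesgue_on[OF U(3)]]])
      show "AE y in \<mu>. \<bar>bump_kernel x s y * (w y - z y)\<bar> \<le> bump_kernel x s y * (\<bar>W\<bar> + \<bar>M\<bar>)"
        using z_up
      proof eventually_elim
        case (elim y)
        show ?case
        proof (cases "y \<in> cball x s")
          case True
          then have "y \<in> cball x0 (R / 2)" "y \<in> cball x0 R" "y \<in> U" using sub subR R_sub by blast+
          then have "\<bar>w y - z y\<bar> \<le> \<bar>W\<bar> + \<bar>M\<bar>"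
            using W[of y] elim w_nonneg[of y] z_nonneg[of y] by linarith
          then show ?thesis
            using bump_kernel_nonneg[OF s(1), of x y] by (simp add: abs_mult mult_left_mono)
        next
          case False
          then show ?thesis by (simp add: kernel_outside(1)[OF s(1) False])
        qed
      qed
    qed
    also have "\<dots> = (\<bar>W\<bar> + \<bar>M\<bar>) * ?b"
      using integral_kernel(1)[OF s(1) subU U(1)] by simp
    finally have L: "\<bar>?L\<bar> \<le> K" using c_pos by (simp add: K_def mult.assoc)
    have "\<bar>s * ?L\<bar> = \<bar>?L\<bar> * s" using s by (simp add: abs_mult)
    also have "\<dots> \<le> K * \<eta>"
      using L s by (intro mult_mono) auto
    finally show ?thesis .
  qed
  have lip: "\<bar>flux x r - flux x s\<bar> \<le> K * \<eta> * \<bar>r - s\<bar>"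
    if x: "x \<in> ball x0 \<eta>" and r: "0 < r" "r \<le> \<eta>" and s: "0 < s" "s \<le> \<eta>" for x r s
  proof -
    have "norm (flux x r - flux x s) \<le> K * \<eta> * norm (r - s)"
      by (rule field_differentiable_bound[of "{0<..\<eta>}" "flux x"
            "\<lambda>s. s * (LINT y|\<mu>. laplacian (bump_kernel x s) y * z y)"])
        (use deriv_bound[OF x] r s in \<open>auto intro: has_field_derivative_at_within flux_deriv\<close>)
    then show ?thesis by simp
  qed
  define \<rho> where "\<rho> n = \<eta> / real (Suc n)" for n
  have \<rho>: "0 < \<rho> n" "\<rho> n \<le> \<eta>" for n using \<eta>(1) by (auto simp: \<rho>_def field_simps)
  have \<rho>_lim: "\<rho> \<longlonglongrightarrow> 0"
    using tendsto_mult_right_zero[OF LIMSEQ_inverse_real_of_nat, of \<eta>] by (simp add: \<rho>_def[abs_def] divide_inverse)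
  have "uniformly_convergent_on (ball x0 \<eta>) (\<lambda>n x. flux x (\<rho> n))"
    unfolding uniformly_convergent_eq_Cauchy uniformly_Cauchy_on_def
  proof (intro allI impI)
    fix e :: real assume "e > 0"
    have "(\<lambda>n. (\<bar>K * \<eta>\<bar> + 1) * \<rho> n) \<longlonglongrightarrow> (\<bar>K * \<eta>\<bar> + 1) * 0" by (intro tendsto_intros \<rho>_lim)
    then have "\<forall>\<^sub>F n in sequentially. (\<bar>K * \<eta>\<bar> + 1) * \<rho> n < e"
      using \<open>e > 0\<close> by (intro order_tendstoD) auto
    then obtain N where N: "\<And>n. n \<ge> N \<Longrightarrow> (\<bar>K * \<eta>\<bar> + 1) * \<rho> n < e"
      unfolding eventually_sequentially by blast
    show "\<exists>N. \<forall>x\<in>ball x0 \<eta>. \<forall>m\<ge>N. \<forall>n\<ge>N. dist (flux x (\<rho> m)) (flux x (\<rho> n)) < e"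
    proof (intro exI[of _ N] ballI allI impI)
      fix x m n assume x: "x \<in> ball x0 \<eta>" and mn: "m \<ge> N" "n \<ge> N"
      have *: "\<bar>\<rho> m - \<rho> n\<bar> \<le> max (\<rho> m) (\<rho> n)" using \<rho>(1)[of m] \<rho>(1)[of n] by auto
      have "\<bar>flux x (\<rho> m) - flux x (\<rho> n)\<bar> \<le> K * \<eta> * \<bar>\<rho> m - \<rho> n\<bar>" by (rule lip[OF x \<rho> \<rho>])
      also have "\<dots> \<le> (\<bar>K * \<eta>\<bar> + 1) * max (\<rho> m) (\<rho> n)"
        using * by (intro mult_mono) auto
      also have "\<dots> < e" using N[OF mn(1)] N[OF mn(2)] by (simp add: max_def)
      finally show "dist (flux x (\<rho> m)) (flux x (\<rho> n)) < e" by (simp add: dist_real_def)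
    qed
  qed
  then obtain a where a: "uniform_limit (ball x0 \<eta>) (\<lambda>n x. flux x (\<rho> n)) a sequentially"
    unfolding uniformly_convergent_on_def by blast
  have cont: "continuous_on (ball x0 \<eta>) a"
  proof (rule uniform_limit_theorem[OF _ a])
    show "\<forall>\<^sub>F n in sequentially. continuous_on (ball x0 \<eta>) (\<lambda>x. flux x (\<rho> n))"
      unfolding flux_def using continuous_on_subset[OF flux_integral_continuous[OF z_int \<rho>(1)]]
      by (intro always_eventually) blast
  qed simp
  have lim: "(\<lambda>n. flux x (\<rho> n)) \<longlonglongrightarrow> a x" if "x \<in> ball x0 \<eta>" for x
    using tendsto_uniform_limitI[OF a that] .
  have pos: "a x \<ge> ?\<kappa> * \<delta>" if "x \<in> ball x0 \<eta>" for x
  proof (rule LIMSEQ_le_const[OF lim[OF that]])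
    show "\<exists>N. \<forall>n\<ge>N. ?\<kappa> * \<delta> \<le> flux x (\<rho> n)"
      using low[of x] \<rho> that \<eta>(3) by (meson ball_subset_cball order_trans subset_ball subsetD)
  qed
  have eq: "AE x in \<mu>. x \<in> ball x0 \<eta> \<longrightarrow> z x = a x / ?\<kappa>"
    using AE_flux_tendsto
  proof eventually_elim
    case (elim x)
    have "z x = a x / ?\<kappa>" if "x \<in> ball x0 \<eta>"
    proof -
      have "filterlim \<rho> (at_right 0) sequentially"
        using \<rho>_lim \<rho>(1) by (simp add: filterlim_at less_imp_neq[symmetric])
      then have "(\<lambda>n. flux x (\<rho> n)) \<longlonglongrightarrow> ?\<kappa> * z x" by (rule filterlim_compose[OF elim])
      then have "a x = ?\<kappa> * z x" using LIMSEQ_unique lim[OF that] by blast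
      then show ?thesis using \<kappa> by simp
    qed
    then show ?case by blast
  qed
  show ?thesis
  proof (intro exI conjI)
    show "\<eta> > 0" by (rule \<eta>)
    show "ball x0 \<eta> \<subseteq> U" using \<eta>(3) R_sub by (auto simp: subset_iff)
    show "continuous_on (ball x0 \<eta>) (\<lambda>x. a x / ?\<kappa>)" using cont \<kappa> by (intro continuous_intros) auto
    show "\<forall>x\<in>ball x0 \<eta>. a x / ?\<kappa> > 0"
      using pos R(2) \<kappa> by (metis divide_pos_pos less_le_trans mult_pos_pos)
    show "AE x in \<mu>. x \<in> ball x0 \<eta> \<longrightarrow> z x = a x / ?\<kappa>" by (rule eq)
  qed
qed

end


section \<open>Square summable functions and weak derivatives\<close>

lemma borel_measurable_lebesgue_on_AE:
  fixes f g :: "'a::euclidean_space \<Rightarrow> 'b::euclidean_space"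
  assumes "A \<in> sets lebesgue" "f \<in> borel_measurable (lebesgue_on A)" "AE x in lebesgue_on A. f x = g x"
  shows "g \<in> borel_measurable (lebesgue_on A)"
proof -
  have "(\<lambda>x. indicator A x *\<^sub>R f x) \<in> borel_measurable lebesgue"
    using assms by (subst (asm) borel_measurable_restrict_space_iff) auto
  moreover have "AE x in lebesgue. indicator A x *\<^sub>R f x = indicator A x *\<^sub>R g x"
    using assms by (subst (asm) AE_restrict_space_iff) (auto elim!: eventually_mono simp: indicator_def)
  ultimately have "(\<lambda>x. indicator A x *\<^sub>R g x) \<in> borel_measurable lebesgue"
    by (rule borel_measurable_AE)
  then show ?thesis using assms by (subst borel_measurable_restrict_space_iff) auto
qed

lemma AE_lebesgue_on_cball_iff:
  "(AE x in lebesgue_on (cball a r). P x) \<longleftrightarrow> (AE x in lebesgue_on (ball a r). P x)"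
proof -
  have "AE x in lebesgue. x \<notin> sphere a r"
    using AE_not_in negligible_sphere negligible_iff_null_sets by blast
  then have "(AE x in lebesgue. x \<in> cball a r \<longrightarrow> P x) \<longleftrightarrow> (AE x in lebesgue. x \<in> ball a r \<longrightarrow> P x)"
  proof (intro iffI)
    assume ae: "AE x in lebesgue. x \<notin> sphere a r" and "AE x in lebesgue. x \<in> cball a r \<longrightarrow> P x"
    from this(2) show "AE x in lebesgue. x \<in> ball a r \<longrightarrow> P x" by eventually_elim auto
  next
    assume "AE x in lebesgue. x \<notin> sphere a r" "AE x in lebesgue. x \<in> ball a r \<longrightarrow> P x"
    then show "AE x in lebesgue. x \<in> cball a r \<longrightarrow> P x" by eventually_elim auto
  qed
  then show ?thesis by (simp add: AE_restrict_space_iff)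
qed

lemma integral_lebesgue_on_cball:
  fixes f :: "'a::euclidean_space \<Rightarrow> 'b::euclidean_space"
  assumes "f \<in> borel_measurable (lebesgue_on (cball a r))"
  shows "(LINT x|lebesgue_on (cball a r). f x) = (LINT x|lebesgue_on (ball a r). f x)"
proof -
  have m: "(\<lambda>x. indicator (cball a r) x *\<^sub>R f x) \<in> borel_measurable lebesgue"
    using assms by (subst (asm) borel_measurable_restrict_space_iff) auto
  have ae: "AE x in lebesgue. indicator (cball a r) x *\<^sub>R f x = indicator (ball a r) x *\<^sub>R f x"
  proof -
    have "AE x in lebesgue. x \<notin> sphere a r"
      using AE_not_in negligible_sphere negligible_iff_null_sets by blast
    then show ?thesis by eventually_elim (auto simp: indicator_def)
  qed
  have "(LINT x|lebesgue. indicator (cball a r) x *\<^sub>R f x) = (LINT x|lebesgue. indicator (ball a r) x *\<^sub>R f x)"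
    by (rule integral_cong_AE[OF m borel_measurable_AE[OF m ae] ae])
  then show ?thesis by (subst (1 2) integral_restrict_space) auto
qed

lemma square_summable_AE_cong:
  assumes A: "A \<in> sets lebesgue" and F: "square_summable A F" and ae: "AE x in lebesgue_on A. F x = G x"
  shows "square_summable A G"
proof -
  have m: "F \<in> borel_measurable (lebesgue_on A)" using F by (simp add: square_summable_def)
  have m': "G \<in> borel_measurable (lebesgue_on A)" by (rule borel_measurable_lebesgue_on_AE[OF A m ae])
  have "AE x in lebesgue_on A. (norm (F x))\<^sup>2 = (norm (G x))\<^sup>2"
    using ae by eventually_elim simp
  moreover have "(\<lambda>x. (norm (F x))\<^sup>2) \<in> borel_measurable (lebesgue_on A)"
    "(\<lambda>x. (norm (G x))\<^sup>2) \<in> borel_measurable (lebesgue_on A)"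
    using m m' by measurable
  ultimately have "integrable (lebesgue_on A) (\<lambda>x. (norm (G x))\<^sup>2)"
    using integrable_cong_AE[of "\<lambda>x. (norm (F x))\<^sup>2" _ "\<lambda>x. (norm (G x))\<^sup>2"] F
    unfolding square_summable_def by blast
  then show ?thesis using m' by (simp add: square_summable_def)
qed

lemma integral_norm2_AE_cong:
  assumes A: "A \<in> sets lebesgue" and F: "square_summable A F" and ae: "AE x in lebesgue_on A. F x = G x"
  shows "(LINT x|lebesgue_on A. (norm (F x))\<^sup>2) = (LINT x|lebesgue_on A. (norm (G x))\<^sup>2)"
proof (rule integral_cong_AE)
  show "(\<lambda>x. (norm (F x))\<^sup>2) \<in> borel_measurable (lebesgue_on A)"
    "(\<lambda>x. (norm (G x))\<^sup>2) \<in> borel_measurable (lebesgue_on A)"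
    using F square_summable_AE_cong[OF assms] unfolding square_summable_def by blast+
  show "AE x in lebesgue_on A. (norm (F x))\<^sup>2 = (norm (G x))\<^sup>2" using ae by eventually_elim simp
qed

lemma square_summable_dominated:
  assumes "F \<in> borel_measurable (lebesgue_on A)" "integrable (lebesgue_on A) k"
    and "\<And>x. x \<in> A \<Longrightarrow> (norm (F x))\<^sup>2 \<le> k x"
  shows "square_summable A F"
  unfolding square_summable_def
proof (intro conjI assms(1) Bochner_Integration.integrable_bound[OF assms(2)])
  show "(\<lambda>x. (norm (F x))\<^sup>2) \<in> borel_measurable (lebesgue_on A)" using assms(1) by measurable
  show "AE x in lebesgue_on A. norm ((norm (F x))\<^sup>2) \<le> norm (k x)"
    using assms(3) by (intro AE_I2) (fastforce simp: space_restrict_space)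
qed

lemma square_summable_add:
  assumes F: "square_summable A F" and G: "square_summable A G"
  shows "square_summable A (\<lambda>x. F x + G x)"
proof (rule square_summable_dominated[where k = "\<lambda>x. 2 * (norm (F x))\<^sup>2 + 2 * (norm (G x))\<^sup>2"])
  show "(\<lambda>x. F x + G x) \<in> borel_measurable (lebesgue_on A)"
    using F G by (auto simp: square_summable_def)
  show "integrable (lebesgue_on A) (\<lambda>x. 2 * (norm (F x))\<^sup>2 + 2 * (norm (G x))\<^sup>2)"
    using F G by (simp add: square_summable_def)
  fix x
  have "(norm (F x + G x))\<^sup>2 + (norm (F x - G x))\<^sup>2 = 2 * (norm (F x))\<^sup>2 + 2 * (norm (G x))\<^sup>2"
    by (simp add: power2_norm_eq_inner inner_add_left inner_add_right inner_diff_left inner_diff_right)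
  then show "(norm (F x + G x))\<^sup>2 \<le> 2 * (norm (F x))\<^sup>2 + 2 * (norm (G x))\<^sup>2"
    by (metis add_increasing2 order_refl zero_le_power2)
qed

lemma square_summable_bounded_linear:
  fixes F :: "real ^ 'm::finite \<Rightarrow> 'b::euclidean_space" and L :: "'b \<Rightarrow> 'c::euclidean_space"
  assumes F: "square_summable A F" and L: "bounded_linear L"
  shows "square_summable A (\<lambda>x. L (F x))"
proof -
  obtain K where K: "\<And>x. norm (L x) \<le> norm x * K" using bounded_linear.bounded[OF L] by blast
  show ?thesis
  proof (rule square_summable_dominated[where k = "\<lambda>x. K\<^sup>2 * (norm (F x))\<^sup>2"])
    have "L \<in> borel_measurable borel"
      by (intro borel_measurable_continuous_onI linear_continuous_on L)
    then show "(\<lambda>x. L (F x)) \<in> borel_measurable (lebesgue_on A)"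
      using F unfolding square_summable_def by (auto intro: measurable_compose)
    show "integrable (lebesgue_on A) (\<lambda>x. K\<^sup>2 * (norm (F x))\<^sup>2)"
      using F by (simp add: square_summable_def)
    show "(norm (L (F x)))\<^sup>2 \<le> K\<^sup>2 * (norm (F x))\<^sup>2" for x
      using power_mono[OF K norm_ge_zero, of "F x" 2] by (simp add: power_mult_distrib mult.commute)
  qed
qed

lemma square_summable_uminus:
  shows "square_summable A F \<Longrightarrow> square_summable A (\<lambda>x. - F x)"
  by (simp add: square_summable_def)

lemma square_summable_diff:
  assumes "square_summable A F" "square_summable A G"
  shows "square_summable A (\<lambda>x. F x - G x)"
  using square_summable_add[OF assms(1) square_summable_uminus[OF assms(2)]] by simp

lemma square_summable_bounded:
  assumes "F \<in> borel_measurable (lebesgue_on A)" "A \<in> lmeasurable" "\<And>x. x \<in> A \<Longrightarrow> norm (F x) \<le> C"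
  shows "square_summable A F"
proof (rule square_summable_dominated[OF assms(1)])
  show "integrable (lebesgue_on A) (\<lambda>_. C\<^sup>2)"
    by (rule finite_measure.integrable_const[OF finite_measure_lebesgue_on[OF assms(2)]])
  show "(norm (F x))\<^sup>2 \<le> C\<^sup>2" if "x \<in> A" for x using assms(3)[OF that] by (intro power_mono) auto
qed

lemma square_summable_test_function:
  fixes e :: "'b::euclidean_space"
  assumes "test_function U \<phi>" "A \<in> lmeasurable"
  shows "square_summable A (\<lambda>x. \<phi> x *\<^sub>R e)"
proof -
  obtain C where "\<And>x. \<bar>\<phi> x\<bar> \<le> C" using test_function_bounded[OF assms(1)] by blast
  then show ?thesis
    using test_function_measurable[OF assms(1)] assms(2)
    by (intro square_summable_bounded[where C = "C * norm e"]) (auto intro: mult_right_mono)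
qed

lemma square_summable_subset:
  assumes "square_summable A F" "A \<in> sets lebesgue" "V \<in> sets lebesgue" "V \<subseteq> A"
  shows "square_summable V F"
proof -
  have "F \<in> borel_measurable (lebesgue_on V)"
    using assms(1,4) unfolding square_summable_def by (blast intro: measurable_restrict_mono)
  then show ?thesis
    using assms integrable_lebesgue_on_subset[of A "\<lambda>x. (norm (F x))\<^sup>2" V]
    unfolding square_summable_def by blast
qed

lemma square_summable_inner:
  assumes F: "square_summable A F" and G: "square_summable A G"
  shows "integrable (lebesgue_on A) (\<lambda>x. F x \<bullet> G x)"
proof (rule Bochner_Integration.integrable_bound[where f = "\<lambda>x. (norm (F x))\<^sup>2 + (norm (G x))\<^sup>2"])
  show "integrable (lebesgue_on A) (\<lambda>x. (norm (F x))\<^sup>2 + (norm (G x))\<^sup>2)"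
    using F G by (simp add: square_summable_def)
  show "(\<lambda>x. F x \<bullet> G x) \<in> borel_measurable (lebesgue_on A)" using F G by (auto simp: square_summable_def)
  have "norm (F x \<bullet> G x) \<le> norm ((norm (F x))\<^sup>2 + (norm (G x))\<^sup>2)" for x
  proof -
    have "\<bar>F x \<bullet> G x\<bar> \<le> norm (F x) * norm (G x)" by (rule Cauchy_Schwarz_ineq2)
    also have "\<dots> \<le> (norm (F x))\<^sup>2 + (norm (G x))\<^sup>2"
      using sum_squares_bound[of "norm (F x)" "norm (G x)"] zero_le_power2[of "norm (F x)"]
        zero_le_power2[of "norm (G x)"] mult_nonneg_nonneg[OF norm_ge_zero norm_ge_zero, of "F x" "G x"]
      by linarith
    finally show ?thesis by simp
  qed
  then show "AE x in lebesgue_on A. norm (F x \<bullet> G x) \<le> norm ((norm (F x))\<^sup>2 + (norm (G x))\<^sup>2)" by simp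
qed

lemma square_summable_norm2:
  "square_summable A F \<Longrightarrow> integrable (lebesgue_on A) (\<lambda>x. (norm (F x))\<^sup>2)"
  by (simp add: square_summable_def)

lemma integrable_test_function_partial_scaleR:
  fixes F :: "real ^ 'm::finite \<Rightarrow> 'b::euclidean_space"
  assumes "integrable (lebesgue_on V) F" "test_function U \<phi>"
  shows "integrable (lebesgue_on V) (\<lambda>x. partial_deriv i \<phi> x *\<^sub>R F x)"
  by (rule integrable_test_function_scaleR[OF assms(1) test_function_partial_deriv[OF assms(2)]])

lemma has_weak_partial_add:
  assumes "has_weak_partial U i F F'" "has_weak_partial U i G G'"
    and "integrable (lebesgue_on U) F" "integrable (lebesgue_on U) F'"
    and "integrable (lebesgue_on U) G" "integrable (lebesgue_on U) G'"
  shows "has_weak_partial U i (\<lambda>x. F x + G x) (\<lambda>x. F' x + G' x)"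
  unfolding has_weak_partial_def
proof (intro allI impI)
  fix \<phi> assume \<phi>: "test_function U \<phi>"
  note i = integrable_test_function_partial_scaleR[OF _ \<phi>] integrable_test_function_scaleR[OF _ \<phi>]
  show "(LINT x|lebesgue_on U. partial_deriv i \<phi> x *\<^sub>R (F x + G x)) = - (LINT x|lebesgue_on U. \<phi> x *\<^sub>R (F' x + G' x))"
    using assms(1,2) \<phi> unfolding has_weak_partial_def
    by (simp add: scaleR_add_right i(1)[OF assms(3)] i(1)[OF assms(5)] i(2)[OF assms(4)] i(2)[OF assms(6)])
qed

lemma has_weak_partial_bounded_linear:
  fixes F :: "real ^ 'm::finite \<Rightarrow> 'b::euclidean_space" and L :: "'b \<Rightarrow> 'c::euclidean_space"
  assumes "has_weak_partial U i F F'" "bounded_linear L"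
    and "integrable (lebesgue_on U) F" "integrable (lebesgue_on U) F'"
  shows "has_weak_partial U i (\<lambda>x. L (F x)) (\<lambda>x. L (F' x))"
  unfolding has_weak_partial_def
proof (intro allI impI)
  fix \<phi> assume \<phi>: "test_function U \<phi>"
  interpret L: bounded_linear L by fact
  have "(LINT x|lebesgue_on U. partial_deriv i \<phi> x *\<^sub>R L (F x)) = L (LINT x|lebesgue_on U. partial_deriv i \<phi> x *\<^sub>R F x)"
    by (subst L.scaleR[symmetric])
      (rule integral_bounded_linear[OF assms(2) integrable_test_function_partial_scaleR[OF assms(3) \<phi>]])
  also have "\<dots> = - L (LINT x|lebesgue_on U. \<phi> x *\<^sub>R F' x)"
    using assms(1) \<phi> unfolding has_weak_partial_def by (simp add: linear_neg[OF L.linear])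
  also have "L (LINT x|lebesgue_on U. \<phi> x *\<^sub>R F' x) = (LINT x|lebesgue_on U. \<phi> x *\<^sub>R L (F' x))"
    by (subst L.scaleR[symmetric], rule integral_bounded_linear[symmetric, OF assms(2)])
      (rule integrable_test_function_scaleR[OF assms(4) \<phi>])
  finally show "(LINT x|lebesgue_on U. partial_deriv i \<phi> x *\<^sub>R L (F x)) = - (LINT x|lebesgue_on U. \<phi> x *\<^sub>R L (F' x))" .
qed

lemma has_weak_partial_AE_cong:
  assumes "U \<in> sets lebesgue" "F \<in> borel_measurable (lebesgue_on U)" "AE x in lebesgue_on U. F x = G x"
  shows "has_weak_partial U i F F' \<longleftrightarrow> has_weak_partial U i G F'"
proof -
  have m: "G \<in> borel_measurable (lebesgue_on U)" by (rule borel_measurable_lebesgue_on_AE[OF assms])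
  have "(LINT x|lebesgue_on U. partial_deriv i \<phi> x *\<^sub>R F x) = (LINT x|lebesgue_on U. partial_deriv i \<phi> x *\<^sub>R G x)"
    if \<phi>: "test_function U \<phi>" for \<phi>
  proof (rule integral_cong_AE)
    have p: "partial_deriv i \<phi> \<in> borel_measurable (lebesgue_on U)"
      by (rule test_function_measurable[OF test_function_partial_deriv[OF \<phi>]])
    show "(\<lambda>x. partial_deriv i \<phi> x *\<^sub>R F x) \<in> borel_measurable (lebesgue_on U)"
      "(\<lambda>x. partial_deriv i \<phi> x *\<^sub>R G x) \<in> borel_measurable (lebesgue_on U)"
      by (rule borel_measurable_scaleR[OF p assms(2)] borel_measurable_scaleR[OF p m])+
    show "AE x in lebesgue_on U. partial_deriv i \<phi> x *\<^sub>R F x = partial_deriv i \<phi> x *\<^sub>R G x"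
      using assms(3) by eventually_elim simp
  qed
  then show ?thesis unfolding has_weak_partial_def by auto
qed

text \<open>The choice in \<open>weak_partial\<close> is made from one and the same predicate on
  both sides, so the results are equal outright and not merely almost everywhere.\<close>

lemma weak_partial_AE_cong:
  assumes "U \<in> sets lebesgue" "F \<in> borel_measurable (lebesgue_on U)" "AE x in lebesgue_on U. F x = G x"
  shows "weak_partial U i F = weak_partial U i G"
  unfolding weak_partial_def has_weak_partial_AE_cong[OF assms] ..

lemma weak_partial_works:
  assumes "square_summable U F'" "has_weak_partial U i F F'"
  shows "square_summable U (weak_partial U i F)" "has_weak_partial U i F (weak_partial U i F)"
  using someI[of "\<lambda>F'. square_summable U F' \<and> has_weak_partial U i F F'" F'] assms
  unfolding weak_partial_def by auto

lemma weak_partial_AE_eq: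
  assumes "open U" "U \<in> lmeasurable" "square_summable U F'" "has_weak_partial U i F F'"
  shows "AE x in lebesgue_on U. weak_partial U i F x = F' x"
  by (rule weak_partial_unique[OF assms(1,2) weak_partial_works[OF assms(3,4)] assms(3,4)])


section \<open>Sobolev functions and traces on the unit sphere\<close>

lemma smooth_on_bounded_linear:
  fixes V :: "real ^ 'm::finite \<Rightarrow> 'b::real_normed_vector"
  assumes "smooth_on A V" "bounded_linear L"
  shows "smooth_on A (\<lambda>x. L (V x))"
proof -
  obtain U f where f: "A \<subseteq> U" "smooth_on_open U f" "\<forall>x\<in>A. f x = V x"
    using assms(1) unfolding smooth_on_def by blast
  then have "smooth_on_open U (\<lambda>x. L (f x))"
    unfolding smooth_on_open_def using Ck_on_bounded_linear[OF assms(2)] by blast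
  then show ?thesis using f unfolding smooth_on_def by (intro exI[of _ U] exI[of _ "\<lambda>x. L (f x)"]) auto
qed

lemma smooth_on_add:
  fixes V W :: "real ^ 'm::finite \<Rightarrow> 'b::real_normed_vector"
  assumes "smooth_on A V" "smooth_on_open UNIV W"
  shows "smooth_on A (\<lambda>x. V x + W x)"
proof -
  obtain U f where f: "A \<subseteq> U" "smooth_on_open U f" "\<forall>x\<in>A. f x = V x"
    using assms(1) unfolding smooth_on_def by blast
  then have "smooth_on_open U (\<lambda>x. f x + W x)"
    using assms(2) Ck_on_add Ck_on_subset[of _ UNIV W U] unfolding smooth_on_open_def by blast
  then show ?thesis using f unfolding smooth_on_def by (intro exI[of _ U] exI[of _ "\<lambda>x. f x + W x"]) auto
qed

lemma smooth_on_continuous_on: "smooth_on A V \<Longrightarrow> continuous_on A V"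
  unfolding smooth_on_def
  using smooth_on_open_continuous_on continuous_on_subset continuous_on_cong by (metis (no_types, lifting))

lemma smooth_on_has_derivative:
  fixes V :: "real ^ 'm::finite \<Rightarrow> 'b::real_normed_vector"
  assumes "smooth_on A V" "open S" "S \<subseteq> A" "x \<in> S"
  shows "(V has_derivative frechet_derivative V (at x)) (at x)"
proof -
  obtain U f where f: "A \<subseteq> U" "smooth_on_open U f" "\<forall>x\<in>A. f x = V x"
    using assms(1) unfolding smooth_on_def by blast
  have "(f has_derivative frechet_derivative f (at x)) (at x)"
    using smooth_on_open_has_derivative[OF f(2)] f(1) assms by blast
  then have "(V has_derivative frechet_derivative f (at x)) (at x)"
    by (rule has_derivative_transform_within_open[OF _ assms(2,4)]) (use f(3) assms(3) in auto)
  then show ?thesis using frechet_derivative_works differentiableI by blast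
qed

lemma continuous_square_summable:
  fixes V :: "real ^ 'm::finite \<Rightarrow> 'b::euclidean_space"
  assumes "continuous_on (cball a r) V"
  shows "square_summable (ball a r) V"
proof -
  have "bounded (V ` cball a r)"
    using assms by (intro compact_imp_bounded compact_continuous_image) auto
  then obtain C where C: "\<And>x. x \<in> cball a r \<Longrightarrow> norm (V x) \<le> C" unfolding bounded_iff by blast
  have "continuous_on (ball a r) V" using assms ball_subset_cball by (rule continuous_on_subset)
  then have "V \<in> borel_measurable (lebesgue_on (ball a r))"
    by (rule continuous_imp_measurable_on_sets_lebesgue) simp
  then show ?thesis using C by (intro square_summable_bounded[where C = C]) auto
qed

text \<open>Near points of the open ball \<open>V\<close> coincides with its smooth extension, whose
  derivatives are bounded on the compact ball. On the sphere the derivative of \<open>V\<close>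
  itself is not controlled, since values of \<open>V\<close> beyond the closed ball are
  arbitrary.\<close>

lemma smooth_on_cball_square_summable:
  fixes V :: "real ^ 'm::finite \<Rightarrow> 'b::euclidean_space"
  assumes "smooth_on (cball a r) V"
  shows "square_summable (ball a r) V" "square_summable (ball a r) (partial_deriv i V)"
proof -
  show "square_summable (ball a r) V"
    by (rule continuous_square_summable[OF smooth_on_continuous_on[OF assms]])
  obtain U f where f: "cball a r \<subseteq> U" "smooth_on_open U f" "\<forall>x\<in>cball a r. f x = V x"
    using assms unfolding smooth_on_def by blast
  have eq: "partial_deriv i f x = partial_deriv i V x" if x: "x \<in> ball a r" for x
  proof -
    have "(f has_derivative frechet_derivative f (at x)) (at x)"
      using smooth_on_open_has_derivative[OF f(2)] f(1) x ball_subset_cball by blast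
    then have "(V has_derivative frechet_derivative f (at x)) (at x)"
      by (rule has_derivative_transform_within_open[OF _ open_ball x]) (use f(3) in auto)
    then show ?thesis by (simp add: partial_deriv_eq)
  qed
  have "continuous_on (cball a r) (partial_deriv i f)"
    using smooth_on_open_continuous_on[OF smooth_on_open_partial_deriv[OF f(2)]] f(1) by (rule continuous_on_subset)
  then have "square_summable (ball a r) (partial_deriv i f)" by (rule continuous_square_summable)
  then show "square_summable (ball a r) (partial_deriv i V)"
    by (rule square_summable_AE_cong[rotated]) (auto simp: eq space_restrict_space intro!: AE_I2)
qed

lemma space_sphere_measure [simp]: "space sphere_measure = sphere 0 1"
  and sets_sphere_measure: "sets sphere_measure = sets (restrict_space borel (sphere 0 1))"
  by (auto simp: sphere_measure_def space_scale_measure space_restrict_space)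

lemma finite_sphere_measure: "finite_measure (sphere_measure :: (real ^ 'm::finite) measure)"
proof
  have "emeasure (sphere_measure :: (real ^ 'm) measure) (sphere 0 1) =
    of_nat CARD('m) * emeasure lebesgue {x :: real ^ 'm. 0 < norm x \<and> norm x < 1 \<and> x /\<^sub>R norm x \<in> sphere 0 1}"
    by (rule emeasure_sphere_measure) auto
  also have "\<dots> \<le> of_nat CARD('m) * emeasure lebesgue (ball (0 :: real ^ 'm) 1)"
    by (intro mult_left_mono emeasure_mono) auto
  also have "\<dots> < \<infinity>"
    using emeasure_bounded_finite[of "ball (0 :: real ^ 'm) 1"]
    by (simp add: ennreal_mult_less_top of_nat_less_top)
  finally show "emeasure (sphere_measure :: (real ^ 'm) measure) (space sphere_measure) \<noteq> \<infinity>" by simp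
qed

lemma integrable_sphere_diff:
  fixes V T :: "real ^ 'm::finite \<Rightarrow> 'b::euclidean_space"
  assumes V: "continuous_on (sphere 0 1) V" and T: "T \<in> borel_measurable sphere_measure"
    "integrable sphere_measure (\<lambda>x. (norm (T x))\<^sup>2)"
  shows "integrable sphere_measure (\<lambda>x. (norm (V x - T x))\<^sup>2)"
proof -
  interpret finite_measure "sphere_measure :: (real ^ 'm) measure" by (rule finite_sphere_measure)
  have "bounded (V ` sphere 0 1)"
    using V by (intro compact_imp_bounded compact_continuous_image) auto
  then obtain C where C: "\<And>x. x \<in> sphere 0 1 \<Longrightarrow> norm (V x) \<le> C" unfolding bounded_iff by blast
  have "V \<in> borel_measurable (restrict_space borel (sphere 0 1))"
    by (rule borel_measurable_continuous_on_restrict[OF V])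
  then have m: "V \<in> borel_measurable sphere_measure"
    using measurable_cong_sets[OF sets_sphere_measure refl] by blast
  show ?thesis
  proof (rule Bochner_Integration.integrable_bound[where f = "\<lambda>x. 2 * C\<^sup>2 + 2 * (norm (T x))\<^sup>2"])
    show "integrable sphere_measure (\<lambda>x. 2 * C\<^sup>2 + 2 * (norm (T x))\<^sup>2)"
      using T(2) by simp
    show "(\<lambda>x. (norm (V x - T x))\<^sup>2) \<in> borel_measurable sphere_measure" using m T(1) by measurable
    have "(norm (V x - T x))\<^sup>2 \<le> 2 * C\<^sup>2 + 2 * (norm (T x))\<^sup>2" if "x \<in> sphere 0 1" for x
    proof -
      have "(norm (V x - T x))\<^sup>2 + (norm (V x + T x))\<^sup>2 = 2 * (norm (V x))\<^sup>2 + 2 * (norm (T x))\<^sup>2"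
        by (simp add: power2_norm_eq_inner inner_add_left inner_add_right inner_diff_left inner_diff_right)
      moreover have "(norm (V x))\<^sup>2 \<le> C\<^sup>2" using C[OF that] by (intro power_mono) auto
      ultimately show ?thesis using zero_le_power2[of "norm (V x + T x)"] by linarith
    qed
    then show "AE x in sphere_measure. norm ((norm (V x - T x))\<^sup>2) \<le> norm (2 * C\<^sup>2 + 2 * (norm (T x))\<^sup>2)"
      by (intro AE_I2) (simp add: add_nonneg_nonneg)
  qed
qed

text \<open>Integrability of the squares of \<open>D\<close> is essential: the integral of a
  nonintegrable function is 0 by convention, and convergence of such integrals would carry no
  information.\<close>

lemma integral_norm2_tendsto_0_mono:
  fixes D :: "nat \<Rightarrow> 'a \<Rightarrow> 'b::euclidean_space" and E :: "nat \<Rightarrow> 'a \<Rightarrow> 'c::euclidean_space"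
  assumes "\<And>n. integrable M (\<lambda>x. (norm (D n x))\<^sup>2)" "(\<lambda>n. LINT x|M. (norm (D n x))\<^sup>2) \<longlonglongrightarrow> 0"
    and "\<And>n x. norm (E n x) \<le> norm (D n x)"
  shows "(\<lambda>n. LINT x|M. (norm (E n x))\<^sup>2) \<longlonglongrightarrow> 0"
proof (rule tendsto_sandwich[OF _ _ tendsto_const assms(2)])
  show "\<forall>\<^sub>F n in sequentially. 0 \<le> (LINT x|M. (norm (E n x))\<^sup>2)" by simp
  have "(LINT x|M. (norm (E n x))\<^sup>2) \<le> (LINT x|M. (norm (D n x))\<^sup>2)" for n
    by (rule integral_mono'[OF assms(1)]) (auto intro: power_mono assms(3))
  then show "\<forall>\<^sub>F n in sequentially. (LINT x|M. (norm (E n x))\<^sup>2) \<le> (LINT x|M. (norm (D n x))\<^sup>2)" by simp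
qed

text \<open>The Sobolev class \<open>W^{1,2}(U)\<close>.\<close>

definition weakly_differentiable :: "(real ^ 'm::finite) set \<Rightarrow> (real ^ 'm \<Rightarrow> 'b::euclidean_space) \<Rightarrow> bool"
  where "weakly_differentiable U F \<longleftrightarrow>
    square_summable U F \<and> (\<forall>i. \<exists>F'. square_summable U F' \<and> has_weak_partial U i F F')"

lemma weakly_differentiable_weak_partial:
  assumes "weakly_differentiable U F"
  shows "square_summable U (weak_partial U i F)" "has_weak_partial U i F (weak_partial U i F)"
  using assms weak_partial_works unfolding weakly_differentiable_def by blast+

lemma weak_partial_linear_AE:
  fixes F :: "real ^ 'm::finite \<Rightarrow> 'b::euclidean_space" and L :: "'b \<Rightarrow> 'c::euclidean_space"
  assumes "weakly_differentiable U F" "open U" "U \<in> lmeasurable" "bounded_linear L"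
  shows "square_summable U (\<lambda>x. L (weak_partial U i F x))"
    "has_weak_partial U i (\<lambda>x. L (F x)) (\<lambda>x. L (weak_partial U i F x))"
    "AE x in lebesgue_on U. weak_partial U i (\<lambda>x. L (F x)) x = L (weak_partial U i F x)"
proof -
  note W = weakly_differentiable_weak_partial[OF assms(1), of i]
  show 1: "square_summable U (\<lambda>x. L (weak_partial U i F x))"
    by (rule square_summable_bounded_linear[OF W(1) assms(4)])
  show 2: "has_weak_partial U i (\<lambda>x. L (F x)) (\<lambda>x. L (weak_partial U i F x))"
    by (rule has_weak_partial_bounded_linear[OF W(2) assms(4)])
      (use assms(1) W(1) assms(3) square_summable_integrable in \<open>auto simp: weakly_differentiable_def\<close>)
  show "AE x in lebesgue_on U. weak_partial U i (\<lambda>x. L (F x)) x = L (weak_partial U i F x)"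
    by (rule weak_partial_AE_eq[OF assms(2,3) 1 2])
qed

lemma weak_partial_perturb_AE:
  assumes "weakly_differentiable U F" "open U" "U \<in> lmeasurable" "test_function U \<phi>"
  shows "square_summable U (\<lambda>x. weak_partial U i F x + partial_deriv i \<phi> x *\<^sub>R e)"
    "has_weak_partial U i (\<lambda>x. F x + \<phi> x *\<^sub>R e) (\<lambda>x. weak_partial U i F x + partial_deriv i \<phi> x *\<^sub>R e)"
    "AE x in lebesgue_on U. weak_partial U i (\<lambda>x. F x + \<phi> x *\<^sub>R e) x =
      weak_partial U i F x + partial_deriv i \<phi> x *\<^sub>R e"
proof -
  note W = weakly_differentiable_weak_partial[OF assms(1), of i]
  have s: "square_summable U (\<lambda>x. \<phi> x *\<^sub>R e)" "square_summable U (\<lambda>x. partial_deriv i \<phi> x *\<^sub>R e)"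
    using square_summable_test_function assms(3,4) test_function_partial_deriv by blast+
  have F: "square_summable U F" using assms(1) by (simp add: weakly_differentiable_def)
  show 1: "square_summable U (\<lambda>x. weak_partial U i F x + partial_deriv i \<phi> x *\<^sub>R e)"
    by (rule square_summable_add[OF W(1) s(2)])
  have "has_weak_partial U i (\<lambda>x. \<phi> x *\<^sub>R e) (\<lambda>x. partial_deriv i \<phi> x *\<^sub>R e)"
    by (rule has_weak_partial_smooth[OF assms(2)]) (use assms(4) in \<open>simp add: test_function_def\<close>)
  then show 2: "has_weak_partial U i (\<lambda>x. F x + \<phi> x *\<^sub>R e) (\<lambda>x. weak_partial U i F x + partial_deriv i \<phi> x *\<^sub>R e)"
    by (intro has_weak_partial_add[OF W(2)] square_summable_integrable[OF _ assms(3)] F W(1) s)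
  show "AE x in lebesgue_on U. weak_partial U i (\<lambda>x. F x + \<phi> x *\<^sub>R e) x =
      weak_partial U i F x + partial_deriv i \<phi> x *\<^sub>R e"
    by (rule weak_partial_AE_eq[OF assms(2,3) 1 2])
qed

text \<open>Composing the smooth approximants with a linear contraction preserves all three
  convergences, so taking traces commutes with \<open>L\<close>. The intended \<open>L\<close> is
  the projection onto antisymmetric pairs.\<close>

lemma has_trace_bounded_linear:
  fixes F T :: "real ^ 'm::finite \<Rightarrow> 'b::euclidean_space" and L :: "'b \<Rightarrow> 'c::euclidean_space"
  assumes tr: "has_trace F T" and F: "weakly_differentiable (ball 0 1) F"
    and L: "bounded_linear L" "\<And>y. norm (L y) \<le> norm y"
  shows "has_trace (\<lambda>x. L (F x)) (\<lambda>x. L (T x))"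
proof -
  interpret L: bounded_linear L by fact
  have Lm: "L \<in> borel_measurable borel"
    by (intro borel_measurable_continuous_onI linear_continuous_on L)
  obtain V where V: "\<And>n::nat. smooth_on (cball 0 1) (V n)"
      "(\<lambda>n. LINT x|lebesgue_on (ball 0 1). (norm (V n x - F x))\<^sup>2) \<longlonglongrightarrow> 0"
      "\<And>i. (\<lambda>n. LINT x|lebesgue_on (ball 0 1).
              (norm (partial_deriv i (V n) x - weak_partial (ball 0 1) i F x))\<^sup>2) \<longlonglongrightarrow> 0"
      "(\<lambda>n. LINT x|sphere_measure. (norm (V n x - T x))\<^sup>2) \<longlonglongrightarrow> 0"
    and T: "T \<in> borel_measurable sphere_measure" "integrable sphere_measure (\<lambda>x. (norm (T x))\<^sup>2)"
    using tr unfolding has_trace_def by blast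
  note W = weakly_differentiable_weak_partial[OF F]
  have sF: "square_summable (ball 0 1) F" using F by (simp add: weakly_differentiable_def)
  have LV: "partial_deriv i (\<lambda>x. L (V n x)) x = L (partial_deriv i (V n) x)" if "x \<in> ball 0 1" for i n x
  proof (rule partial_deriv_eq)
    show "((\<lambda>x. L (V n x)) has_derivative (\<lambda>v. L (frechet_derivative (V n) (at x) v))) (at x)"
      by (rule L.has_derivative[OF smooth_on_has_derivative[OF V(1) open_ball ball_subset_cball that]])
  qed
  have contr: "norm (L a - L b) \<le> norm (a - b)" for a b by (metis L.diff L(2))
  show ?thesis
    unfolding has_trace_def
  proof (intro conjI exI[of _ "\<lambda>n x. L (V n x)"] allI)
    show "(\<lambda>x. L (T x)) \<in> borel_measurable sphere_measure"
      using measurable_compose[OF T(1) Lm] .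
    then have m: "(\<lambda>x. (norm (L (T x)))\<^sup>2) \<in> borel_measurable sphere_measure" by measurable
    show "integrable sphere_measure (\<lambda>x. (norm (L (T x)))\<^sup>2)"
      by (rule Bochner_Integration.integrable_bound[OF T(2) m]) (auto intro: power_mono L(2))
    show "smooth_on (cball 0 1) (\<lambda>x. L (V n x))" for n by (rule smooth_on_bounded_linear[OF V(1) L(1)])
    show "(\<lambda>n. LINT x|lebesgue_on (ball 0 1). (norm (L (V n x) - L (F x)))\<^sup>2) \<longlonglongrightarrow> 0"
      by (rule integral_norm2_tendsto_0_mono[OF _ V(2) contr])
        (intro square_summable_norm2 square_summable_diff smooth_on_cball_square_summable(1)[OF V(1)] sF)
    show "(\<lambda>n. LINT x|sphere_measure. (norm (L (V n x) - L (T x)))\<^sup>2) \<longlonglongrightarrow> 0"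
      by (rule integral_norm2_tendsto_0_mono[OF _ V(4) contr], rule integrable_sphere_diff[OF _ T],
          rule continuous_on_subset[OF smooth_on_continuous_on[OF V(1)]]) auto
    show "(\<lambda>n. LINT x|lebesgue_on (ball 0 1).
        (norm (partial_deriv i (\<lambda>x. L (V n x)) x - weak_partial (ball 0 1) i (\<lambda>x. L (F x)) x))\<^sup>2) \<longlonglongrightarrow> 0" for i
    proof -
      let ?E = "\<lambda>n x. L (partial_deriv i (V n) x) - L (weak_partial (ball 0 1) i F x)"
      have lim: "(\<lambda>n. LINT x|lebesgue_on (ball 0 1). (norm (?E n x))\<^sup>2) \<longlonglongrightarrow> 0"
        by (rule integral_norm2_tendsto_0_mono[OF _ V(3)[of i] contr])
          (intro square_summable_norm2 square_summable_diff smooth_on_cball_square_summable V(1) W)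
      have ae: "AE x in lebesgue_on (ball 0 1). ?E n x =
        partial_deriv i (\<lambda>x. L (V n x)) x - weak_partial (ball 0 1) i (\<lambda>x. L (F x)) x" for n
        using weak_partial_linear_AE(3)[OF F open_ball lmeasurable_ball L(1), of i] AE_space
        by eventually_elim (simp add: LV space_restrict_space)
      have ss: "square_summable (ball 0 1) (?E n)" for n
        by (intro square_summable_diff square_summable_bounded_linear[OF _ L(1)] smooth_on_cball_square_summable V(1) W)
      have "(LINT x|lebesgue_on (ball 0 1). (norm (?E n x))\<^sup>2) = (LINT x|lebesgue_on (ball 0 1).
        (norm (partial_deriv i (\<lambda>x. L (V n x)) x - weak_partial (ball 0 1) i (\<lambda>x. L (F x)) x))\<^sup>2)" for n
        by (rule integral_norm2_AE_cong[OF _ ss ae]) simp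
      with lim show ?thesis by simp
    qed
  qed
qed

text \<open>Shifting every approximant by the same smooth function leaves all differences unchanged,
  and on the sphere the shift is invisible because the support of \<open>\<phi>\<close> lies in the
  open ball.\<close>

lemma has_trace_perturb:
  assumes tr: "has_trace F T" and F: "weakly_differentiable (ball 0 1) F" and \<phi>: "test_function (ball 0 1) \<phi>"
  shows "has_trace (\<lambda>x. F x + \<phi> x *\<^sub>R e) T"
proof -
  obtain V where V: "\<And>n::nat. smooth_on (cball 0 1) (V n)"
      "(\<lambda>n. LINT x|lebesgue_on (ball 0 1). (norm (V n x - F x))\<^sup>2) \<longlonglongrightarrow> 0"
      "\<And>i. (\<lambda>n. LINT x|lebesgue_on (ball 0 1).
              (norm (partial_deriv i (V n) x - weak_partial (ball 0 1) i F x))\<^sup>2) \<longlonglongrightarrow> 0"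
      "(\<lambda>n. LINT x|sphere_measure. (norm (V n x - T x))\<^sup>2) \<longlonglongrightarrow> 0"
    and T: "T \<in> borel_measurable sphere_measure" "integrable sphere_measure (\<lambda>x. (norm (T x))\<^sup>2)"
    using tr unfolding has_trace_def by blast
  note W = weakly_differentiable_weak_partial[OF F]
  have s: "smooth_on_open UNIV \<phi>" using \<phi> by (simp add: test_function_def)
  have se: "smooth_on_open UNIV (\<lambda>x. \<phi> x *\<^sub>R e)"
    using s Ck_on_bounded_linear[OF bounded_linear_scaleR_left, of UNIV _ \<phi> e]
    unfolding smooth_on_open_def by blast
  have sphere: "\<phi> x = 0" if "x \<in> sphere 0 1" for x
    using \<phi> that closure_subset[of "{x. \<phi> x \<noteq> 0}"] unfolding test_function_def by fastforce
  have dV: "partial_deriv i (\<lambda>x. V n x + \<phi> x *\<^sub>R e) x = partial_deriv i (V n) x + partial_deriv i \<phi> x *\<^sub>R e"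
    if "x \<in> ball 0 1" for i n x
    by (rule partial_deriv_eq, intro has_derivative_add has_derivative_scaleR_left
        smooth_on_has_derivative[OF V(1) open_ball ball_subset_cball that] smooth_on_open_has_derivative[OF s]) simp
  show ?thesis
    unfolding has_trace_def
  proof (intro conjI exI[of _ "\<lambda>n x. V n x + \<phi> x *\<^sub>R e"] allI)
    show "T \<in> borel_measurable sphere_measure" "integrable sphere_measure (\<lambda>x. (norm (T x))\<^sup>2)" by fact+
    show "smooth_on (cball 0 1) (\<lambda>x. V n x + \<phi> x *\<^sub>R e)" for n by (rule smooth_on_add[OF V(1) se])
    show "(\<lambda>n. LINT x|lebesgue_on (ball 0 1). (norm (V n x + \<phi> x *\<^sub>R e - (F x + \<phi> x *\<^sub>R e)))\<^sup>2) \<longlonglongrightarrow> 0"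
      using V(2) by simp
    have "(LINT x|sphere_measure. (norm (V n x + \<phi> x *\<^sub>R e - T x))\<^sup>2) = (LINT x|sphere_measure. (norm (V n x - T x))\<^sup>2)" for n
      by (rule Bochner_Integration.integral_cong) (auto simp: sphere)
    then show "(\<lambda>n. LINT x|sphere_measure. (norm (V n x + \<phi> x *\<^sub>R e - T x))\<^sup>2) \<longlonglongrightarrow> 0" using V(4) by simp
    show "(\<lambda>n. LINT x|lebesgue_on (ball 0 1). (norm (partial_deriv i (\<lambda>x. V n x + \<phi> x *\<^sub>R e) x
        - weak_partial (ball 0 1) i (\<lambda>x. F x + \<phi> x *\<^sub>R e) x))\<^sup>2) \<longlonglongrightarrow> 0" for i
    proof -
      let ?E = "\<lambda>n x. partial_deriv i (V n) x - weak_partial (ball 0 1) i F x"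
      have ae: "AE x in lebesgue_on (ball 0 1). ?E n x = partial_deriv i (\<lambda>x. V n x + \<phi> x *\<^sub>R e) x
        - weak_partial (ball 0 1) i (\<lambda>x. F x + \<phi> x *\<^sub>R e) x" for n
        using weak_partial_perturb_AE(3)[OF F open_ball lmeasurable_ball \<phi>, of i e] AE_space
        by eventually_elim (simp add: dV space_restrict_space)
      have ss: "square_summable (ball 0 1) (?E n)" for n
        by (intro square_summable_diff smooth_on_cball_square_summable V(1) W)
      have "(LINT x|lebesgue_on (ball 0 1). (norm (?E n x))\<^sup>2) = (LINT x|lebesgue_on (ball 0 1).
        (norm (partial_deriv i (\<lambda>x. V n x + \<phi> x *\<^sub>R e) x - weak_partial (ball 0 1) i (\<lambda>x. F x + \<phi> x *\<^sub>R e) x))\<^sup>2)" for n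
        by (rule integral_norm2_AE_cong[OF _ ss ae]) simp
      with V(3)[of i] show ?thesis by simp
    qed
  qed
qed

lemma has_trace_AE_cong:
  fixes F G T :: "real ^ 'm::finite \<Rightarrow> 'b::euclidean_space"
  assumes tr: "has_trace F T" and F: "square_summable (ball 0 1) F"
    and ae: "AE x in lebesgue_on (ball 0 1). F x = G x"
  shows "has_trace G T"
proof -
  have m: "F \<in> borel_measurable (lebesgue_on (ball 0 1))" using F by (simp add: square_summable_def)
  have "weak_partial (ball 0 1) i G = weak_partial (ball 0 1) i F" for i
    by (rule weak_partial_AE_cong[OF _ m ae, symmetric]) simp
  moreover have "(LINT x|lebesgue_on (ball 0 1). (norm (V x - F x))\<^sup>2) =
    (LINT x|lebesgue_on (ball 0 1). (norm (V x - G x))\<^sup>2)" if "smooth_on (cball 0 1) V" for V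
  proof (rule integral_norm2_AE_cong)
    show "square_summable (ball 0 1) (\<lambda>x. V x - F x)"
      by (rule square_summable_diff[OF smooth_on_cball_square_summable(1)[OF that] F])
    show "AE x in lebesgue_on (ball 0 1). V x - F x = V x - G x" using ae by eventually_elim simp
  qed simp
  ultimately show ?thesis using tr unfolding has_trace_def by auto
qed


section \<open>Comparison functions\<close>

abbreviation averages_tend_to :: "(real ^ 'm::finite \<Rightarrow> 'b::euclidean_space) \<Rightarrow> real ^ 'm \<Rightarrow> 'b \<Rightarrow> bool"
  where "averages_tend_to F x y \<equiv>
    ((\<lambda>r. (LINT z|lebesgue_on (cball x r). norm (F z - y)) / measure lebesgue (cball x r)) \<longlongrightarrow> 0) (at_right 0)"

text \<open>Both candidates are recovered from the same integrals against flux kernels, up to the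
  nonzero factor \<open>flux_mass\<close>.\<close>

lemma averages_tend_to_unique:
  fixes F :: "real ^ 'm::finite \<Rightarrow> 'b::euclidean_space"
  assumes "open U" "integrable (lebesgue_on U) F" "x \<in> U" "averages_tend_to F x y" "averages_tend_to F x y'"
  shows "y = y'"
proof -
  have "flux_mass TYPE('m) *\<^sub>R y = flux_mass TYPE('m) *\<^sub>R y'"
    by (rule tendsto_unique[OF trivial_limit_at_right_real flux_kernel_tendsto[OF assms(1-3)]
          flux_kernel_tendsto[OF assms(1-3)]]) fact+
  then show ?thesis using flux_mass_pos[where 'm='m] by simp
qed

lemma averages_tend_to_AE_cong:
  fixes F G :: "real ^ 'm::finite \<Rightarrow> 'b::euclidean_space"
  assumes "open U" "F \<in> borel_measurable (lebesgue_on U)" "AE x in lebesgue_on U. F x = G x" "x \<in> U"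
    and "averages_tend_to F x y"
  shows "averages_tend_to G x y"
proof -
  obtain d where d: "d > 0" "cball x d \<subseteq> U"
    using assms(1,4) open_contains_cball by blast
  have "(LINT z|lebesgue_on (cball x r). norm (F z - y)) = (LINT z|lebesgue_on (cball x r). norm (G z - y))"
    if "0 < r" "r < d" for r
  proof -
    have sub: "cball x r \<subseteq> U" using that d subset_cball[of r d x] by auto
    have F: "F \<in> borel_measurable (lebesgue_on (cball x r))"
      by (rule measurable_restrict_mono[OF assms(2) sub])
    have "AE z in lebesgue. z \<in> U \<longrightarrow> F z = G z"
      using assms(1,3) by (subst (asm) AE_restrict_space_iff) auto
    then have "AE z in lebesgue. z \<in> cball x r \<longrightarrow> F z = G z"
      by eventually_elim (use sub in blast)
    then have ae: "AE z in lebesgue_on (cball x r). F z = G z"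
      by (subst AE_restrict_space_iff) auto
    have G: "G \<in> borel_measurable (lebesgue_on (cball x r))"
      by (rule borel_measurable_lebesgue_on_AE[OF _ F ae]) simp
    show ?thesis
    proof (rule integral_cong_AE)
      show "(\<lambda>z. norm (F z - y)) \<in> borel_measurable (lebesgue_on (cball x r))"
        "(\<lambda>z. norm (G z - y)) \<in> borel_measurable (lebesgue_on (cball x r))"
        using F G by measurable
      show "AE z in lebesgue_on (cball x r). norm (F z - y) = norm (G z - y)"
        using ae by eventually_elim simp
    qed
  qed
  then have "\<forall>\<^sub>F r in at_right 0. (LINT z|lebesgue_on (cball x r). norm (F z - y)) / measure lebesgue (cball x r) =
      (LINT z|lebesgue_on (cball x r). norm (G z - y)) / measure lebesgue (cball x r)"
    unfolding eventually_at_right_field using d(1) by (intro exI[of _ d]) auto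
  from tendsto_cong[THEN iffD1, OF this assms(5)] show ?thesis .
qed

lemma averages_tend_to_continuous:
  fixes F :: "real ^ 'm::finite \<Rightarrow> 'b::euclidean_space"
  assumes "open U" "x \<in> U" "continuous_on U F"
  shows "averages_tend_to F x (F x)"
proof (rule tendstoI)
  fix e :: real assume "e > 0"
  obtain d where d: "d > 0" "cball x d \<subseteq> U" using assms(1,2) open_contains_cball by blast
  have "isCont F x" using assms by (simp add: continuous_on_eq_continuous_at)
  then obtain d' where d': "d' > 0" "\<And>y. dist y x < d' \<Longrightarrow> dist (F y) (F x) < e / 2"
    using half_gt_zero[OF \<open>e > 0\<close>] unfolding continuous_at_eps_delta by blast
  have "dist ((LINT z|lebesgue_on (cball x r). norm (F z - F x)) / measure lebesgue (cball x r)) 0 < e"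
    if r: "0 < r" "r < min d d'" for r
  proof -
    have sub: "cball x r \<subseteq> U" using r d subset_cball[of r d x] by auto
    have pos: "measure lebesgue (cball x r) > 0" using r by (simp add: content_cball_pos)
    interpret finite_measure "lebesgue_on (cball x r)" by (rule finite_measure_lebesgue_on) simp
    have "continuous_on (cball x r) F" using assms(3) sub by (rule continuous_on_subset)
    then have m: "F \<in> borel_measurable (lebesgue_on (cball x r))"
      by (rule continuous_imp_measurable_on_sets_lebesgue) simp
    have le: "norm (F z - F x) \<le> e / 2" if "z \<in> cball x r" for z
      using d'(2)[of z] that r by (simp add: dist_norm norm_minus_commute less_imp_le)
    have "integrable (lebesgue_on (cball x r)) (\<lambda>z. norm (F z - F x))"
      using m le by (intro integrable_const_bound[where B = "e / 2"])
        (auto intro!: AE_I2 simp: space_restrict_space)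
    then have "(LINT z|lebesgue_on (cball x r). norm (F z - F x)) \<le> (LINT z|lebesgue_on (cball x r). e / 2)"
      by (rule integral_mono) (use le in \<open>auto simp: space_restrict_space\<close>)
    also have "\<dots> = e / 2 * measure lebesgue (cball x r)" by (simp add: measure_restrict_space)
    also have "\<dots> < e * measure lebesgue (cball x r)"
      using pos \<open>e > 0\<close> by (intro mult_strict_right_mono) auto
    finally show ?thesis using pos by (simp add: pos_divide_less_eq)
  qed
  then show "\<forall>\<^sub>F r in at_right 0. dist ((LINT z|lebesgue_on (cball x r). norm (F z - F x)) / measure lebesgue (cball x r)) 0 < e"
    unfolding eventually_at_right_field using d(1) d'(1) by (intro exI[of _ "min d d'"]) auto
qed

lemma strictly_defined_iff:
  "strictly_defined u \<longleftrightarrow> (\<forall>x\<in>ball 0 1. \<forall>y. averages_tend_to (xi \<circ> u) x y \<longrightarrow> xi (u x) = y)"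
  by (simp add: strictly_defined_def)

lemma xi_ordered: "fst (xi p) \<le> snd (xi p)"
  by (cases p) auto

text \<open>Integration against a nonnegative kernel preserves the order of the components, and so
  does the limit. Consequently limits of averages of ordered pairs are again values of
  \<open>xi\<close>.\<close>

lemma averages_tend_to_ordered:
  fixes F :: "real ^ 'm::finite \<Rightarrow> real \<times> real"
  assumes "open U" "integrable (lebesgue_on U) F" "x \<in> U" "averages_tend_to F x y"
    and ae: "AE x in lebesgue_on U. fst (F x) \<le> snd (F x)"
  shows "fst y \<le> snd y"
proof -
  let ?I = "\<lambda>r. LINT y|lebesgue_on U. flux_kernel x r y *\<^sub>R F y"
  have "((\<lambda>r. snd (?I r) - fst (?I r)) \<longlongrightarrow>
      snd (flux_mass TYPE('m) *\<^sub>R y) - fst (flux_mass TYPE('m) *\<^sub>R y)) (at_right 0)"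
    by (intro tendsto_diff tendsto_snd tendsto_fst flux_kernel_tendsto[OF assms(1-4)])
  moreover have "\<forall>\<^sub>F r in at_right 0. 0 \<le> snd (?I r) - fst (?I r)"
  proof -
    have "0 \<le> snd (?I r) - fst (?I r)" if "r > 0" for r
    proof -
      note i = integrable_flux_kernel_scaleR[OF assms(2) that, of x]
      have "fst (?I r) = (LINT y|lebesgue_on U. fst (flux_kernel x r y *\<^sub>R F y))"
        "snd (?I r) = (LINT y|lebesgue_on U. snd (flux_kernel x r y *\<^sub>R F y))"
        using integral_bounded_linear[OF bounded_linear_fst i] integral_bounded_linear[OF bounded_linear_snd i] by auto
      moreover have "(LINT y|lebesgue_on U. fst (flux_kernel x r y *\<^sub>R F y)) \<le>
        (LINT y|lebesgue_on U. snd (flux_kernel x r y *\<^sub>R F y))"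
      proof (rule integral_mono_AE)
        show "integrable (lebesgue_on U) (\<lambda>y. fst (flux_kernel x r y *\<^sub>R F y))"
          "integrable (lebesgue_on U) (\<lambda>y. snd (flux_kernel x r y *\<^sub>R F y))"
          using integrable_bounded_linear[OF bounded_linear_fst i] integrable_bounded_linear[OF bounded_linear_snd i] by auto
        show "AE y in lebesgue_on U. fst (flux_kernel x r y *\<^sub>R F y) \<le> snd (flux_kernel x r y *\<^sub>R F y)"
          using ae by eventually_elim (simp add: mult_left_mono flux_kernel_nonneg[OF that])
      qed
      ultimately show ?thesis by simp
    qed
    then show ?thesis by (simp add: eventually_at_right_less eventually_at_filter)
  qed
  ultimately have "0 \<le> snd (flux_mass TYPE('m) *\<^sub>R y) - fst (flux_mass TYPE('m) *\<^sub>R y)"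
    by (rule tendsto_lowerbound) (rule trivial_limit_at_right_real)
  then show ?thesis using flux_mass_pos[where 'm='m] by simp
qed

text \<open>The function is redefined as the limit of averages wherever this limit exists. By
  Lebesgue's theorem only a null set is affected, so the averages of the new function are those of
  \<open>H\<close>, and whenever they converge the new value is already their limit. Limits are
  ordered, hence each is \<open>xi\<close> of an unordered pair.\<close>

lemma strictly_defined_representative:
  fixes H :: "real ^ 'm::finite \<Rightarrow> real \<times> real"
  assumes H: "square_summable (ball 0 1) H" and ord: "AE x in lebesgue_on (ball 0 1). fst (H x) \<le> snd (H x)"
  shows "\<exists>u. strictly_defined u \<and> (AE x in lebesgue_on (ball 0 1). H x = xi (u x))"
proof -
  have iH: "integrable (lebesgue_on (ball 0 1)) H"
    by (rule square_summable_integrable[OF H]) simp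
  have mH: "H \<in> borel_measurable (lebesgue_on (ball 0 1))" using H by (simp add: square_summable_def)
  define pair :: "real \<times> real \<Rightarrow> real uprod" where "pair y = Upair (fst y) (snd y)" for y
  have xi_pair: "xi (pair y) = y" if "fst y \<le> snd y" for y
    using that by (cases y) (simp add: pair_def)
  define u where "u x = pair (if x \<in> ball 0 1 \<and> (\<exists>y. averages_tend_to H x y)
    then SOME y. averages_tend_to H x y else H x)" for x
  have u_eq: "xi (u x) = y" if x: "x \<in> ball 0 1" and y: "averages_tend_to H x y" for x y
  proof -
    have "(SOME y. averages_tend_to H x y) = y"
      using y averages_tend_to_unique[OF open_ball iH x] by blast
    moreover have "x \<in> ball 0 1 \<and> (\<exists>y. averages_tend_to H x y)" using x y by blast
    ultimately have "u x = pair y" unfolding u_def by (simp only: if_True simp_thms)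
    then show ?thesis using xi_pair averages_tend_to_ordered[OF open_ball iH x y ord] by simp
  qed
  have ae: "AE x in lebesgue_on (ball 0 1). H x = xi (u x)"
    using AE_lebesgue_point[OF open_ball lmeasurable_ball iH] AE_space
    by eventually_elim (use u_eq in \<open>simp add: space_restrict_space\<close>)
  have m: "(xi \<circ> u) \<in> borel_measurable (lebesgue_on (ball 0 1))"
    by (rule borel_measurable_lebesgue_on_AE[OF _ mH]) (use ae in auto)
  have "xi (u x) = y" if x: "x \<in> ball 0 1" and y: "averages_tend_to (xi \<circ> u) x y" for x y
  proof (rule u_eq[OF x])
    show "averages_tend_to H x y"
      by (rule averages_tend_to_AE_cong[OF open_ball m _ x y]) (use ae in \<open>auto elim!: eventually_mono\<close>)
  qed
  then have "strictly_defined u" unfolding strictly_defined_iff by blast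
  then show ?thesis using ae by blast
qed

lemma square_summable_cball:
  assumes "square_summable (ball a r) F"
  shows "square_summable (cball a r) F"
proof -
  let ?G = "\<lambda>x. indicator (ball a r) x *\<^sub>R F x"
  have m: "?G \<in> borel_measurable lebesgue" and i: "integrable lebesgue (\<lambda>x. (norm (?G x))\<^sup>2)"
  proof -
    show "?G \<in> borel_measurable lebesgue"
      using assms unfolding square_summable_def by (subst (asm) borel_measurable_restrict_space_iff) auto
    have "integrable lebesgue (\<lambda>x. indicator (ball a r) x *\<^sub>R (norm (F x))\<^sup>2)"
      using square_summable_norm2[OF assms] by (subst (asm) integrable_restrict_space) auto
    also have "(\<lambda>x. indicator (ball a r) x *\<^sub>R (norm (F x))\<^sup>2) = (\<lambda>x. (norm (?G x))\<^sup>2)"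
      by (auto simp: indicator_def)
    finally show "integrable lebesgue (\<lambda>x. (norm (?G x))\<^sup>2)" .
  qed
  have "integrable (lebesgue_on (cball a r)) (\<lambda>x. (norm (?G x))\<^sup>2)"
    using integrable_mult_indicator[OF _ i, of "cball a r"] by (subst integrable_restrict_space) auto
  then have "square_summable (cball a r) ?G"
    using m by (simp add: square_summable_def measurable_restrict_space1)
  moreover have "AE x in lebesgue_on (cball a r). ?G x = F x"
    unfolding AE_lebesgue_on_cball_iff by (intro AE_I2) (simp add: space_restrict_space)
  ultimately show ?thesis by (rule square_summable_AE_cong[rotated]) simp
qed

lemma step_distance:
  fixes u v :: "real ^ 'm::finite \<Rightarrow> real uprod"
  assumes "square_summable (cball 0 1) (xi \<circ> v)" "square_summable (cball 0 1) (xi \<circ> u)"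
  shows "(LINT x|lebesgue_on (cball 0 1). (Q2_dist (v x) (u x))\<^sup>2) =
    (LINT x|lebesgue_on (ball 0 1). (norm (xi (v x) - xi (u x)))\<^sup>2)"
proof -
  have "(\<lambda>x. (norm (xi (v x) - xi (u x)))\<^sup>2) \<in> borel_measurable (lebesgue_on (cball 0 1))"
    using square_summable_norm2[OF square_summable_diff[OF assms]] by (simp add: comp_def)
  then show ?thesis
    by (simp add: Q2_dist_eq_dist_xi dist_norm integral_lebesgue_on_cball)
qed

lemma Y2_iff:
  fixes u :: "real ^ 'm::finite \<Rightarrow> real uprod"
  shows "u \<in> Y2 \<longleftrightarrow> square_summable (cball 0 1) (xi \<circ> u) \<and> weakly_differentiable (ball 0 1) (xi \<circ> u)"
  using square_summable_subset[of "cball 0 1" "xi \<circ> u" "ball 0 1"]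
  by (auto simp: Y2_def weakly_differentiable_def)

lemma Dir_AE_eq:
  fixes u :: "real ^ 'm::finite \<Rightarrow> real uprod"
  assumes "\<And>i. square_summable (ball 0 1) (F i)" "\<And>i. has_weak_partial (ball 0 1) i (xi \<circ> u) (F i)"
  shows "Dir u = (\<Sum>i\<in>UNIV. LINT x|lebesgue_on (ball 0 1). (norm (F i x))\<^sup>2)"
proof -
  have W: "square_summable (ball 0 1) (weak_partial (ball 0 1) i (xi \<circ> u))" for i
    by (rule weak_partial_works[OF assms])
  have "Dir u = (\<Sum>i\<in>UNIV. LINT x|lebesgue_on (ball 0 1). (norm (weak_partial (ball 0 1) i (xi \<circ> u) x))\<^sup>2)"
    unfolding Dir_def by (rule Bochner_Integration.integral_sum) (rule square_summable_norm2[OF W])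
  also have "\<dots> = (\<Sum>i\<in>UNIV. LINT x|lebesgue_on (ball 0 1). (norm (F i x))\<^sup>2)"
    by (intro sum.cong[OF refl] integral_norm2_AE_cong[OF _ W weak_partial_AE_eq[OF open_ball lmeasurable_ball assms]])
      simp
  finally show ?thesis .
qed

text \<open>The comparison function need not be strictly defined, since it may be replaced by a strictly
  defined representative.\<close>

lemma minimizer_le_competitor:
  fixes v u f0 :: "real ^ 'm::finite \<Rightarrow> real uprod" and H :: "real ^ 'm \<Rightarrow> real \<times> real"
  assumes min: "is_arg_min (\<lambda>u. step_functional k v u h) (\<lambda>u. u \<in> admissible f0) u"
    and v: "square_summable (ball 0 1) (xi \<circ> v)" "square_summable (cball 0 1) (xi \<circ> v)"
    and H: "square_summable (ball 0 1) H" and F: "\<And>i. square_summable (ball 0 1) (F i)" "\<And>i. has_weak_partial (ball 0 1) i H (F i)"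
    and ord: "AE x in lebesgue_on (ball 0 1). fst (H x) \<le> snd (H x)"
    and tr: "same_trace H (xi \<circ> f0)"
  shows "step_functional k v u h \<le> (\<Sum>i\<in>UNIV. LINT x|lebesgue_on (ball 0 1). (norm (F i x))\<^sup>2)
    + 1 / (h / 2 ^ k) * (LINT x|lebesgue_on (ball 0 1). (norm (xi (v x) - H x))\<^sup>2)"
proof -
  obtain u' where u': "strictly_defined u'" and ae: "AE x in lebesgue_on (ball 0 1). H x = xi (u' x)"
    using strictly_defined_representative[OF H ord] by blast
  have ae': "AE x in lebesgue_on (ball 0 1). H x = (xi \<circ> u') x" using ae by simp
  have mH: "H \<in> borel_measurable (lebesgue_on (ball 0 1))" using H by (simp add: square_summable_def)
  have su: "square_summable (ball 0 1) (xi \<circ> u')" by (rule square_summable_AE_cong[OF _ H ae']) simp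
  have suc: "square_summable (cball 0 1) (xi \<circ> u')" using su by (rule square_summable_cball)
  have wu: "has_weak_partial (ball 0 1) i (xi \<circ> u') (F i)" for i
  proof -
    have "has_weak_partial (ball 0 1) i H (F i) \<longleftrightarrow> has_weak_partial (ball 0 1) i (xi \<circ> u') (F i)"
      by (rule has_weak_partial_AE_cong[OF _ mH ae']) simp
    then show ?thesis using F(2) by blast
  qed
  have "u' \<in> Y2" using suc su wu F(1) by (auto simp: Y2_iff weakly_differentiable_def)
  moreover have "same_trace (xi \<circ> u') (xi \<circ> f0)"
    using tr has_trace_AE_cong[OF _ H ae'] unfolding same_trace_def by blast
  ultimately have "u' \<in> admissible f0" using u' by (simp add: admissible_def)
  then have "step_functional k v u h \<le> step_functional k v u' h"
    using min unfolding is_arg_min_def by (meson not_le)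
  also have "\<dots> = (\<Sum>i\<in>UNIV. LINT x|lebesgue_on (ball 0 1). (norm (F i x))\<^sup>2)
    + 1 / (h / 2 ^ k) * (LINT x|lebesgue_on (ball 0 1). (norm (xi (v x) - H x))\<^sup>2)"
  proof -
    have "(LINT x|lebesgue_on (cball 0 1). (Q2_dist (v x) (u' x))\<^sup>2) =
        (LINT x|lebesgue_on (ball 0 1). (norm (xi (v x) - xi (u' x)))\<^sup>2)"
      using step_distance[OF v(2) suc] by simp
    also have "\<dots> = (LINT x|lebesgue_on (ball 0 1). (norm (xi (v x) - H x))\<^sup>2)"
    proof (rule integral_norm2_AE_cong)
      show "square_summable (ball 0 1) (\<lambda>x. xi (v x) - xi (u' x))" using square_summable_diff[OF v(1) su] by simp
      show "AE x in lebesgue_on (ball 0 1). xi (v x) - xi (u' x) = xi (v x) - H x"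
        using ae by eventually_elim simp
    qed simp
    finally show ?thesis using Dir_AE_eq[OF F(1) wu] by (simp add: step_functional_def)
  qed
  finally show ?thesis .
qed


section \<open>The variation of a minimizer\<close>

text \<open>The orthogonal projection of the plane onto the line of points
  \<open>(- a, a)\<close>.\<close>

definition antisym_part :: "real \<times> real \<Rightarrow> real \<times> real"
  where "antisym_part p = ((fst p - snd p) / 2, (snd p - fst p) / 2)"

lemma norm_prod_power2: "(norm (p :: real \<times> real))\<^sup>2 = (fst p)\<^sup>2 + (snd p)\<^sup>2"
  by (cases p) (simp add: norm_Pair)

lemma bounded_linear_antisym_part: "bounded_linear antisym_part"
  unfolding antisym_part_def[abs_def]
  by (intro bounded_linear_Pair bounded_linear_divide[THEN bounded_linear_compose] bounded_linear_sub
      bounded_linear_fst bounded_linear_snd)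

text \<open>Pythagoras: \<open>q\<close> lies on the antisymmetric line, and
  \<open>p - antisym_part p\<close> is orthogonal to it with both coordinates
  \<open>(fst p + snd p) / 2\<close>.\<close>

lemma norm_antisym_part_split:
  "(norm (q - p))\<^sup>2 = (norm (q - antisym_part p))\<^sup>2 + (fst p + snd p)\<^sup>2 / 2" if "fst q = - snd q"
  using that unfolding norm_prod_power2 antisym_part_def by (simp add: power2_eq_square field_simps)

lemma norm_antisym_part_le: "norm (antisym_part p) \<le> norm p"
proof -
  have "(norm (antisym_part p))\<^sup>2 \<le> (norm p)\<^sup>2"
    using norm_antisym_part_split[of 0 p] by simp
  then show ?thesis by (rule power2_le_imp_le) simp
qed

lemma integral_norm2_perturb:
  assumes "square_summable A F" "square_summable A G"
  shows "(LINT x|lebesgue_on A. (norm (F x + t *\<^sub>R G x))\<^sup>2) = (LINT x|lebesgue_on A. (norm (F x))\<^sup>2)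
    + 2 * t * (LINT x|lebesgue_on A. F x \<bullet> G x) + t\<^sup>2 * (LINT x|lebesgue_on A. (norm (G x))\<^sup>2)"
proof -
  have "(norm (F x + t *\<^sub>R G x))\<^sup>2 = (norm (F x))\<^sup>2 + 2 * t * (F x \<bullet> G x) + t\<^sup>2 * (norm (G x))\<^sup>2" for x
    unfolding power2_norm_eq_inner
    by (simp add: inner_add_left inner_add_right inner_commute[of "G x" "F x"] algebra_simps power2_eq_square)
  then show ?thesis
    using square_summable_norm2[OF assms(1)] square_summable_norm2[OF assms(2)] square_summable_inner[OF assms]
    by simp
qed

text \<open>One step, from \<open>v\<close> to \<open>u\<close>. Symmetry is asked for on the open
  ball only, because strict definedness says nothing about values on the sphere; the boundary values
  enter through traces alone.\<close>

locale minimizing_step =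
  fixes f0 v u :: "real ^ 'm::finite \<Rightarrow> real uprod" and w :: "real ^ 'm \<Rightarrow> real" and h :: real and k :: nat
  assumes h_pos: "h > 0"
    and f0: "f0 \<in> Y2" and f0_sym: "\<And>x. x \<in> ball 0 1 \<Longrightarrow> fst (xi (f0 x)) = - snd (xi (f0 x))"
    and v_ss: "square_summable (ball 0 1) (xi \<circ> v)" and v_eq: "\<And>x. x \<in> ball 0 1 \<Longrightarrow> xi (v x) = (- w x, w x)"
    and min: "is_arg_min (\<lambda>u. step_functional k v u h) (\<lambda>u. u \<in> admissible f0) u"
begin

abbreviation "B \<equiv> ball (0 :: real ^ 'm) 1"

definition c where "c = 1 / (h / 2 ^ k)"

definition W where "W i = weak_partial B i (xi \<circ> u)"

definition z where "z x = (snd (xi (u x)) - fst (xi (u x))) / 2"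

lemma c_pos: "c > 0" using h_pos by (simp add: c_def)

lemma z_nonneg: "z x \<ge> 0" using xi_ordered by (simp add: z_def)

lemma u: "u \<in> Y2" "strictly_defined u" "same_trace (xi \<circ> u) (xi \<circ> f0)"
  using min by (auto simp: is_arg_min_def admissible_def)

lemma wd: "weakly_differentiable B (xi \<circ> u)" using u(1) by (simp add: Y2_iff)

lemma ss: "square_summable B (xi \<circ> u)" using wd by (simp add: weakly_differentiable_def)

lemma W: "square_summable B (W i)" "has_weak_partial B i (xi \<circ> u) (W i)"
  using weakly_differentiable_weak_partial[OF wd] by (simp_all add: W_def)

lemma energy:
  "step_functional k v u h = (\<Sum>i\<in>UNIV. LINT x|lebesgue_on B. (norm (W i x))\<^sup>2)
    + c * (LINT x|lebesgue_on B. (norm (xi (v x) - xi (u x)))\<^sup>2)"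
  using step_distance[OF square_summable_cball[OF v_ss] square_summable_cball[OF ss]]
  by (simp add: step_functional_def c_def Dir_AE_eq[OF W])

lemma le_competitor:
  assumes "square_summable B H" "\<And>i. square_summable B (F i)" "\<And>i. has_weak_partial B i H (F i)"
    and "AE x in lebesgue_on B. fst (H x) \<le> snd (H x)" "same_trace H (xi \<circ> f0)"
  shows "(\<Sum>i\<in>UNIV. LINT x|lebesgue_on B. (norm (W i x))\<^sup>2)
      + c * (LINT x|lebesgue_on B. (norm (xi (v x) - xi (u x)))\<^sup>2)
    \<le> (\<Sum>i\<in>UNIV. LINT x|lebesgue_on B. (norm (F i x))\<^sup>2) + c * (LINT x|lebesgue_on B. (norm (xi (v x) - H x))\<^sup>2)"
  using minimizer_le_competitor[OF min v_ss square_summable_cball[OF v_ss] assms]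
  unfolding energy c_def[symmetric] .

text \<open>The projection fixes \<open>xi \<circ> f0\<close> on the ball, so projecting the common
  trace of \<open>u\<close> and \<open>f0\<close> yields a common trace of the projected
  \<open>u\<close> and of \<open>f0\<close> itself.\<close>

lemma same_trace_antisym: "same_trace (\<lambda>x. antisym_part ((xi \<circ> u) x)) (xi \<circ> f0)"
proof -
  obtain T where T: "has_trace (xi \<circ> u) T" "has_trace (xi \<circ> f0) T"
    using u(3) unfolding same_trace_def by blast
  have wd0: "weakly_differentiable B (xi \<circ> f0)" using f0 by (simp add: Y2_iff)
  note tr = has_trace_bounded_linear[OF _ _ bounded_linear_antisym_part norm_antisym_part_le]
  have "square_summable B (\<lambda>x. antisym_part ((xi \<circ> f0) x))"
    using square_summable_bounded_linear[OF _ bounded_linear_antisym_part] wd0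
    unfolding weakly_differentiable_def by blast
  moreover have "AE x in lebesgue_on B. antisym_part ((xi \<circ> f0) x) = (xi \<circ> f0) x"
    using f0_sym by (intro AE_I2) (simp add: space_restrict_space antisym_part_def prod_eq_iff)
  ultimately have "has_trace (xi \<circ> f0) (\<lambda>x. antisym_part (T x))"
    by (rule has_trace_AE_cong[OF tr[OF T(2) wd0]])
  with tr[OF T(1) wd] show ?thesis unfolding same_trace_def by blast
qed

text \<open>Projection does not increase the Dirichlet energy, and it brings \<open>xi (u x)\<close>
  closer to the antisymmetric \<open>xi (v x)\<close> by exactly half the squared sum of the two
  entries. Minimality therefore makes that sum vanish almost everywhere.\<close>

lemma minimizer_antisym: "AE x in lebesgue_on B. xi (u x) = (- z x, z x)"
proof -
  let ?H = "\<lambda>x. antisym_part ((xi \<circ> u) x)"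
  have sH: "square_summable B ?H" by (rule square_summable_bounded_linear[OF ss bounded_linear_antisym_part])
  note lin = weak_partial_linear_AE[OF wd open_ball lmeasurable_ball bounded_linear_antisym_part]
  have "(\<Sum>i\<in>UNIV. LINT x|lebesgue_on B. (norm (W i x))\<^sup>2)
      + c * (LINT x|lebesgue_on B. (norm (xi (v x) - xi (u x)))\<^sup>2)
    \<le> (\<Sum>i\<in>UNIV. LINT x|lebesgue_on B. (norm (antisym_part (W i x)))\<^sup>2)
      + c * (LINT x|lebesgue_on B. (norm (xi (v x) - ?H x))\<^sup>2)"
  proof (rule le_competitor[OF sH _ _ _ same_trace_antisym])
    show "square_summable B (\<lambda>x. antisym_part (W i x))" "has_weak_partial B i ?H (\<lambda>x. antisym_part (W i x))" for i
      using lin(1,2) by (auto simp: W_def)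
    show "AE x in lebesgue_on B. fst (?H x) \<le> snd (?H x)"
      using xi_ordered by (intro AE_I2) (simp add: antisym_part_def)
  qed
  moreover have "(\<Sum>i\<in>UNIV. LINT x|lebesgue_on B. (norm (antisym_part (W i x)))\<^sup>2) \<le>
      (\<Sum>i\<in>UNIV. LINT x|lebesgue_on B. (norm (W i x))\<^sup>2)"
    by (intro sum_mono integral_mono' square_summable_norm2[OF W(1)]) (auto intro: power_mono norm_antisym_part_le)
  ultimately have "c * (LINT x|lebesgue_on B. (norm (xi (v x) - xi (u x)))\<^sup>2) \<le>
      c * (LINT x|lebesgue_on B. (norm (xi (v x) - ?H x))\<^sup>2)" by linarith
  then have le: "(LINT x|lebesgue_on B. (norm (xi (v x) - xi (u x)))\<^sup>2) \<le> (LINT x|lebesgue_on B. (norm (xi (v x) - ?H x))\<^sup>2)"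
    using c_pos by simp
  have i1: "integrable (lebesgue_on B) (\<lambda>x. (norm (xi (v x) - xi (u x)))\<^sup>2)"
    using square_summable_norm2[OF square_summable_diff[OF v_ss ss]] by simp
  have i2: "integrable (lebesgue_on B) (\<lambda>x. (norm (xi (v x) - ?H x))\<^sup>2)"
    using square_summable_norm2[OF square_summable_diff[OF v_ss sH]] by simp
  define D where "D x = (norm (xi (v x) - xi (u x)))\<^sup>2 - (norm (xi (v x) - ?H x))\<^sup>2" for x
  have iD: "integrable (lebesgue_on B) D" unfolding D_def[abs_def] using i1 i2 by simp
  have D: "D x = (fst (xi (u x)) + snd (xi (u x)))\<^sup>2 / 2" if "x \<in> B" for x
    using norm_antisym_part_split[of "xi (v x)" "xi (u x)"] v_eq[OF that] by (simp add: D_def)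
  have nn: "AE x in lebesgue_on B. 0 \<le> D x"
    by (intro AE_I2) (simp add: D space_restrict_space)
  have "(LINT x|lebesgue_on B. D x) \<le> 0" unfolding D_def using i1 i2 le by simp
  then have "(LINT x|lebesgue_on B. D x) = 0" using integral_nonneg_AE[OF nn] by simp
  then have "AE x in lebesgue_on B. D x = 0" using integral_nonneg_eq_0_iff_AE[OF iD nn] by simp
  then show ?thesis using AE_space
    by eventually_elim (auto simp: D space_restrict_space z_def prod_eq_iff field_simps)
qed

text \<open>The competitor is \<open>xi \<circ> u\<close> shifted by \<open>t * \<phi>\<close> in
  the direction \<open>(-1, 1)\<close>; it is ordered precisely where \<open>z + t * \<phi>\<close>
  is nonnegative. Its energy is a quadratic polynomial in \<open>t\<close>, and \<open>b\<close>
  depends on \<open>\<phi>\<close> but not on \<open>t\<close>, so that \<open>t\<close> may later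
  tend to 0.\<close>

lemma first_variation:
  assumes \<phi>: "test_function B \<phi>"
  shows "\<exists>b. \<forall>t. (AE x in lebesgue_on B. 0 \<le> z x + t * \<phi> x) \<longrightarrow>
    0 \<le> t * (- (LINT x|lebesgue_on B. laplacian \<phi> x * z x) - c * (LINT x|lebesgue_on B. \<phi> x * (w x - z x))) + t\<^sup>2 * b"
proof -
  define e :: "real \<times> real" where "e = (-1, 1)"
  let ?\<mu> = "lebesgue_on B"
  let ?G = "\<lambda>i x. partial_deriv i \<phi> x *\<^sub>R e"
  have sG: "square_summable B (?G i)" for i
    by (rule square_summable_test_function[OF test_function_partial_deriv[OF \<phi>]]) simp
  have s\<phi>: "square_summable B (\<lambda>x. - (\<phi> x *\<^sub>R e))"
    by (rule square_summable_uminus[OF square_summable_test_function[OF \<phi>]]) simp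
  have svu: "square_summable B (\<lambda>x. xi (v x) - xi (u x))"
    using square_summable_diff[OF v_ss ss] by simp
  have iU: "integrable ?\<mu> (xi \<circ> u)" by (rule square_summable_integrable[OF ss]) simp
  have ue: "xi (u x) \<bullet> e = 2 * z x" for x by (simp add: e_def z_def inner_prod_def)
  have iz: "integrable ?\<mu> z"
  proof -
    have "integrable ?\<mu> (\<lambda>x. (xi \<circ> u) x \<bullet> e / 2)" using iU by (intro integrable_divide integrable_inner_left)
    then show ?thesis by (simp add: ue)
  qed
  \<comment> \<open>The derivative \<open>partial_deriv i \<phi>\<close> is itself a test function,
    so the definition of the weak derivative moves the second derivative onto \<open>\<phi>\<close>
    too, leaving only the component of \<open>xi \<circ> u\<close> along \<open>e\<close>, which is
    \<open>2 * z\<close>.\<close>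
  have WG: "(LINT x|?\<mu>. W i x \<bullet> ?G i x) = - 2 * (LINT x|?\<mu>. partial_deriv i (partial_deriv i \<phi>) x * z x)" for i
  proof -
    note \<phi>i = test_function_partial_deriv[OF \<phi>, of i]
    note \<phi>ii = test_function_partial_deriv[OF \<phi>i, of i]
    have "(LINT x|?\<mu>. W i x \<bullet> ?G i x) = (LINT x|?\<mu>. (partial_deriv i \<phi> x *\<^sub>R W i x) \<bullet> e)" by simp
    also have "\<dots> = (LINT x|?\<mu>. partial_deriv i \<phi> x *\<^sub>R W i x) \<bullet> e"
      by (intro integral_inner_left integrable_test_function_scaleR[OF _ \<phi>i] square_summable_integrable[OF W(1)]) simp
    also have "\<dots> = - (LINT x|?\<mu>. partial_deriv i (partial_deriv i \<phi>) x *\<^sub>R (xi \<circ> u) x) \<bullet> e"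
      using W(2)[of i] \<phi>i unfolding has_weak_partial_def by simp
    also have "\<dots> = - (LINT x|?\<mu>. (partial_deriv i (partial_deriv i \<phi>) x *\<^sub>R (xi \<circ> u) x) \<bullet> e)"
      using integral_inner_left[OF integrable_test_function_scaleR[OF iU \<phi>ii], of e] by simp
    also have "\<dots> = - (LINT x|?\<mu>. 2 * (partial_deriv i (partial_deriv i \<phi>) x * z x))" by (simp add: ue mult.left_commute)
    finally show ?thesis by simp
  qed
  have lap: "(\<Sum>i\<in>UNIV. LINT x|?\<mu>. W i x \<bullet> ?G i x) = - 2 * (LINT x|?\<mu>. laplacian \<phi> x * z x)"
  proof -
    have "integrable ?\<mu> (\<lambda>x. partial_deriv i (partial_deriv i \<phi>) x * z x)" for i
      using integrable_test_function_scaleR[OF iz test_function_partial_deriv[OF test_function_partial_deriv[OF \<phi>]]]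
      by simp
    then have "(LINT x|?\<mu>. laplacian \<phi> x * z x) = (\<Sum>i\<in>UNIV. LINT x|?\<mu>. partial_deriv i (partial_deriv i \<phi>) x * z x)"
      unfolding laplacian_def sum_distrib_right by (intro Bochner_Integration.integral_sum)
    then show ?thesis unfolding WG by (simp add: sum_distrib_left)
  qed
  have vu: "(LINT x|?\<mu>. (xi (v x) - xi (u x)) \<bullet> - (\<phi> x *\<^sub>R e)) = - 2 * (LINT x|?\<mu>. \<phi> x * (w x - z x))"
  proof -
    have "(LINT x|?\<mu>. (xi (v x) - xi (u x)) \<bullet> - (\<phi> x *\<^sub>R e)) = (LINT x|?\<mu>. - 2 * (\<phi> x * (w x - z x)))"
    proof (rule Bochner_Integration.integral_cong[OF refl])
      fix x assume "x \<in> space ?\<mu>"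
      then have "xi (v x) \<bullet> e = 2 * w x" by (simp add: space_restrict_space v_eq e_def)
      then show "(xi (v x) - xi (u x)) \<bullet> - (\<phi> x *\<^sub>R e) = - 2 * (\<phi> x * (w x - z x))"
        by (simp add: inner_diff_left ue algebra_simps)
    qed
    then show ?thesis by simp
  qed
  \<comment> \<open>The linear part of the energy difference comes out as 4 times the bracket in the
    claim: a 2 from expanding the square and a 2 from the two entries of the pair. Hence the
    division by 4.\<close>
  define b where "b = ((\<Sum>i\<in>UNIV. LINT x|?\<mu>. (norm (?G i x))\<^sup>2) + c * (LINT x|?\<mu>. (norm (- (\<phi> x *\<^sub>R e)))\<^sup>2)) / 4"
  show ?thesis
  proof (intro exI[of _ b] allI impI)
    fix t assume ord: "AE x in ?\<mu>. 0 \<le> z x + t * \<phi> x"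
    let ?H = "\<lambda>x. (xi \<circ> u) x + \<phi> x *\<^sub>R (t *\<^sub>R e)"
    let ?F = "\<lambda>i x. W i x + t *\<^sub>R ?G i x"
    note pert = weak_partial_perturb_AE[OF wd open_ball lmeasurable_ball \<phi>, of _ "t *\<^sub>R e", folded W_def]
    have F_eq: "(\<lambda>x. W i x + partial_deriv i \<phi> x *\<^sub>R t *\<^sub>R e) = ?F i" for i by (simp add: mult.commute)
    have "(\<Sum>i\<in>UNIV. LINT x|?\<mu>. (norm (W i x))\<^sup>2) + c * (LINT x|?\<mu>. (norm (xi (v x) - xi (u x)))\<^sup>2)
      \<le> (\<Sum>i\<in>UNIV. LINT x|?\<mu>. (norm (?F i x))\<^sup>2) + c * (LINT x|?\<mu>. (norm (xi (v x) - ?H x))\<^sup>2)"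
    proof (rule le_competitor)
      show "square_summable B ?H"
        by (rule square_summable_add[OF ss square_summable_test_function[OF \<phi>]]) simp
      show "square_summable B (?F i)" "has_weak_partial B i ?H (?F i)" for i
        using pert(1,2)[of i] unfolding F_eq by auto
      show "AE x in ?\<mu>. fst (?H x) \<le> snd (?H x)"
        using ord by eventually_elim (simp add: e_def z_def field_simps)
      show "same_trace ?H (xi \<circ> f0)"
        using u(3) has_trace_perturb[OF _ wd \<phi>] unfolding same_trace_def by blast
    qed
    also have "(\<Sum>i\<in>UNIV. LINT x|?\<mu>. (norm (?F i x))\<^sup>2) = (\<Sum>i\<in>UNIV. LINT x|?\<mu>. (norm (W i x))\<^sup>2)
        + 2 * t * (\<Sum>i\<in>UNIV. LINT x|?\<mu>. W i x \<bullet> ?G i x) + t\<^sup>2 * (\<Sum>i\<in>UNIV. LINT x|?\<mu>. (norm (?G i x))\<^sup>2)"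
      unfolding integral_norm2_perturb[OF W(1) sG] by (simp only: sum.distrib sum_distrib_left)
    also have "(LINT x|?\<mu>. (norm (xi (v x) - ?H x))\<^sup>2) =
        (LINT x|?\<mu>. (norm ((xi (v x) - xi (u x)) + t *\<^sub>R (- (\<phi> x *\<^sub>R e))))\<^sup>2)"
      by (simp add: algebra_simps)
    also have "\<dots> = (LINT x|?\<mu>. (norm (xi (v x) - xi (u x)))\<^sup>2)
        + 2 * t * (LINT x|?\<mu>. (xi (v x) - xi (u x)) \<bullet> - (\<phi> x *\<^sub>R e)) + t\<^sup>2 * (LINT x|?\<mu>. (norm (- (\<phi> x *\<^sub>R e)))\<^sup>2)"
      by (rule integral_norm2_perturb[OF svu s\<phi>])
    finally show "0 \<le> t * (- (LINT x|?\<mu>. laplacian \<phi> x * z x) - c * (LINT x|?\<mu>. \<phi> x * (w x - z x))) + t\<^sup>2 * b"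
      unfolding lap vu by (simp add: b_def algebra_simps)
  qed
qed

end


section \<open>From the first variation to positivity and continuity of the minimizer\<close>

lemma linear_coefficient_nonneg:
  fixes a b \<delta> :: real
  assumes "\<delta> > 0" "\<And>t. 0 < t \<Longrightarrow> t \<le> \<delta> \<Longrightarrow> 0 \<le> t * a + t\<^sup>2 * b"
  shows "0 \<le> a"
proof (rule ccontr)
  assume "\<not> 0 \<le> a"
  \<comment> \<open>Chosen so small that the quadratic term can offset at most half of the negative
    linear term.\<close>
  define t where "t = min \<delta> (- a / (2 * (\<bar>b\<bar> + 1)))"
  have "0 < - a / (2 * (\<bar>b\<bar> + 1))"
    using \<open>\<not> 0 \<le> a\<close> by (intro divide_pos_pos) auto
  then have t: "0 < t" "t \<le> \<delta>" "t \<le> - a / (2 * (\<bar>b\<bar> + 1))"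
    using assms(1) by (auto simp only: t_def min_less_iff_conj min.cobounded1 min.cobounded2)
  have "t * b \<le> t * (\<bar>b\<bar> + 1)" using t(1) by (intro mult_left_mono) auto
  also have "\<dots> \<le> - a / 2" using t(3) by (simp add: field_simps)
  finally have "a + t * b < 0" using \<open>\<not> 0 \<le> a\<close> by simp
  then have "t * (a + t * b) < 0" using t(1) by (simp add: mult_pos_neg)
  then show False using assms(2)[OF t(1,2)] by (simp add: algebra_simps power2_eq_square)
qed

context minimizing_step
begin

lemma z_integrable: "integrable (lebesgue_on B) z"
proof -
  have iU: "integrable (lebesgue_on B) (xi \<circ> u)" by (rule square_summable_integrable[OF ss]) simp
  have "integrable (lebesgue_on B) (\<lambda>x. (snd ((xi \<circ> u) x) - fst ((xi \<circ> u) x)) / 2)"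
    by (intro integrable_divide Bochner_Integration.integrable_diff
        integrable_bounded_linear[OF bounded_linear_fst iU] integrable_bounded_linear[OF bounded_linear_snd iU])
  then show ?thesis by (simp add: z_def[abs_def])
qed

lemma w_integrable: "integrable (lebesgue_on B) w"
proof -
  have "integrable (lebesgue_on B) (xi \<circ> v)" by (rule square_summable_integrable[OF v_ss]) simp
  then have "integrable (lebesgue_on B) (\<lambda>x. snd ((xi \<circ> v) x))"
    by (rule integrable_bounded_linear[OF bounded_linear_snd])
  also have "integrable (lebesgue_on B) (\<lambda>x. snd ((xi \<circ> v) x)) \<longleftrightarrow> integrable (lebesgue_on B) w"
    by (rule Bochner_Integration.integrable_cong) (simp_all add: v_eq space_restrict_space)
  finally show ?thesis .
qed

lemma variational_inequality_z:
  assumes "continuous_on B w" "\<And>x. x \<in> B \<Longrightarrow> w x \<ge> 0" "\<exists>x\<in>B. w x \<noteq> 0"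
  shows "variational_inequality B z w c"
proof
  show "open B" "connected B" "B \<in> lmeasurable" by auto
  show "c > 0" by (rule c_pos)
  show "integrable (lebesgue_on B) z" by (rule z_integrable)
  show "integrable (lebesgue_on B) w" by (rule w_integrable)
  show "0 \<le> z x" for x by (rule z_nonneg)
  show "continuous_on B w" "\<And>x. x \<in> B \<Longrightarrow> 0 \<le> w x" "\<exists>x\<in>B. w x \<noteq> 0" by fact+
  show "c * (LINT x|lebesgue_on B. \<phi> x * (w x - z x)) \<le> - (LINT x|lebesgue_on B. laplacian \<phi> x * z x)"
    if \<phi>: "test_function B \<phi>" and nn: "\<And>x. \<phi> x \<ge> 0" for \<phi>
  proof -
    obtain b where b: "\<And>t. AE x in lebesgue_on B. 0 \<le> z x + t * \<phi> x \<Longrightarrow>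
      0 \<le> t * (- (LINT x|lebesgue_on B. laplacian \<phi> x * z x) - c * (LINT x|lebesgue_on B. \<phi> x * (w x - z x))) + t\<^sup>2 * b"
      using first_variation[OF \<phi>] by blast
    have "0 \<le> - (LINT x|lebesgue_on B. laplacian \<phi> x * z x) - c * (LINT x|lebesgue_on B. \<phi> x * (w x - z x))"
      by (rule linear_coefficient_nonneg[of 1, OF _ b]) (simp_all add: z_nonneg nn)
    then show ?thesis by simp
  qed
  show "c * (LINT x|lebesgue_on B. \<phi> x * (w x - z x)) = - (LINT x|lebesgue_on B. laplacian \<phi> x * z x)"
    if \<phi>: "test_function B \<phi>" and \<delta>: "\<delta> > 0" "AE x in lebesgue_on B. \<phi> x \<noteq> 0 \<longrightarrow> \<delta> \<le> z x" for \<phi> \<delta>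
  proof -
    let ?a = "- (LINT x|lebesgue_on B. laplacian \<phi> x * z x) - c * (LINT x|lebesgue_on B. \<phi> x * (w x - z x))"
    obtain b where b: "\<And>t. AE x in lebesgue_on B. 0 \<le> z x + t * \<phi> x \<Longrightarrow> 0 \<le> t * ?a + t\<^sup>2 * b"
      using first_variation[OF \<phi>] by blast
    obtain C where C: "\<And>x. \<bar>\<phi> x\<bar> \<le> C" using test_function_bounded[OF \<phi>] by blast
    have "0 \<le> C" using C[of 0] by simp
    \<comment> \<open>Such \<open>t\<close> change \<open>z\<close> by at most
      \<open>\<delta>\<close>, and only where \<open>z\<close> is at least \<open>\<delta>\<close>;
      elsewhere \<open>\<phi>\<close> is 0. The added 1 guards against \<open>C = 0\<close>.\<close>
    have small: "AE x in lebesgue_on B. 0 \<le> z x + t * \<phi> x" if "\<bar>t\<bar> \<le> \<delta> / (C + 1)" for t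
      using \<delta>(2)
    proof eventually_elim
      case (elim x)
      have "\<bar>t * \<phi> x\<bar> \<le> \<delta> / (C + 1) * (C + 1)"
        unfolding abs_mult using that C[of x] \<open>0 \<le> C\<close> \<open>\<delta> > 0\<close> by (intro mult_mono) auto
      then have "\<bar>t * \<phi> x\<bar> \<le> \<delta>" using \<open>0 \<le> C\<close> by simp
      then show ?case using elim z_nonneg[of x] by (cases "\<phi> x = 0") (auto simp: abs_le_iff)
    qed
    have pos: "\<delta> / (C + 1) > 0" using \<open>0 \<le> C\<close> \<delta>(1) by simp
    have "0 \<le> ?a" by (rule linear_coefficient_nonneg[OF pos b[OF small]]) simp
    \<comment> \<open>The smallness condition is symmetric in \<open>t\<close>, so
      \<open>- t\<close> is admissible too; this reverses the sign of the linear term and keeps the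
      quadratic one.\<close>
    moreover have "0 \<le> - ?a"
    proof (rule linear_coefficient_nonneg[OF pos, of _ b])
      fix t assume "0 < t" "t \<le> \<delta> / (C + 1)"
      then have "\<bar>- t\<bar> \<le> \<delta> / (C + 1)" by simp
      from b[OF small[OF this]] show "0 \<le> t * - ?a + t\<^sup>2 * b"
        by (simp only: mult_minus_left mult_minus_right power2_minus)
    qed
    ultimately show ?thesis by simp
  qed
qed

text \<open>Near each point \<open>xi \<circ> u\<close> agrees almost everywhere with a continuous
  function, whose averages converge everywhere to its values. Strict definedness turns this into
  equality at every point. The local representatives need no patching, since all of them coincide
  with the second entry of \<open>xi (u x)\<close>.\<close>

lemma positive_minimizer:
  assumes "continuous_on B w" "\<And>x. x \<in> B \<Longrightarrow> w x \<ge> 0" "\<exists>x\<in>B. w x \<noteq> 0"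
  shows "\<exists>w'. continuous_on B w' \<and> (\<forall>x\<in>B. w' x > 0 \<and> xi (u x) = (- w' x, w' x))"
proof -
  interpret vi: variational_inequality B z w c by (rule variational_inequality_z) fact+
  define w' where "w' x = snd (xi (u x))" for x
  have rep: "\<exists>\<eta> a. \<eta> > 0 \<and> continuous_on (ball x0 \<eta>) a \<and>
    (\<forall>x\<in>ball x0 \<eta>. a x > 0 \<and> xi (u x) = (- a x, a x))" if x0: "x0 \<in> B" for x0
  proof -
    obtain \<eta> a where \<eta>: "\<eta> > 0" "ball x0 \<eta> \<subseteq> B" and a: "continuous_on (ball x0 \<eta>) a"
      "\<And>x. x \<in> ball x0 \<eta> \<Longrightarrow> a x > 0" "AE x in lebesgue_on B. x \<in> ball x0 \<eta> \<longrightarrow> z x = a x"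
      using vi.continuous_representative[OF x0] by blast
    let ?a = "\<lambda>x. (- a x, a x)"
    have ca: "continuous_on (ball x0 \<eta>) ?a" using a(1) by (intro continuous_intros)
    have "AE x in lebesgue_on B. x \<in> ball x0 \<eta> \<longrightarrow> ?a x = (xi \<circ> u) x"
      using a(3) minimizer_antisym by eventually_elim simp
    then have "AE x in lebesgue. x \<in> B \<longrightarrow> x \<in> ball x0 \<eta> \<longrightarrow> ?a x = (xi \<circ> u) x"
      by (subst (asm) AE_restrict_space_iff) auto
    then have "AE x in lebesgue. x \<in> ball x0 \<eta> \<longrightarrow> ?a x = (xi \<circ> u) x"
      by eventually_elim (use \<eta>(2) in blast)
    then have ae: "AE x in lebesgue_on (ball x0 \<eta>). ?a x = (xi \<circ> u) x"
      by (subst AE_restrict_space_iff) auto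
    have "xi (u x) = ?a x" if x: "x \<in> ball x0 \<eta>" for x
    proof -
      have "averages_tend_to (xi \<circ> u) x (?a x)"
      proof (rule averages_tend_to_AE_cong[OF open_ball _ ae x])
        show "?a \<in> borel_measurable (lebesgue_on (ball x0 \<eta>))"
          by (rule continuous_imp_measurable_on_sets_lebesgue[OF ca]) simp
        show "averages_tend_to ?a x (?a x)" by (rule averages_tend_to_continuous[OF open_ball x ca])
      qed
      then show ?thesis using u(2) x \<eta>(2) unfolding strictly_defined_iff by blast
    qed
    then show ?thesis using \<eta> a by blast
  qed
  have "isCont w' x0" if x0: "x0 \<in> B" for x0
  proof -
    obtain \<eta> a where \<eta>: "\<eta> > 0" "continuous_on (ball x0 \<eta>) a" "\<And>x. x \<in> ball x0 \<eta> \<Longrightarrow> xi (u x) = (- a x, a x)"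
      using rep[OF x0] by blast
    then have "continuous_on (ball x0 \<eta>) w'"
      by (subst continuous_on_cong[OF refl, of _ _ a]) (auto simp: w'_def)
    then show ?thesis using \<eta>(1) by (simp add: continuous_on_eq_continuous_at)
  qed
  then have "continuous_on B w'" by (simp add: continuous_at_imp_continuous_on)
  moreover have "w' x > 0 \<and> xi (u x) = (- w' x, w' x)" if x: "x \<in> B" for x
  proof -
    obtain \<eta> a where "\<eta> > 0" "\<forall>y\<in>ball x \<eta>. a y > 0 \<and> xi (u y) = (- a y, a y)"
      using rep[OF x] by blast
    then have "a x > 0 \<and> xi (u x) = (- a x, a x)" by simp
    then show ?thesis by (simp add: w'_def)
  qed
  ultimately show ?thesis by blast
qed

end

section \<open>Induction along the step minimizing sequence\<close>

lemma Upair_of_xi: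
  assumes "xi p = (- a, a)"
  shows "p = Upair a (- a)"
proof (cases p)
  case (Upair b c)
  have m: "min b c = - a" "max b c = a" using assms unfolding Upair by simp_all
  show ?thesis
  proof (cases "b \<le> c")
    case True
    then have "b = - a" "c = a" using m by linarith+
    then show ?thesis unfolding Upair by (simp add: Upair_inject)
  next
    case False
    then have "c = - a" "b = a" using m by linarith+
    then show ?thesis unfolding Upair by simp
  qed
qed

theorem theorem8p3:
  fixes g :: "real ^ 'm::finite \<Rightarrow> real"
    and f0 :: "real ^ 'm \<Rightarrow> real uprod"
    and f :: "nat \<Rightarrow> real ^ 'm \<Rightarrow> real uprod"
    and h :: real
  assumes "smooth_on (cball 0 1) g"
    and "\<forall>x\<in>cball 0 1. g x \<ge> 0"
    and "\<exists>x\<in>cball 0 1. g x \<noteq> 0"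
    and "\<forall>x\<in>cball 0 1. f0 x = Upair (g x) (- g x)"
    and "f0 \<in> Y2"
    and "h > 0"
    and "step_minimizing_sequence f0 h f"
  shows "(\<exists>ft :: nat \<Rightarrow> real ^ 'm \<Rightarrow> real.
            \<forall>k\<ge>1. \<forall>x\<in>ball 0 1. f k x = Upair (ft k x) (- ft k x) \<and> ft k x > 0)
         \<and> (\<forall>k\<ge>1. \<forall>x\<in>ball 0 1. f k x \<noteq> Upair 0 0)"
proof -
  let ?B = "ball (0 :: real ^ 'm) 1"
  have sub: "x \<in> cball 0 1" if "x \<in> ?B" for x using that by simp
  have f0_eq: "xi (f0 x) = (- g x, g x)" if "x \<in> ?B" for x
  proof -
    have "g x \<ge> 0" "f0 x = Upair (g x) (- g x)" using assms(2,4) sub[OF that] by blast+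
    then show ?thesis by (auto simp: min_def max_def)
  qed
  have g_cont: "continuous_on (cball 0 1) g" by (rule smooth_on_continuous_on[OF assms(1)])
  \<comment> \<open>The given point with \<open>g x \<noteq> 0\<close> may lie on the sphere; by
    continuity, \<open>g\<close> cannot vanish throughout the open ball without vanishing on its
    closure.\<close>
  have g_nontrivial: "\<exists>x\<in>?B. g x \<noteq> 0"
  proof (rule ccontr)
    assume "\<not> (\<exists>x\<in>?B. g x \<noteq> 0)"
    then have "g x = 0" if "x \<in> cball 0 1" for x
      using continuous_constant_on_closure[of ?B g 0 x] g_cont that by auto
    then show False using assms(3) by blast
  qed
  \<comment> \<open>The invariant asks for nonnegativity and nontriviality rather than positivity,
    because \<open>g\<close> may have zeros in the ball; it must hold for step 0, whereas positivity
    is gained from step 1 on.\<close>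
  define Inv where "Inv u w \<longleftrightarrow> continuous_on ?B w \<and> (\<forall>x\<in>?B. w x \<ge> 0) \<and> (\<exists>x\<in>?B. w x \<noteq> 0) \<and>
    (\<forall>x\<in>?B. xi (u x) = (- w x, w x)) \<and> square_summable ?B (xi \<circ> u)" for u w
  have step: "\<exists>w'. Inv (f (Suc k)) w' \<and> (\<forall>x\<in>?B. w' x > 0)" if "Inv (f k) w" for k w
  proof -
    have min: "is_arg_min (\<lambda>u. step_functional (Suc k) (f k) u h) (\<lambda>u. u \<in> admissible f0) (f (Suc k))"
      using assms(7)[unfolded step_minimizing_sequence_def, THEN conjunct2, rule_format, of "Suc k"] by simp
    have I: "continuous_on ?B w" "\<forall>x\<in>?B. w x \<ge> 0" "\<exists>x\<in>?B. w x \<noteq> 0"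
      "\<forall>x\<in>?B. xi (f k x) = (- w x, w x)" "square_summable ?B (xi \<circ> f k)"
      using that unfolding Inv_def by blast+
    interpret minimizing_step f0 "f k" "f (Suc k)" w h "Suc k"
    proof
      show "fst (xi (f0 x)) = - snd (xi (f0 x))" if "x \<in> ?B" for x using f0_eq[OF that] by simp
      show "square_summable ?B (xi \<circ> f k)" by (rule I(5))
      show "xi (f k x) = (- w x, w x)" if "x \<in> ?B" for x by (rule bspec[OF I(4) that])
    qed (rule assms(6), rule assms(5), rule min)
    obtain w' where w': "continuous_on ?B w'" "\<And>x. x \<in> ?B \<Longrightarrow> w' x > 0 \<and> xi (f (Suc k) x) = (- w' x, w' x)"
      using positive_minimizer[OF I(1) _ I(3)] I(2) by blast
    have "\<exists>x\<in>?B. w' x \<noteq> 0" using w'(2)[of 0] by (intro bexI[of _ 0]) auto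
    moreover have "\<forall>x\<in>?B. w' x \<ge> 0" using w'(2) less_imp_le by blast
    ultimately have "Inv (f (Suc k)) w'" unfolding Inv_def using w'(1) ss by (intro conjI ballI) (use w'(2) in blast)+
    then show ?thesis using w'(2) by blast
  qed
  have inv: "\<exists>w. Inv (f k) w" for k
  proof (induction k)
    case 0
    have "f 0 x = f0 x" if "x \<in> cball 0 1" for x
      using assms(7) that by (simp add: step_minimizing_sequence_def)
    then have eq: "xi (f0 x) = xi (f 0 x)" if "x \<in> ?B" for x using sub[OF that] by simp
    have "square_summable ?B (xi \<circ> f0)" using assms(5) by (simp add: Y2_iff weakly_differentiable_def)
    then have "square_summable ?B (xi \<circ> f 0)"
      by (rule square_summable_AE_cong[rotated]) (auto simp: eq space_restrict_space intro!: AE_I2)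
    moreover have "continuous_on ?B g" using g_cont ball_subset_cball by (rule continuous_on_subset)
    moreover have "xi (f 0 x) = (- g x, g x)" if "x \<in> ?B" for x using eq[OF that] f0_eq[OF that] by simp
    ultimately have "Inv (f 0) g" unfolding Inv_def using assms(2) g_nontrivial sub by blast
    then show ?case by blast
  next
    case (Suc k)
    then show ?case using step by blast
  qed
  have pos: "\<exists>a>0. xi (f k x) = (- a, a)" if k: "k \<ge> 1" and x: "x \<in> ?B" for k x
  proof -
    obtain j where j: "k = Suc j" using k by (cases k) auto
    obtain w where "Inv (f j) w" using inv by blast
    then obtain w' where "Inv (f k) w'" "\<forall>x\<in>?B. w' x > 0" using step unfolding j by blast
    then show ?thesis using x unfolding Inv_def by blast
  qed
  \<comment> \<open>The larger entry of the pair is a witness that involves no choice, so one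
    function serves for all \<open>k\<close> and \<open>x\<close>.\<close>
  have "f k x = Upair (snd (xi (f k x))) (- snd (xi (f k x))) \<and> snd (xi (f k x)) > 0"
    if k: "k \<ge> 1" and x: "x \<in> ?B" for k x
  proof -
    obtain a where "a > 0" "xi (f k x) = (- a, a)" using pos[OF k x] by blast
    then show ?thesis using Upair_of_xi[of "f k x" a] by simp
  qed
  moreover have "f k x \<noteq> Upair 0 0" if "k \<ge> 1" "x \<in> ?B" for k x
    using pos[OF that] by auto
  ultimately show ?thesis by (intro conjI exI[of _ "\<lambda>k x. snd (xi (f k x))"]) blast+
qed

end
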